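(* Let $\Gamma$ be an ordered group, $\Lambda\subseteq\Gamma$ a subset, and $FR$ a $\Gamma$-filtered ring. The embedding $\phi\colon\operatorname{Glid}_\Lambda FR\to\operatorname{Prefrag}_\Lambda FR$ reflects conflations, i.e. a sequence $K\xrightarrow{f}M\xrightarrow{g}N$ in $\operatorname{Glid}_\Lambda FR$ is a conflation if and only if $\phi(K)\xrightarrow{\phi(f)}\phi(M)\xrightarrow{\phi(g)}\phi(N)$ is a conflation in $\operatorname{Prefrag}_\Lambda FR$.
   Context: Rings are unital. An ordered group $(\Gamma,\le)$ is a group with a (partial) order such that $\alpha\le\beta$ and $\gamma\le\delta$ imply $\alpha\gamma\le\beta\delta$; its unit is $e$. A $\Gamma$-filtered ring $FR$ is a ring $R$ with additive subgroups $\{F_\gamma R\}_{\gamma\in\Gamma}$ such that $1_R\in F_eR$, $F_\alpha R\subseteq F_\beta R$ if $\alpha\le\beta$, and $(F_\alpha R)(F_\beta R)\subseteq F_{\alpha\beta}R$. The preadditive category $\mathcal F_\Lambda R$ has object set $\Lambda$ and $\operatorname{Hom}(\alpha,\beta)=F_{\beta\alpha^{-1}}R$ if $\alpha\le\beta$, and $0$ otherwise; composition is multiplication in $R$. The preadditive category $\overline{\mathcal F}_\Lambda R$ has object set $\Lambda\sqcup\{\infty\}$, contains $\mathcal F_\Lambda R$ as a full subcategory, and has $\operatorname{Hom}(\alpha,\infty)=R$ for all $\alpha\in\Lambda\sqcup\{\infty\}$ and $\operatorname{Hom}(\infty,\alpha)=0$ for $\alpha\in\Lambda$. If $\alpha\le\beta$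 or $\beta=\infty$, write $1_{\alpha,\beta}$ for $1_R\in\operatorname{Hom}(\alpha,\beta)$. $\operatorname{Mod}$ denotes additive covariant functors to abelian groups. $\operatorname{Prefrag}_\Lambda FR\subseteq\operatorname{Mod}\mathcal F_\Lambda R$ is the full subcategory of those $M$ such that $M(1_{\alpha,\beta})$ is a monomorphism for all $\alpha\le\beta$ in $\Lambda$. $\operatorname{Preglid}_\Lambda FR\subseteq\operatorname{Mod}\overline{\mathcal F}_\Lambda R$ is the full subcategory of those $M$ such that $M(1_{\alpha,\beta})$ is a monomorphism for all $\alpha,\beta\in\Lambda\sqcup\{\infty\}$ with $\alpha\le\beta$ or $\beta=\infty$. Both are quasi-abelian, with all kernel-cokernel pairs as conflations. With $\Sigma$ the class of morphisms $f$ of $\operatorname{Preglid}_\Lambda FR$ such that $f_\lambda$ is an isomorphism for all $\lambda\in\Lambda$, $\operatorname{Glid}_\Lambda FR=(\operatorname{Preglid}_\Lambda FR)[\Sigma^{-1}]$, with localization functor $Q$. The conflations of $\operatorname{Glid}_\Lambda FR$ are given by the weakest conflation structure for which $Q$ maps conflations to conflations, i.e. they are the sequences isomorphic to images under $Q$ of conflations of $\operatorname{Preglid}_\Lambda FR$; this makes $\operatorname{Glid}_\Lambda FR$ a deflation-exact category. The functor $\phi$ is the unique functor such that $\phi\circ Q$ is the restriction functor along $\mathcal F_\Lambda R\subseteq\overline{\mathcal F}_\Lambda R$; it is fully faithful. *)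

theory Defs
  imports "HOL-Algebra.AbelCoset"
begin

section \<open>Categories\<close>

text \<open>Hom-sets need not be disjoint, so identities, composition and the action of functors on
  arrows carry the objects explicitly: \<open>cmp C A B D g f\<close> is the composite of
  \<open>f : A \<rightarrow> B\<close> and \<open>g : B \<rightarrow> D\<close>.\<close>

record ('o, 'a) cat =
  Ob :: "'o set"
  Hom :: "'o \<Rightarrow> 'o \<Rightarrow> 'a set"
  idn :: "'o \<Rightarrow> 'a"
  cmp :: "'o \<Rightarrow> 'o \<Rightarrow> 'o \<Rightarrow> 'a \<Rightarrow> 'a \<Rightarrow> 'a"

record ('o, 'a) pcat = "('o, 'a) cat" +
  hadd :: "'o \<Rightarrow> 'o \<Rightarrow> 'a \<Rightarrow> 'a \<Rightarrow> 'a"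
  hzero :: "'o \<Rightarrow> 'o \<Rightarrow> 'a"

definition hom_group :: "('o, 'a, 'x) pcat_scheme \<Rightarrow> 'o \<Rightarrow> 'o \<Rightarrow> 'a monoid" where
  "hom_group C A B = \<lparr>carrier = Hom C A B, mult = hadd C A B, one = hzero C A B\<rparr>"

locale category =
  fixes C :: "('o, 'a, 'x) cat_scheme"
  assumes idn_in: "A \<in> Ob C \<Longrightarrow> idn C A \<in> Hom C A A"
    and cmp_in: "\<lbrakk>A \<in> Ob C; B \<in> Ob C; D \<in> Ob C; f \<in> Hom C A B; g \<in> Hom C B D\<rbrakk>
      \<Longrightarrow> cmp C A B D g f \<in> Hom C A D"
    and idn_right: "\<lbrakk>A \<in> Ob C; B \<in> Ob C; f \<in> Hom C A B\<rbrakk> \<Longrightarrow> cmp C A A B f (idn C A) = f"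
    and idn_left: "\<lbrakk>A \<in> Ob C; B \<in> Ob C; f \<in> Hom C A B\<rbrakk> \<Longrightarrow> cmp C A B B (idn C B) f = f"
    and cmp_assoc: "\<lbrakk>A \<in> Ob C; B \<in> Ob C; D \<in> Ob C; E \<in> Ob C;
        f \<in> Hom C A B; g \<in> Hom C B D; h \<in> Hom C D E\<rbrakk>
      \<Longrightarrow> cmp C A D E h (cmp C A B D g f) = cmp C A B E (cmp C B D E h g) f"

locale preadditive_category = category C for C :: "('o, 'a, 'x) pcat_scheme" +
  assumes hom_comm_group: "\<lbrakk>A \<in> Ob C; B \<in> Ob C\<rbrakk> \<Longrightarrow> comm_group (hom_group C A B)"
    and cmp_add_right: "\<lbrakk>A \<in> Ob C; B \<in> Ob C; D \<in> Ob C;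
        f \<in> Hom C A B; f' \<in> Hom C A B; g \<in> Hom C B D\<rbrakk>
      \<Longrightarrow> cmp C A B D g (hadd C A B f f') = hadd C A D (cmp C A B D g f) (cmp C A B D g f')"
    and cmp_add_left: "\<lbrakk>A \<in> Ob C; B \<in> Ob C; D \<in> Ob C;
        f \<in> Hom C A B; g \<in> Hom C B D; g' \<in> Hom C B D\<rbrakk>
      \<Longrightarrow> cmp C A B D (hadd C B D g g') f = hadd C A D (cmp C A B D g f) (cmp C A B D g' f)"

definition full_sub :: "('o, 'a, 'x) cat_scheme \<Rightarrow> 'o set \<Rightarrow> ('o, 'a, 'x) cat_scheme" where
  "full_sub C S = C\<lparr>Ob := Ob C \<inter> S\<rparr>"

definition is_iso_pair :: "('o, 'a, 'x) cat_scheme \<Rightarrow> 'o \<Rightarrow> 'o \<Rightarrow> 'a \<Rightarrow> 'a \<Rightarrow> bool" where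
  "is_iso_pair C A B f g \<longleftrightarrow> f \<in> Hom C A B \<and> g \<in> Hom C B A \<and>
     cmp C A B A g f = idn C A \<and> cmp C B A B f g = idn C B"

definition is_iso_arr :: "('o, 'a, 'x) cat_scheme \<Rightarrow> 'o \<Rightarrow> 'o \<Rightarrow> 'a \<Rightarrow> bool" where
  "is_iso_arr C A B f \<longleftrightarrow> (\<exists>g. is_iso_pair C A B f g)"

record ('o, 'a, 'p, 'b) fctr =
  fob :: "'o \<Rightarrow> 'p"
  fmap :: "'o \<Rightarrow> 'o \<Rightarrow> 'a \<Rightarrow> 'b"

definition is_functor ::
  "('o, 'a, 'x) cat_scheme \<Rightarrow> ('p, 'b, 'y) cat_scheme \<Rightarrow> ('o, 'a, 'p, 'b) fctr \<Rightarrow> bool" where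
  "is_functor C D F \<longleftrightarrow>
     (\<forall>A\<in>Ob C. fob F A \<in> Ob D) \<and>
     (\<forall>A\<in>Ob C. \<forall>B\<in>Ob C. \<forall>f\<in>Hom C A B. fmap F A B f \<in> Hom D (fob F A) (fob F B)) \<and>
     (\<forall>A\<in>Ob C. fmap F A A (idn C A) = idn D (fob F A)) \<and>
     (\<forall>A\<in>Ob C. \<forall>B\<in>Ob C. \<forall>E\<in>Ob C. \<forall>f\<in>Hom C A B. \<forall>g\<in>Hom C B E.
        fmap F A E (cmp C A B E g f) =
        cmp D (fob F A) (fob F B) (fob F E) (fmap F B E g) (fmap F A B f))"

definition is_additive_functor ::
  "('o, 'a, 'x) pcat_scheme \<Rightarrow> ('p, 'b, 'y) pcat_scheme \<Rightarrow> ('o, 'a, 'p, 'b) fctr \<Rightarrow> bool" where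
  "is_additive_functor C D F \<longleftrightarrow> is_functor C D F \<and>
     (\<forall>A\<in>Ob C. \<forall>B\<in>Ob C. fmap F A B \<in> hom (hom_group C A B) (hom_group D (fob F A) (fob F B)))"

definition fctr_comp ::
  "('p, 'b, 'q, 'c) fctr \<Rightarrow> ('o, 'a, 'p, 'b) fctr \<Rightarrow> ('o, 'a, 'q, 'c) fctr" where
  "fctr_comp G F = \<lparr>fob = (\<lambda>A. fob G (fob F A)),
     fmap = (\<lambda>A B f. fmap G (fob F A) (fob F B) (fmap F A B f))\<rparr>"

definition fctr_eq ::
  "('o, 'a, 'x) cat_scheme \<Rightarrow> ('o, 'a, 'p, 'b) fctr \<Rightarrow> ('o, 'a, 'p, 'b) fctr \<Rightarrow> bool" where
  "fctr_eq C F G \<longleftrightarrow> (\<forall>A\<in>Ob C. fob F A = fob G A) \<and>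
     (\<forall>A\<in>Ob C. \<forall>B\<in>Ob C. \<forall>f\<in>Hom C A B. fmap F A B f = fmap G A B f)"

section \<open>Kernel-cokernel pairs\<close>

definition is_kernel ::
  "('o, 'a, 'x) pcat_scheme \<Rightarrow> 'o \<Rightarrow> 'a \<Rightarrow> 'o \<Rightarrow> 'a \<Rightarrow> 'o \<Rightarrow> bool" where
  "is_kernel C K f M g N \<longleftrightarrow> f \<in> Hom C K M \<and> g \<in> Hom C M N \<and>
     cmp C K M N g f = hzero C K N \<and>
     (\<forall>X\<in>Ob C. \<forall>h\<in>Hom C X M. cmp C X M N g h = hzero C X N \<longrightarrow>
        (\<exists>!k. k \<in> Hom C X K \<and> cmp C X K M f k = h))"

definition is_cokernel ::
  "('o, 'a, 'x) pcat_scheme \<Rightarrow> 'o \<Rightarrow> 'a \<Rightarrow> 'o \<Rightarrow> 'a \<Rightarrow> 'o \<Rightarrow> bool" where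
  "is_cokernel C K f M g N \<longleftrightarrow> f \<in> Hom C K M \<and> g \<in> Hom C M N \<and>
     cmp C K M N g f = hzero C K N \<and>
     (\<forall>X\<in>Ob C. \<forall>h\<in>Hom C M X. cmp C K M X h f = hzero C K X \<longrightarrow>
        (\<exists>!k. k \<in> Hom C N X \<and> cmp C M N X k g = h))"

definition kernel_cokernel_pair ::
  "('o, 'a, 'x) pcat_scheme \<Rightarrow> 'o \<Rightarrow> 'a \<Rightarrow> 'o \<Rightarrow> 'a \<Rightarrow> 'o \<Rightarrow> bool" where
  "kernel_cokernel_pair C K f M g N \<longleftrightarrow> K \<in> Ob C \<and> M \<in> Ob C \<and> N \<in> Ob C \<and>
     is_kernel C K f M g N \<and> is_cokernel C K f M g N"

definition iso_sequences ::
  "('o, 'a, 'x) cat_scheme \<Rightarrow> 'o \<Rightarrow> 'a \<Rightarrow> 'o \<Rightarrow> 'a \<Rightarrow> 'o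
     \<Rightarrow> 'o \<Rightarrow> 'a \<Rightarrow> 'o \<Rightarrow> 'a \<Rightarrow> 'o \<Rightarrow> bool" where
  "iso_sequences C K f M g N K' f' M' g' N' \<longleftrightarrow>
     (\<exists>a b c. is_iso_arr C K K' a \<and> is_iso_arr C M M' b \<and> is_iso_arr C N N' c \<and>
        cmp C K M M' b f = cmp C K K' M' f' a \<and>
        cmp C M N N' c g = cmp C M M' N' g' b)"

section \<open>Localization\<close>

text \<open>The Gabriel-Zisman construction of the localization of \<open>C\<close> at the arrows \<open>w \<in> W A B\<close>.
  Paths are read in diagrammatic order; \<open>Inv A B w\<close> is a formal inverse \<open>B \<rightarrow> A\<close> of
  \<open>w : A \<rightarrow> B\<close>.\<close>

datatype ('o, 'a) zstep = Fwd 'o 'o 'a | Inv 'o 'o 'a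

inductive zpath ::
  "('o, 'a, 'x) cat_scheme \<Rightarrow> ('o \<Rightarrow> 'o \<Rightarrow> 'a set) \<Rightarrow> 'o \<Rightarrow> ('o, 'a) zstep list \<Rightarrow> 'o \<Rightarrow> bool"
  for C :: "('o, 'a, 'x) cat_scheme" and W :: "'o \<Rightarrow> 'o \<Rightarrow> 'a set" where
  zpath_Nil: "A \<in> Ob C \<Longrightarrow> zpath C W A [] A"
| zpath_Fwd: "\<lbrakk>A \<in> Ob C; B \<in> Ob C; f \<in> Hom C A B; zpath C W B p D\<rbrakk>
    \<Longrightarrow> zpath C W A (Fwd A B f # p) D"
| zpath_Inv: "\<lbrakk>A \<in> Ob C; B \<in> Ob C; w \<in> Hom C A B; w \<in> W A B; zpath C W A p D\<rbrakk>
    \<Longrightarrow> zpath C W B (Inv A B w # p) D"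

inductive zequiv ::
  "('o, 'a, 'x) cat_scheme \<Rightarrow> ('o \<Rightarrow> 'o \<Rightarrow> 'a set) \<Rightarrow> 'o \<Rightarrow> 'o
     \<Rightarrow> ('o, 'a) zstep list \<Rightarrow> ('o, 'a) zstep list \<Rightarrow> bool"
  for C :: "('o, 'a, 'x) cat_scheme" and W :: "'o \<Rightarrow> 'o \<Rightarrow> 'a set" where
  zequiv_refl: "zpath C W A p B \<Longrightarrow> zequiv C W A B p p"
| zequiv_sym: "zequiv C W A B p q \<Longrightarrow> zequiv C W A B q p"
| zequiv_trans: "\<lbrakk>zequiv C W A B p q; zequiv C W A B q r\<rbrakk> \<Longrightarrow> zequiv C W A B p r"
| zequiv_append: "\<lbrakk>zequiv C W A B p p'; zequiv C W B D q q'\<rbrakk>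
    \<Longrightarrow> zequiv C W A D (p @ q) (p' @ q')"
| zequiv_idn: "A \<in> Ob C \<Longrightarrow> zequiv C W A A [Fwd A A (idn C A)] []"
| zequiv_cmp: "\<lbrakk>A \<in> Ob C; B \<in> Ob C; D \<in> Ob C; f \<in> Hom C A B; g \<in> Hom C B D\<rbrakk>
    \<Longrightarrow> zequiv C W A D [Fwd A B f, Fwd B D g] [Fwd A D (cmp C A B D g f)]"
| zequiv_Fwd_Inv: "\<lbrakk>A \<in> Ob C; B \<in> Ob C; w \<in> Hom C A B; w \<in> W A B\<rbrakk>
    \<Longrightarrow> zequiv C W A A [Fwd A B w, Inv A B w] []"
| zequiv_Inv_Fwd: "\<lbrakk>A \<in> Ob C; B \<in> Ob C; w \<in> Hom C A B; w \<in> W A B\<rbrakk>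
    \<Longrightarrow> zequiv C W B B [Inv A B w, Fwd A B w] []"

definition zclass ::
  "('o, 'a, 'x) cat_scheme \<Rightarrow> ('o \<Rightarrow> 'o \<Rightarrow> 'a set) \<Rightarrow> 'o \<Rightarrow> 'o
     \<Rightarrow> ('o, 'a) zstep list \<Rightarrow> ('o, 'a) zstep list set" where
  "zclass C W A B p = {q. zequiv C W A B p q}"

definition localization ::
  "('o, 'a, 'x) cat_scheme \<Rightarrow> ('o \<Rightarrow> 'o \<Rightarrow> 'a set) \<Rightarrow> ('o, ('o, 'a) zstep list set) cat" where
  "localization C W =
     \<lparr>Ob = Ob C,
      Hom = (\<lambda>A B. {zclass C W A B p | p. zpath C W A p B}),
      idn = (\<lambda>A. zclass C W A A []),
      cmp = (\<lambda>A B D G F. {r. \<exists>p\<in>F. \<exists>q\<in>G. zequiv C W A D (p @ q) r})\<rparr>"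

definition localization_functor ::
  "('o, 'a, 'x) cat_scheme \<Rightarrow> ('o \<Rightarrow> 'o \<Rightarrow> 'a set)
     \<Rightarrow> ('o, 'a, 'o, ('o, 'a) zstep list set) fctr" where
  "localization_functor C W =
     \<lparr>fob = (\<lambda>A. A), fmap = (\<lambda>A B f. zclass C W A B [Fwd A B f])\<rparr>"

section \<open>Modules over a preadditive category\<close>

text \<open>Abelian groups with carrier a subset of the type \<open>'m\<close>, written multiplicatively. Group
  homomorphisms are made extensional so that equality of arrows is equality on the carrier. Since
  HOL has no type of all abelian groups, \<open>'m\<close> plays the role of a universe; subgroups, and (by
  choosing representatives) quotients, of a group in \<open>Ab\<close> are again available in \<open>Ab\<close>, and so are
  finite products when \<open>'m\<close> is infinite.\<close>

definition Ab :: "('m monoid, 'm \<Rightarrow> 'm) pcat" where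
  "Ab = \<lparr>Ob = {G. comm_group G},
     Hom = (\<lambda>G H. hom G H \<inter> extensional (carrier G)),
     idn = (\<lambda>G. \<lambda>x\<in>carrier G. x),
     cmp = (\<lambda>G H K g f. compose (carrier G) g f),
     hadd = (\<lambda>G H f g. \<lambda>x\<in>carrier G. f x \<otimes>\<^bsub>H\<^esub> g x),
     hzero = (\<lambda>G H. \<lambda>x\<in>carrier G. \<one>\<^bsub>H\<^esub>)\<rparr>"

text \<open>Additive functors to abelian groups and natural transformations. The values of a functor on
  non-objects and non-arrows are not normalized; functors differing only there are isomorphic.\<close>

definition Modcat :: "('o, 'a, 'x) pcat_scheme
    \<Rightarrow> (('o, 'a, 'm monoid, 'm \<Rightarrow> 'm) fctr, 'o \<Rightarrow> 'm \<Rightarrow> 'm) pcat" where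
  "Modcat C = \<lparr>Ob = {M. is_additive_functor C Ab M},
     Hom = (\<lambda>M N. {t \<in> (\<Pi>\<^sub>E A\<in>Ob C. Hom Ab (fob M A) (fob N A)).
        \<forall>A\<in>Ob C. \<forall>B\<in>Ob C. \<forall>f\<in>Hom C A B.
          cmp Ab (fob M A) (fob M B) (fob N B) (t B) (fmap M A B f) =
          cmp Ab (fob M A) (fob N A) (fob N B) (fmap N A B f) (t A)}),
     idn = (\<lambda>M. \<lambda>A\<in>Ob C. idn Ab (fob M A)),
     cmp = (\<lambda>M N P t s. \<lambda>A\<in>Ob C. cmp Ab (fob M A) (fob N A) (fob P A) (t A) (s A)),
     hadd = (\<lambda>M N s t. \<lambda>A\<in>Ob C. hadd Ab (fob M A) (fob N A) (s A) (t A)),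
     hzero = (\<lambda>M N. \<lambda>A\<in>Ob C. hzero Ab (fob M A) (fob N A))\<rparr>"

section \<open>Filtered rings\<close>

record 'g ogroup = "'g monoid" +
  gle :: "'g \<Rightarrow> 'g \<Rightarrow> bool"  (infix \<open>\<preceq>\<index>\<close> 50)

locale ordered_group = group \<Gamma> for \<Gamma> :: "('g, 'x) ogroup_scheme" (structure) +
  assumes gle_refl: "\<alpha> \<in> carrier \<Gamma> \<Longrightarrow> \<alpha> \<preceq> \<alpha>"
    and gle_antisym: "\<lbrakk>\<alpha> \<in> carrier \<Gamma>; \<beta> \<in> carrier \<Gamma>; \<alpha> \<preceq> \<beta>; \<beta> \<preceq> \<alpha>\<rbrakk> \<Longrightarrow> \<alpha> = \<beta>"
    and gle_trans: "\<lbrakk>\<alpha> \<in> carrier \<Gamma>; \<beta> \<in> carrier \<Gamma>; \<gamma> \<in> carrier \<Gamma>; \<alpha> \<preceq> \<beta>; \<beta> \<preceq> \<gamma>\<rbrakk>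
      \<Longrightarrow> \<alpha> \<preceq> \<gamma>"
    and gle_mult: "\<lbrakk>\<alpha> \<in> carrier \<Gamma>; \<beta> \<in> carrier \<Gamma>; \<gamma> \<in> carrier \<Gamma>; \<delta> \<in> carrier \<Gamma>;
        \<alpha> \<preceq> \<beta>; \<gamma> \<preceq> \<delta>\<rbrakk> \<Longrightarrow> \<alpha> \<otimes> \<gamma> \<preceq> \<beta> \<otimes> \<delta>"

locale filtered_ring = grp: ordered_group \<Gamma> + ring R
  for \<Gamma> :: "('g, 'x) ogroup_scheme" and R :: "('r, 'y) ring_scheme" +
  fixes F :: "'g \<Rightarrow> 'r set"
  assumes filt_subgroup: "\<alpha> \<in> carrier \<Gamma> \<Longrightarrow> additive_subgroup (F \<alpha>) R"
    and filt_one: "\<one>\<^bsub>R\<^esub> \<in> F \<one>\<^bsub>\<Gamma>\<^esub>"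
    and filt_mono: "\<lbrakk>\<alpha> \<in> carrier \<Gamma>; \<beta> \<in> carrier \<Gamma>; \<alpha> \<preceq>\<^bsub>\<Gamma>\<^esub> \<beta>\<rbrakk> \<Longrightarrow> F \<alpha> \<subseteq> F \<beta>"
    and filt_mult: "\<lbrakk>\<alpha> \<in> carrier \<Gamma>; \<beta> \<in> carrier \<Gamma>; r \<in> F \<alpha>; s \<in> F \<beta>\<rbrakk>
      \<Longrightarrow> r \<otimes>\<^bsub>R\<^esub> s \<in> F (\<alpha> \<otimes>\<^bsub>\<Gamma>\<^esub> \<beta>)"

definition Fcat :: "('g, 'x) ogroup_scheme \<Rightarrow> ('r, 'y) ring_scheme \<Rightarrow> ('g \<Rightarrow> 'r set) \<Rightarrow> 'g set
    \<Rightarrow> ('g, 'r) pcat" where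
  "Fcat \<Gamma> R F \<Lambda> = \<lparr>Ob = \<Lambda>,
     Hom = (\<lambda>\<alpha> \<beta>. if \<alpha> \<preceq>\<^bsub>\<Gamma>\<^esub> \<beta> then F (\<beta> \<otimes>\<^bsub>\<Gamma>\<^esub> inv\<^bsub>\<Gamma>\<^esub> \<alpha>) else {\<zero>\<^bsub>R\<^esub>}),
     idn = (\<lambda>\<alpha>. \<one>\<^bsub>R\<^esub>),
     cmp = (\<lambda>\<alpha> \<beta> \<gamma> s r. s \<otimes>\<^bsub>R\<^esub> r),
     hadd = (\<lambda>\<alpha> \<beta> r s. r \<oplus>\<^bsub>R\<^esub> s),
     hzero = (\<lambda>\<alpha> \<beta>. \<zero>\<^bsub>R\<^esub>)\<rparr>"

datatype 'g ext = Fin 'g | Infty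

fun ext_le :: "('g, 'x) ogroup_scheme \<Rightarrow> 'g ext \<Rightarrow> 'g ext \<Rightarrow> bool" where
  "ext_le \<Gamma> \<alpha> Infty = True"
| "ext_le \<Gamma> (Fin \<alpha>) (Fin \<beta>) = (\<alpha> \<preceq>\<^bsub>\<Gamma>\<^esub> \<beta>)"
| "ext_le \<Gamma> Infty (Fin \<beta>) = False"

definition ext_set :: "'g set \<Rightarrow> 'g ext set" where
  "ext_set \<Lambda> = insert Infty (Fin ` \<Lambda>)"

fun Fbar_hom :: "('g, 'x) ogroup_scheme \<Rightarrow> ('r, 'y) ring_scheme \<Rightarrow> ('g \<Rightarrow> 'r set) \<Rightarrow> 'g set
    \<Rightarrow> 'g ext \<Rightarrow> 'g ext \<Rightarrow> 'r set" where
  "Fbar_hom \<Gamma> R F \<Lambda> \<alpha> Infty = carrier R"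
| "Fbar_hom \<Gamma> R F \<Lambda> (Fin \<alpha>) (Fin \<beta>) = Hom (Fcat \<Gamma> R F \<Lambda>) \<alpha> \<beta>"
| "Fbar_hom \<Gamma> R F \<Lambda> Infty (Fin \<beta>) = {\<zero>\<^bsub>R\<^esub>}"

definition Fbar :: "('g, 'x) ogroup_scheme \<Rightarrow> ('r, 'y) ring_scheme \<Rightarrow> ('g \<Rightarrow> 'r set) \<Rightarrow> 'g set
    \<Rightarrow> ('g ext, 'r) pcat" where
  "Fbar \<Gamma> R F \<Lambda> = \<lparr>Ob = ext_set \<Lambda>,
     Hom = Fbar_hom \<Gamma> R F \<Lambda>,
     idn = (\<lambda>\<alpha>. \<one>\<^bsub>R\<^esub>),
     cmp = (\<lambda>\<alpha> \<beta> \<gamma> s r. s \<otimes>\<^bsub>R\<^esub> r),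
     hadd = (\<lambda>\<alpha> \<beta> r s. r \<oplus>\<^bsub>R\<^esub> s),
     hzero = (\<lambda>\<alpha> \<beta>. \<zero>\<^bsub>R\<^esub>)\<rparr>"

section \<open>Prefragments, preglids and glids\<close>

text \<open>The arrow written \<open>1\<^sub>\<alpha>\<^sub>,\<^sub>\<beta>\<close> is the element \<open>\<one>\<^bsub>R\<^esub>\<close> of \<open>Hom \<alpha> \<beta>\<close>.\<close>

type_synonym ('g, 'r, 'm) prefrag = "('g, 'r, 'm monoid, 'm \<Rightarrow> 'm) fctr"
type_synonym ('g, 'm) prefrag_arr = "'g \<Rightarrow> 'm \<Rightarrow> 'm"
type_synonym ('g, 'r, 'm) preglid = "('g ext, 'r, 'm) prefrag"
type_synonym ('g, 'm) preglid_arr = "('g ext, 'm) prefrag_arr"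
type_synonym ('g, 'r, 'm) glid_arr =
  "(('g, 'r, 'm) preglid, ('g, 'm) preglid_arr) zstep list set"

definition Prefrag :: "('g, 'x) ogroup_scheme \<Rightarrow> ('r, 'y) ring_scheme \<Rightarrow> ('g \<Rightarrow> 'r set) \<Rightarrow> 'g set
    \<Rightarrow> (('g, 'r, 'm) prefrag, ('g, 'm) prefrag_arr) pcat" where
  "Prefrag \<Gamma> R F \<Lambda> = full_sub (Modcat (Fcat \<Gamma> R F \<Lambda>))
     {M. \<forall>\<alpha>\<in>\<Lambda>. \<forall>\<beta>\<in>\<Lambda>. \<alpha> \<preceq>\<^bsub>\<Gamma>\<^esub> \<beta> \<longrightarrow> fmap M \<alpha> \<beta> \<one>\<^bsub>R\<^esub> \<in> mon (fob M \<alpha>) (fob M \<beta>)}"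

definition Preglid :: "('g, 'x) ogroup_scheme \<Rightarrow> ('r, 'y) ring_scheme \<Rightarrow> ('g \<Rightarrow> 'r set) \<Rightarrow> 'g set
    \<Rightarrow> (('g, 'r, 'm) preglid, ('g, 'm) preglid_arr) pcat" where
  "Preglid \<Gamma> R F \<Lambda> = full_sub (Modcat (Fbar \<Gamma> R F \<Lambda>))
     {M. \<forall>\<alpha>\<in>ext_set \<Lambda>. \<forall>\<beta>\<in>ext_set \<Lambda>.
        ext_le \<Gamma> \<alpha> \<beta> \<longrightarrow> fmap M \<alpha> \<beta> \<one>\<^bsub>R\<^esub> \<in> mon (fob M \<alpha>) (fob M \<beta>)}"

definition Sigma_glid :: "('g, 'x) ogroup_scheme \<Rightarrow> ('r, 'y) ring_scheme \<Rightarrow> ('g \<Rightarrow> 'r set)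
    \<Rightarrow> 'g set \<Rightarrow> ('g, 'r, 'm) preglid \<Rightarrow> ('g, 'r, 'm) preglid \<Rightarrow> ('g, 'm) preglid_arr set" where
  "Sigma_glid \<Gamma> R F \<Lambda> M N =
     {t \<in> Hom (Preglid \<Gamma> R F \<Lambda>) M N.
        \<forall>\<alpha>\<in>\<Lambda>. t (Fin \<alpha>) \<in> iso (fob M (Fin \<alpha>)) (fob N (Fin \<alpha>))}"

definition Glid :: "('g, 'x) ogroup_scheme \<Rightarrow> ('r, 'y) ring_scheme \<Rightarrow> ('g \<Rightarrow> 'r set) \<Rightarrow> 'g set
    \<Rightarrow> (('g, 'r, 'm) preglid, ('g, 'r, 'm) glid_arr) cat" where
  "Glid \<Gamma> R F \<Lambda> = localization (Preglid \<Gamma> R F \<Lambda>) (Sigma_glid \<Gamma> R F \<Lambda>)"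

definition Q_glid :: "('g, 'x) ogroup_scheme \<Rightarrow> ('r, 'y) ring_scheme \<Rightarrow> ('g \<Rightarrow> 'r set) \<Rightarrow> 'g set
    \<Rightarrow> (('g, 'r, 'm) preglid, ('g, 'm) preglid_arr,
        ('g, 'r, 'm) preglid, ('g, 'r, 'm) glid_arr) fctr" where
  "Q_glid \<Gamma> R F \<Lambda> = localization_functor (Preglid \<Gamma> R F \<Lambda>) (Sigma_glid \<Gamma> R F \<Lambda>)"

abbreviation conflation_Prefrag where
  "conflation_Prefrag \<Gamma> R F \<Lambda> \<equiv> kernel_cokernel_pair (Prefrag \<Gamma> R F \<Lambda>)"

abbreviation conflation_Preglid where
  "conflation_Preglid \<Gamma> R F \<Lambda> \<equiv> kernel_cokernel_pair (Preglid \<Gamma> R F \<Lambda>)"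

text \<open>The sequences isomorphic to images of conflations under the localization functor.\<close>

definition conflation_Glid :: "('g, 'x) ogroup_scheme \<Rightarrow> ('r, 'y) ring_scheme \<Rightarrow> ('g \<Rightarrow> 'r set)
    \<Rightarrow> 'g set \<Rightarrow> ('g, 'r, 'm) preglid \<Rightarrow> ('g, 'r, 'm) glid_arr \<Rightarrow> ('g, 'r, 'm) preglid
    \<Rightarrow> ('g, 'r, 'm) glid_arr \<Rightarrow> ('g, 'r, 'm) preglid \<Rightarrow> bool" where
  "conflation_Glid \<Gamma> R F \<Lambda> K f M g N \<longleftrightarrow>
     K \<in> Ob (Glid \<Gamma> R F \<Lambda>) \<and> M \<in> Ob (Glid \<Gamma> R F \<Lambda>) \<and> N \<in> Ob (Glid \<Gamma> R F \<Lambda>) \<and>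
     f \<in> Hom (Glid \<Gamma> R F \<Lambda>) K M \<and> g \<in> Hom (Glid \<Gamma> R F \<Lambda>) M N \<and>
     (\<exists>K' f' M' g' N'. conflation_Preglid \<Gamma> R F \<Lambda> K' f' M' g' N' \<and>
        (let Q = Q_glid \<Gamma> R F \<Lambda> in
         iso_sequences (Glid \<Gamma> R F \<Lambda>) K f M g N
           (fob Q K') (fmap Q K' M' f') (fob Q M') (fmap Q M' N' g') (fob Q N')))"

text \<open>Restriction along the inclusion of \<open>Fcat \<Gamma> R F \<Lambda>\<close> into \<open>Fbar \<Gamma> R F \<Lambda>\<close>.\<close>

definition Res :: "'g set \<Rightarrow> (('g, 'r, 'm) preglid, ('g, 'm) preglid_arr,
    ('g, 'r, 'm) prefrag, ('g, 'm) prefrag_arr) fctr" where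
  "Res \<Lambda> = \<lparr>fob = (\<lambda>M. \<lparr>fob = (\<lambda>\<alpha>. fob M (Fin \<alpha>)), fmap = (\<lambda>\<alpha> \<beta>. fmap M (Fin \<alpha>) (Fin \<beta>))\<rparr>),
     fmap = (\<lambda>M N t. \<lambda>\<alpha>\<in>\<Lambda>. t (Fin \<alpha>))\<rparr>"

text \<open>The functor induced by \<open>Res\<close> on the localization, characterized by its composite with the
  localization functor; see \<open>glid_embedding_exists\<close> for existence and uniqueness.\<close>

definition is_glid_embedding :: "('g, 'x) ogroup_scheme \<Rightarrow> ('r, 'y) ring_scheme
    \<Rightarrow> ('g \<Rightarrow> 'r set) \<Rightarrow> 'g set
    \<Rightarrow> (('g, 'r, 'm) preglid, ('g, 'r, 'm) glid_arr,
        ('g, 'r, 'm) prefrag, ('g, 'm) prefrag_arr) fctr \<Rightarrow> bool" where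
  "is_glid_embedding \<Gamma> R F \<Lambda> \<phi> \<longleftrightarrow>
     is_functor (Glid \<Gamma> R F \<Lambda>) (Prefrag \<Gamma> R F \<Lambda>) \<phi> \<and>
     fctr_eq (Preglid \<Gamma> R F \<Lambda>) (fctr_comp \<phi> (Q_glid \<Gamma> R F \<Lambda>)) (Res \<Lambda>)"

section \<open>Consistency of the definitions\<close>

lemma category_full_sub: "category C \<Longrightarrow> category (full_sub C S)"
  unfolding category_def full_sub_def by simp

lemma (in filtered_ring) filt_carrier: "\<alpha> \<in> carrier \<Gamma> \<Longrightarrow> F \<alpha> \<subseteq> carrier R"
  using additive_subgroup.a_subset[OF filt_subgroup] .

lemma (in filtered_ring) Fcat_hom_subgroup:
  assumes "\<alpha> \<in> carrier \<Gamma>" "\<beta> \<in> carrier \<Gamma>"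
  shows "additive_subgroup (Hom (Fcat \<Gamma> R F \<Lambda>) \<alpha> \<beta>) R"
proof -
  have "additive_subgroup {\<zero>\<^bsub>R\<^esub>} R"
    by (intro additive_subgroup.intro subgroup.intro) (auto simp: a_inv_def[symmetric])
  then show ?thesis
    using assms filt_subgroup by (simp add: Fcat_def)
qed

lemma (in filtered_ring) gle_quot:
  assumes "\<alpha> \<in> carrier \<Gamma>" "\<beta> \<in> carrier \<Gamma>" "\<alpha> \<preceq>\<^bsub>\<Gamma>\<^esub> \<beta>"
  shows "\<one>\<^bsub>\<Gamma>\<^esub> \<preceq>\<^bsub>\<Gamma>\<^esub> \<beta> \<otimes>\<^bsub>\<Gamma>\<^esub> inv\<^bsub>\<Gamma>\<^esub> \<alpha>"
  using grp.gle_mult[of \<alpha> \<beta> "inv\<^bsub>\<Gamma>\<^esub> \<alpha>" "inv\<^bsub>\<Gamma>\<^esub> \<alpha>"] assms grp.gle_refl by simp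

lemma (in filtered_ring) one_in_Fcat_hom:
  assumes "\<alpha> \<in> carrier \<Gamma>" "\<beta> \<in> carrier \<Gamma>" "\<alpha> \<preceq>\<^bsub>\<Gamma>\<^esub> \<beta>"
  shows "\<one>\<^bsub>R\<^esub> \<in> Hom (Fcat \<Gamma> R F \<Lambda>) \<alpha> \<beta>"
proof -
  have "F \<one>\<^bsub>\<Gamma>\<^esub> \<subseteq> F (\<beta> \<otimes>\<^bsub>\<Gamma>\<^esub> inv\<^bsub>\<Gamma>\<^esub> \<alpha>)"
    using assms gle_quot by (intro filt_mono) auto
  then show ?thesis
    using assms filt_one by (auto simp: Fcat_def)
qed

lemma (in filtered_ring) Fcat_hom_mult:
  assumes abc: "\<alpha> \<in> carrier \<Gamma>" "\<beta> \<in> carrier \<Gamma>" "\<gamma> \<in> carrier \<Gamma>"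
    and r: "r \<in> Hom (Fcat \<Gamma> R F \<Lambda>) \<alpha> \<beta>" and s: "s \<in> Hom (Fcat \<Gamma> R F \<Lambda>) \<beta> \<gamma>"
  shows "s \<otimes>\<^bsub>R\<^esub> r \<in> Hom (Fcat \<Gamma> R F \<Lambda>) \<alpha> \<gamma>"
proof -
  interpret H: additive_subgroup "Hom (Fcat \<Gamma> R F \<Lambda>) \<alpha> \<gamma>" R
    using Fcat_hom_subgroup abc by blast
  have rs: "r \<in> carrier R" "s \<in> carrier R"
    using r s Fcat_hom_subgroup abc additive_subgroup.a_subset by blast+
  show ?thesis
  proof (cases "\<alpha> \<preceq>\<^bsub>\<Gamma>\<^esub> \<beta> \<and> \<beta> \<preceq>\<^bsub>\<Gamma>\<^esub> \<gamma>")
    case True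
    then have le: "\<alpha> \<preceq>\<^bsub>\<Gamma>\<^esub> \<gamma>"
      using grp.gle_trans abc by blast
    have "s \<otimes>\<^bsub>R\<^esub> r \<in> F ((\<gamma> \<otimes>\<^bsub>\<Gamma>\<^esub> inv\<^bsub>\<Gamma>\<^esub> \<beta>) \<otimes>\<^bsub>\<Gamma>\<^esub> (\<beta> \<otimes>\<^bsub>\<Gamma>\<^esub> inv\<^bsub>\<Gamma>\<^esub> \<alpha>))"
      using True r s abc by (intro filt_mult) (auto simp: Fcat_def)
    also have "(\<gamma> \<otimes>\<^bsub>\<Gamma>\<^esub> inv\<^bsub>\<Gamma>\<^esub> \<beta>) \<otimes>\<^bsub>\<Gamma>\<^esub> (\<beta> \<otimes>\<^bsub>\<Gamma>\<^esub> inv\<^bsub>\<Gamma>\<^esub> \<alpha>) = \<gamma> \<otimes>\<^bsub>\<Gamma>\<^esub> inv\<^bsub>\<Gamma>\<^esub> \<alpha>"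
    proof -
      have "inv\<^bsub>\<Gamma>\<^esub> \<beta> \<otimes>\<^bsub>\<Gamma>\<^esub> (\<beta> \<otimes>\<^bsub>\<Gamma>\<^esub> inv\<^bsub>\<Gamma>\<^esub> \<alpha>) = inv\<^bsub>\<Gamma>\<^esub> \<alpha>"
        using abc by (simp add: grp.m_assoc[symmetric])
      then show ?thesis
        using abc by (simp add: grp.m_assoc)
    qed
    finally show ?thesis
      using le by (simp add: Fcat_def)
  next
    case False
    then have "r = \<zero>\<^bsub>R\<^esub> \<or> s = \<zero>\<^bsub>R\<^esub>"
      using r s by (auto simp: Fcat_def split: if_splits)
    then have "s \<otimes>\<^bsub>R\<^esub> r = \<zero>\<^bsub>R\<^esub>"
      using rs by auto
    then show ?thesis
      using H.zero_closed by simp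
  qed
qed

lemma (in ring) comm_group_additive_subgroup:
  assumes "additive_subgroup H R"
  shows "comm_group \<lparr>carrier = H, mult = (\<lambda>r s. r \<oplus> s), one = \<zero>\<rparr>"
proof -
  interpret additive_subgroup H R
    by (rule assms)
  show ?thesis
  proof (rule comm_groupI; simp)
    fix x
    assume "x \<in> H"
    then show "\<exists>y\<in>H. y \<oplus> x = \<zero>"
      using a_subset by (intro bexI[of _ "\<ominus> x"]) (auto simp: l_neg)
  qed (use a_subset in \<open>auto simp: subset_iff a_ac\<close>)
qed

lemma (in filtered_ring) Fcat_preadditive:
  assumes "\<Lambda> \<subseteq> carrier \<Gamma>"
  shows "preadditive_category (Fcat \<Gamma> R F \<Lambda>)"
proof -
  have Ob: "Ob (Fcat \<Gamma> R F \<Lambda>) = \<Lambda>"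
    by (simp add: Fcat_def)
  have sub: "r \<in> carrier R"
    if "\<alpha> \<in> \<Lambda>" "\<beta> \<in> \<Lambda>" "r \<in> Hom (Fcat \<Gamma> R F \<Lambda>) \<alpha> \<beta>" for \<alpha> \<beta> r
    using that assms Fcat_hom_subgroup[of \<alpha> \<beta> \<Lambda>] additive_subgroup.a_subset by blast
  show ?thesis
  proof (intro preadditive_category.intro category.intro preadditive_category_axioms.intro, goal_cases)
    case (1 A)
    then show ?case
      using one_in_Fcat_hom[of A A] grp.gle_refl assms by (auto simp: Ob) (auto simp: Fcat_def)
  next
    case (2 A B D f g)
    then have "g \<otimes>\<^bsub>R\<^esub> f \<in> Hom (Fcat \<Gamma> R F \<Lambda>) A D"
      using Fcat_hom_mult[of A B D] assms by (auto simp: Ob)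
    then show ?case
      by (simp add: Fcat_def)
  next
    case (6 A B)
    then show ?case
      using comm_group_additive_subgroup[OF Fcat_hom_subgroup[of A B \<Lambda>]] assms
      by (simp add: Ob subset_iff) (simp add: hom_group_def Fcat_def)
  next
    case (3 A B f)
    then have "f \<in> carrier R"
      using sub by (simp add: Ob)
    then show ?case
      by (simp add: Fcat_def)
  next
    case (4 A B f)
    then have "f \<in> carrier R"
      using sub by (simp add: Ob)
    then show ?case
      by (simp add: Fcat_def)
  next
    case (5 A B D E f g h)
    then have "f \<in> carrier R" "g \<in> carrier R" "h \<in> carrier R"
      using sub by (simp_all add: Ob)
    then show ?case
      by (simp add: Fcat_def m_assoc)
  next
    case (7 A B D f f' g)
    then have "f \<in> carrier R" "f' \<in> carrier R" "g \<in> carrier R"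
      using sub by (simp_all add: Ob)
    then show ?case
      by (simp add: Fcat_def r_distr)
  next
    case (8 A B D f g g')
    then have "f \<in> carrier R" "g \<in> carrier R" "g' \<in> carrier R"
      using sub by (simp_all add: Ob)
    then show ?case
      by (simp add: Fcat_def l_distr)
  qed
qed

lemma (in filtered_ring) Fbar_hom_subgroup:
  assumes "\<Lambda> \<subseteq> carrier \<Gamma>" "\<alpha> \<in> ext_set \<Lambda>" "\<beta> \<in> ext_set \<Lambda>"
  shows "additive_subgroup (Fbar_hom \<Gamma> R F \<Lambda> \<alpha> \<beta>) R"
proof -
  have "additive_subgroup {\<zero>\<^bsub>R\<^esub>} R" "additive_subgroup (carrier R) R"
    by (intro additive_subgroup.intro subgroup.intro; auto simp: a_inv_def[symmetric])+
  then show ?thesis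
    using assms Fcat_hom_subgroup[of _ _ \<Lambda>]
    by (cases \<alpha>; cases \<beta>) (auto simp: ext_set_def)
qed

lemma (in filtered_ring) Fbar_preadditive:
  assumes "\<Lambda> \<subseteq> carrier \<Gamma>"
  shows "preadditive_category (Fbar \<Gamma> R F \<Lambda>)"
proof -
  have Ob: "Ob (Fbar \<Gamma> R F \<Lambda>) = ext_set \<Lambda>" and Hom: "Hom (Fbar \<Gamma> R F \<Lambda>) = Fbar_hom \<Gamma> R F \<Lambda>"
    by (simp_all add: Fbar_def)
  have sub: "r \<in> carrier R"
    if "\<alpha> \<in> ext_set \<Lambda>" "\<beta> \<in> ext_set \<Lambda>" "r \<in> Fbar_hom \<Gamma> R F \<Lambda> \<alpha> \<beta>" for \<alpha> \<beta> r
    using that assms Fbar_hom_subgroup additive_subgroup.a_subset by blast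
  have mult: "s \<otimes>\<^bsub>R\<^esub> r \<in> Fbar_hom \<Gamma> R F \<Lambda> \<alpha> \<gamma>"
    if abc: "\<alpha> \<in> ext_set \<Lambda>" "\<beta> \<in> ext_set \<Lambda>" "\<gamma> \<in> ext_set \<Lambda>"
      and r: "r \<in> Fbar_hom \<Gamma> R F \<Lambda> \<alpha> \<beta>" and s: "s \<in> Fbar_hom \<Gamma> R F \<Lambda> \<beta> \<gamma>" for \<alpha> \<beta> \<gamma> r s
  proof -
    have rs: "r \<in> carrier R" "s \<in> carrier R"
      using sub that by blast+
    interpret H: additive_subgroup "Fbar_hom \<Gamma> R F \<Lambda> \<alpha> \<gamma>" R
      using Fbar_hom_subgroup that assms by blast
    show ?thesis
    proof (cases \<gamma>)
      case Infty
      then show ?thesis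
        using rs by simp
    next
      case c: (Fin c)
      show ?thesis
      proof (cases \<beta>)
        case Infty
        then have "s \<otimes>\<^bsub>R\<^esub> r = \<zero>\<^bsub>R\<^esub>"
          using s rs c by simp
        then show ?thesis
          using H.zero_closed by simp
      next
        case b: (Fin b)
        show ?thesis
        proof (cases \<alpha>)
          case Infty
          then have "s \<otimes>\<^bsub>R\<^esub> r = \<zero>\<^bsub>R\<^esub>"
            using r rs b by simp
          then show ?thesis
            using H.zero_closed by simp
        next
          case a: (Fin a)
          have "a \<in> carrier \<Gamma>" "b \<in> carrier \<Gamma>" "c \<in> carrier \<Gamma>"
            using a b c abc assms by (auto simp: ext_set_def)
          then show ?thesis
            using Fcat_hom_mult r s a b c by simp
        qed
      qed
    qed
  qed
  show ?thesis
  proof (intro preadditive_category.intro category.intro preadditive_category_axioms.intro, goal_cases)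
    case (1 A)
    then show ?case
      using one_in_Fcat_hom grp.gle_refl assms
      by (cases A) (auto simp: Fbar_def ext_set_def subset_iff)
  next
    case (2 A B D f g)
    then show ?case
      using mult[of A B D f g] by (simp add: Fbar_def)
  next
    case (6 A B)
    then show ?case
      using comm_group_additive_subgroup[OF Fbar_hom_subgroup[of \<Lambda> A B]] assms
      by (simp add: hom_group_def Fbar_def)
  next
    case (3 A B f)
    then have "f \<in> carrier R"
      using sub by (simp add: Ob Hom)
    then show ?case
      by (simp add: Fbar_def)
  next
    case (4 A B f)
    then have "f \<in> carrier R"
      using sub by (simp add: Ob Hom)
    then show ?case
      by (simp add: Fbar_def)
  next
    case (5 A B D E f g h)
    then have "f \<in> carrier R" "g \<in> carrier R" "h \<in> carrier R"
      using sub by (simp_all add: Ob Hom)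
    then show ?case
      by (simp add: Fbar_def m_assoc)
  next
    case (7 A B D f f' g)
    then have "f \<in> carrier R" "f' \<in> carrier R" "g \<in> carrier R"
      using sub by (simp_all add: Ob Hom)
    then show ?case
      by (simp add: Fbar_def r_distr)
  next
    case (8 A B D f g g')
    then have "f \<in> carrier R" "g \<in> carrier R" "g' \<in> carrier R"
      using sub by (simp_all add: Ob Hom)
    then show ?case
      by (simp add: Fbar_def l_distr)
  qed
qed

lemma Ab_simps:
  "Ob Ab = {G. comm_group G}" "Hom Ab G H = hom G H \<inter> extensional (carrier G)"
  "idn Ab G = (\<lambda>x\<in>carrier G. x)" "cmp Ab G H K g f = compose (carrier G) g f"
  by (simp_all add: Ab_def)

lemma Ab_category: "category (Ab :: ('m monoid, 'm \<Rightarrow> 'm) pcat)"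
proof (unfold_locales, goal_cases)
  case (1 A)
  then interpret comm_group A
    by (simp add: Ab_simps)
  show ?case
    by (auto simp: Ab_simps hom_def)
next
  case (2 A B D f g)
  then show ?case
    by (auto simp: Ab_simps hom_def compose_def Pi_iff comm_groupE(1))
next
  case (5 A B D E f g h)
  then show ?case
    by (auto simp: Ab_simps hom_def intro: compose_assoc)
qed (auto simp: Ab_simps hom_def compose_def extensional_def fun_eq_iff Pi_iff)

lemma Modcat_simps:
  "Ob (Modcat C) = {M. is_additive_functor C Ab M}"
  "t \<in> Hom (Modcat C) M N \<longleftrightarrow> t \<in> (\<Pi>\<^sub>E A\<in>Ob C. Hom Ab (fob M A) (fob N A)) \<and>
        (\<forall>A\<in>Ob C. \<forall>B\<in>Ob C. \<forall>f\<in>Hom C A B.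
          cmp Ab (fob M A) (fob M B) (fob N B) (t B) (fmap M A B f) =
          cmp Ab (fob M A) (fob N A) (fob N B) (fmap N A B f) (t A))"
  "idn (Modcat C) M = (\<lambda>A\<in>Ob C. idn Ab (fob M A))"
  "cmp (Modcat C) M N P t s = (\<lambda>A\<in>Ob C. cmp Ab (fob M A) (fob N A) (fob P A) (t A) (s A))"
  by (simp_all add: Modcat_def)

lemma Modcat_ObD:
  assumes "M \<in> Ob (Modcat C)" "A \<in> Ob C"
  shows "fob M A \<in> Ob Ab" "B \<in> Ob C \<Longrightarrow> f \<in> Hom C A B \<Longrightarrow> fmap M A B f \<in> Hom Ab (fob M A) (fob M B)"
  using assms by (auto simp: Modcat_simps(1) is_additive_functor_def is_functor_def)

lemma Modcat_category:
  "category (Modcat C :: (('o, 'a, 'm monoid, 'm \<Rightarrow> 'm) fctr, 'o \<Rightarrow> 'm \<Rightarrow> 'm) pcat)"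
proof -
  interpret Ab: category "Ab :: ('m monoid, 'm \<Rightarrow> 'm) pcat"
    by (rule Ab_category)
  show ?thesis
  proof (unfold_locales, goal_cases)
    case (1 M)
    note [simp] = Modcat_ObD[OF 1]
    show ?case
      unfolding Modcat_simps
      by (auto simp: Ab.idn_in Ab.idn_left Ab.idn_right)
  next
    case (2 M N P s t)
    note [simp] = Modcat_ObD[OF 2(1)] Modcat_ObD[OF 2(2)] Modcat_ObD[OF 2(3)]
    have s: "\<And>A. A \<in> Ob C \<Longrightarrow> s A \<in> Hom Ab (fob M A) (fob N A)"
      and t: "\<And>A. A \<in> Ob C \<Longrightarrow> t A \<in> Hom Ab (fob N A) (fob P A)"
      using 2(4,5) unfolding Modcat_simps by auto
    show ?case
      unfolding Modcat_simps(2,4)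
    proof (intro conjI ballI)
      fix A B f
      assume AB: "A \<in> Ob C" "B \<in> Ob C" and f: "f \<in> Hom C A B"
      let ?c = "\<lambda>X Y Z. cmp (Ab :: ('m monoid, 'm \<Rightarrow> 'm) pcat) X Y Z"
      have nat: "?c (fob M A) (fob M B) (fob N B) (s B) (fmap M A B f) =
          ?c (fob M A) (fob N A) (fob N B) (fmap N A B f) (s A)"
        "?c (fob N A) (fob N B) (fob P B) (t B) (fmap N A B f) =
          ?c (fob N A) (fob P A) (fob P B) (fmap P A B f) (t A)"
        using 2(4,5) AB f unfolding Modcat_simps by blast+
      have "?c (fob M A) (fob M B) (fob P B) (?c (fob M B) (fob N B) (fob P B) (t B) (s B)) (fmap M A B f)
          = ?c (fob M A) (fob N B) (fob P B) (t B) (?c (fob M A) (fob M B) (fob N B) (s B) (fmap M A B f))"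
        using AB f s t by (intro Ab.cmp_assoc[symmetric]) auto
      also have "\<dots> = ?c (fob M A) (fob N A) (fob P B)
          (?c (fob N A) (fob N B) (fob P B) (t B) (fmap N A B f)) (s A)"
        unfolding nat(1) using AB f s t by (intro Ab.cmp_assoc) auto
      also have "\<dots> = ?c (fob M A) (fob P A) (fob P B) (fmap P A B f)
          (?c (fob M A) (fob N A) (fob P A) (t A) (s A))"
        unfolding nat using AB f s t by (intro Ab.cmp_assoc[symmetric]) auto
      finally show "?c (fob M A) (fob M B) (fob P B)
          ((\<lambda>A\<in>Ob C. ?c (fob M A) (fob N A) (fob P A) (t A) (s A)) B) (fmap M A B f) =
        ?c (fob M A) (fob P A) (fob P B) (fmap P A B f)
          ((\<lambda>A\<in>Ob C. ?c (fob M A) (fob N A) (fob P A) (t A) (s A)) A)"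
        using AB by simp
    qed (use s t in \<open>auto intro!: Ab.cmp_in\<close>)
  next
    case (3 M N s)
    show ?case
      using 3 Modcat_ObD[OF 3(1)] Modcat_ObD[OF 3(2)] unfolding Modcat_simps
      by (intro extensionalityI[where A = "Ob C"])
        (auto simp: Ab.idn_right PiE_iff)
  next
    case (4 M N s)
    show ?case
      using 4 Modcat_ObD[OF 4(1)] Modcat_ObD[OF 4(2)] unfolding Modcat_simps
      by (intro extensionalityI[where A = "Ob C"])
        (auto simp: Ab.idn_left PiE_iff)
  next
    case (5 M N P L s t u)
    show ?case
      using 5(5-) Modcat_ObD[OF 5(1)] Modcat_ObD[OF 5(2)] Modcat_ObD[OF 5(3)] Modcat_ObD[OF 5(4)]
      unfolding Modcat_simps
      by (intro extensionalityI[where A = "Ob C"])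
        (auto simp: PiE_iff intro!: Ab.cmp_assoc)
  qed
qed

lemma zpath_Ob: "zpath C W A p B \<Longrightarrow> A \<in> Ob C \<and> B \<in> Ob C"
  by (induction rule: zpath.induct) auto

lemma zpath_append: "zpath C W A p B \<Longrightarrow> zpath C W B q D \<Longrightarrow> zpath C W A (p @ q) D"
  by (induction rule: zpath.induct) (auto intro: zpath.intros)

lemma (in category) zequiv_zpath: "zequiv C W A B p q \<Longrightarrow> zpath C W A p B \<and> zpath C W A q B"
  by (induction rule: zequiv.induct)
    (auto intro!: zpath.intros idn_in cmp_in intro: zpath_append)

lemma zclass_eqI: "zequiv C W A B p q \<Longrightarrow> zclass C W A B p = zclass C W A B q"
  unfolding zclass_def by (blast intro: zequiv_sym zequiv_trans)

lemma localization_simps: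
  "Ob (localization C W) = Ob C"
  "Hom (localization C W) A B = {zclass C W A B p | p. zpath C W A p B}"
  "idn (localization C W) A = zclass C W A A []"
  by (simp_all add: localization_def)

lemma localization_cmp:
  assumes "zpath C W A p B" "zpath C W B q D"
  shows "cmp (localization C W) A B D (zclass C W B D q) (zclass C W A B p) = zclass C W A D (p @ q)"
  using assms unfolding localization_def zclass_def
  by (auto intro: zequiv_refl zequiv_append zequiv_sym zequiv_trans)

lemma localization_category: "category (localization C W)"
  by unfold_locales
    (auto simp: localization_simps localization_cmp zpath_Nil zpath_append
      intro: exI[of _ "[]"] exI[of _ "_ @ _"] zpath_Nil zpath_append)

lemma (in category) localization_functor_is_functor:
  "is_functor C (localization C W) (localization_functor C W)"
proof -
  have "zpath C W A [Fwd A B f] B" if "A \<in> Ob C" "B \<in> Ob C" "f \<in> Hom C A B" for A B f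
    using that by (intro zpath.intros)
  then show ?thesis
    unfolding is_functor_def localization_functor_def
    by (auto simp: localization_simps localization_cmp idn_in cmp_in
      intro!: zclass_eqI zequiv_idn zequiv_cmp[THEN zequiv_sym])
qed

lemma localization_functor_inverts:
  assumes "A \<in> Ob C" "B \<in> Ob C" "w \<in> Hom C A B" "w \<in> W A B"
  shows "is_iso_pair (localization C W) A B
    (fmap (localization_functor C W) A B w) (zclass C W B A [Inv A B w])"
proof -
  have "zpath C W A [Fwd A B w] B" "zpath C W B [Inv A B w] A"
    using assms by (auto intro!: zpath.intros)
  then show ?thesis
    using assms unfolding is_iso_pair_def localization_functor_def
    by (auto simp: localization_simps localization_cmp
      intro!: zclass_eqI zequiv_Fwd_Inv zequiv_Inv_Fwd)
qed

lemma (in category) iso_pair_unique: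
  assumes "A \<in> Ob C" "B \<in> Ob C" "is_iso_pair C A B f g" "is_iso_pair C A B f h"
  shows "g = h"
proof -
  have "g = cmp C B B A g (cmp C B A B f h)"
    using assms idn_right unfolding is_iso_pair_def by metis
  also have "\<dots> = cmp C B A A (cmp C A B A g f) h"
    using assms cmp_assoc[of B A B A h f g] unfolding is_iso_pair_def by simp
  also have "\<dots> = h"
    using assms idn_left unfolding is_iso_pair_def by metis
  finally show ?thesis .
qed

text \<open>The universal property of the localization: a functor \<open>G\<close> inverting \<open>W\<close> is evaluated
  on paths by sending formal inverses to inverses.\<close>

primrec zeval :: "('p, 'b, 'y) cat_scheme \<Rightarrow> ('o, 'a, 'p, 'b) fctr \<Rightarrow> 'o \<Rightarrow> ('o, 'a) zstep list \<Rightarrow> 'b"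
  where
  "zeval D G E [] = idn D (fob G E)"
| "zeval D G E (s # p) = (case s of
      Fwd A B f \<Rightarrow> cmp D (fob G A) (fob G B) (fob G E) (zeval D G E p) (fmap G A B f)
    | Inv A B w \<Rightarrow> cmp D (fob G B) (fob G A) (fob G E) (zeval D G E p)
        (SOME g. is_iso_pair D (fob G A) (fob G B) (fmap G A B w) g))"

locale inverting_functor = C: category C + D: category D
  for C :: "('o, 'a, 'x) cat_scheme" and D :: "('p, 'b, 'y) cat_scheme" +
  fixes W :: "'o \<Rightarrow> 'o \<Rightarrow> 'a set" and G :: "('o, 'a, 'p, 'b) fctr"
  assumes functor_G: "is_functor C D G"
    and inverts_G: "\<lbrakk>A \<in> Ob C; B \<in> Ob C; w \<in> Hom C A B; w \<in> W A B\<rbrakk>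
      \<Longrightarrow> is_iso_arr D (fob G A) (fob G B) (fmap G A B w)"
begin

abbreviation ginv where
  "ginv A B w \<equiv> SOME g. is_iso_pair D (fob G A) (fob G B) (fmap G A B w) g"

lemma ginv: "\<lbrakk>A \<in> Ob C; B \<in> Ob C; w \<in> Hom C A B; w \<in> W A B\<rbrakk>
    \<Longrightarrow> is_iso_pair D (fob G A) (fob G B) (fmap G A B w) (ginv A B w)"
  using inverts_G unfolding is_iso_arr_def by (metis someI_ex)

lemma G_ob [simp]: "A \<in> Ob C \<Longrightarrow> fob G A \<in> Ob D"
  and G_hom: "\<lbrakk>A \<in> Ob C; B \<in> Ob C; f \<in> Hom C A B\<rbrakk> \<Longrightarrow> fmap G A B f \<in> Hom D (fob G A) (fob G B)"
  and G_idn: "A \<in> Ob C \<Longrightarrow> fmap G A A (idn C A) = idn D (fob G A)"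
  and G_cmp: "\<lbrakk>A \<in> Ob C; B \<in> Ob C; E \<in> Ob C; f \<in> Hom C A B; g \<in> Hom C B E\<rbrakk> \<Longrightarrow>
    fmap G A E (cmp C A B E g f) =
      cmp D (fob G A) (fob G B) (fob G E) (fmap G B E g) (fmap G A B f)"
  using functor_G unfolding is_functor_def by blast+

lemma ginv_right: "\<lbrakk>A \<in> Ob C; B \<in> Ob C; w \<in> Hom C A B; w \<in> W A B\<rbrakk>
    \<Longrightarrow> cmp D (fob G B) (fob G A) (fob G B) (fmap G A B w) (ginv A B w) = idn D (fob G B)"
  and ginv_left: "\<lbrakk>A \<in> Ob C; B \<in> Ob C; w \<in> Hom C A B; w \<in> W A B\<rbrakk>
    \<Longrightarrow> cmp D (fob G A) (fob G B) (fob G A) (ginv A B w) (fmap G A B w) = idn D (fob G A)"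
  using ginv unfolding is_iso_pair_def by blast+

lemma ginv_hom: "\<lbrakk>A \<in> Ob C; B \<in> Ob C; w \<in> Hom C A B; w \<in> W A B\<rbrakk>
    \<Longrightarrow> ginv A B w \<in> Hom D (fob G B) (fob G A)"
  using ginv unfolding is_iso_pair_def by blast

lemma zeval_hom: "zpath C W A p B \<Longrightarrow> zeval D G B p \<in> Hom D (fob G A) (fob G B)"
  by (induction rule: zpath.induct)
    (auto dest: zpath_Ob intro!: D.idn_in D.cmp_in G_hom ginv_hom)

lemma zeval_append:
  "zpath C W A p B \<Longrightarrow> zpath C W B q E \<Longrightarrow>
    zeval D G E (p @ q) = cmp D (fob G A) (fob G B) (fob G E) (zeval D G E q) (zeval D G B p)"
proof (induction rule: zpath.induct)
  case (zpath_Nil A)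
  then show ?case
    using zeval_hom zpath_Ob[OF zpath_Nil(2)] by (simp add: D.idn_right)
next
  case (zpath_Fwd A B f p X)
  then show ?case
    using zpath_Ob[OF zpath_Fwd(4)] zpath_Ob[OF zpath_Fwd(6)]
    by (auto intro!: D.cmp_assoc[symmetric] zeval_hom G_hom)
next
  case (zpath_Inv A B w p X)
  then show ?case
    using zpath_Ob[OF zpath_Inv(5)] zpath_Ob[OF zpath_Inv(7)]
    by (auto intro!: D.cmp_assoc[symmetric] zeval_hom ginv_hom)
qed

lemma zeval_zequiv: "zequiv C W A B p q \<Longrightarrow> zeval D G B p = zeval D G B q"
proof (induction rule: zequiv.induct)
  case (zequiv_append A B p p' E q q')
  then show ?case
    using C.zequiv_zpath zeval_append by metis
next
  case (zequiv_idn A)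
  then show ?case
    by (simp add: G_idn D.idn_left D.idn_in)
next
  case (zequiv_cmp A B E f g)
  then show ?case
    by (simp add: G_cmp G_hom D.idn_left D.cmp_in)
next
  case (zequiv_Fwd_Inv A B w)
  then show ?case
    by (simp add: D.idn_left ginv_hom ginv_left)
next
  case (zequiv_Inv_Fwd A B w)
  then show ?case
    by (simp add: D.idn_left G_hom ginv_right)
qed auto

definition lift :: "('o, ('o, 'a) zstep list set, 'p, 'b) fctr" where
  "lift = \<lparr>fob = fob G, fmap = (\<lambda>A B X. zeval D G B (SOME p. p \<in> X))\<rparr>"

lemma fmap_lift:
  assumes "zpath C W A p B"
  shows "fmap lift A B (zclass C W A B p) = zeval D G B p"
proof -
  have "p \<in> zclass C W A B p"
    using assms by (simp add: zclass_def zequiv_refl)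
  then have "(SOME q. q \<in> zclass C W A B p) \<in> zclass C W A B p"
    by (rule someI)
  then show ?thesis
    using zeval_zequiv by (simp add: zclass_def lift_def)
qed

lemma lift_is_functor: "is_functor (localization C W) D lift"
  unfolding is_functor_def
proof (intro conjI ballI, goal_cases)
  case (4 A B E f g)
  then obtain p q where p: "f = zclass C W A B p" "zpath C W A p B"
    and q: "g = zclass C W B E q" "zpath C W B q E"
    by (auto simp: localization_simps)
  then show ?case
    using zeval_append
    by (simp add: localization_cmp fmap_lift zpath_append) (simp add: lift_def)
qed (auto simp: localization_simps fmap_lift zpath_Nil, auto simp: lift_def zeval_hom)

lemma lift_comp: "fctr_eq C (fctr_comp lift (localization_functor C W)) G"
  unfolding fctr_eq_def
proof (intro conjI ballI, goal_cases)
  case (2 A B f)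
  then have "zpath C W A [Fwd A B f] B"
    by (intro zpath.intros)
  with 2 show ?case
    by (simp add: fctr_comp_def localization_functor_def fmap_lift D.idn_left G_hom)
qed (simp add: fctr_comp_def localization_functor_def lift_def)

lemma lift_unique:
  assumes H: "is_functor (localization C W) D H"
    and eq: "fctr_eq C (fctr_comp H (localization_functor C W)) G"
  shows "fctr_eq (localization C W) H lift"
proof -
  have ob: "fob H A = fob G A" if "A \<in> Ob C" for A
    using eq that by (simp add: fctr_eq_def fctr_comp_def localization_functor_def)
  have fwd: "fmap H A B (zclass C W A B [Fwd A B f]) = fmap G A B f"
    if "A \<in> Ob C" "B \<in> Ob C" "f \<in> Hom C A B" for A B f
    using eq that by (simp add: fctr_eq_def fctr_comp_def localization_functor_def)
  have H_idn: "fmap H A A (zclass C W A A []) = idn D (fob G A)" if "A \<in> Ob C" for A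
    using H that ob by (simp add: is_functor_def localization_simps)
  have H_cmp: "fmap H A E (zclass C W A E (p @ q)) =
      cmp D (fob G A) (fob G B) (fob G E) (fmap H B E (zclass C W B E q)) (fmap H A B (zclass C W A B p))"
    if "zpath C W A p B" "zpath C W B q E" for A B E p q
  proof -
    have "zclass C W A B p \<in> Hom (localization C W) A B" "zclass C W B E q \<in> Hom (localization C W) B E"
      using that by (auto simp: localization_simps)
    then show ?thesis
      using H that zpath_Ob[OF that(1)] zpath_Ob[OF that(2)] localization_cmp[OF that] ob
      unfolding is_functor_def by (metis localization_simps(1))
  qed
  have H_hom: "fmap H A B (zclass C W A B p) \<in> Hom D (fob G A) (fob G B)"
    if "zpath C W A p B" for A B p
  proof -
    have "zclass C W A B p \<in> Hom (localization C W) A B"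
      using that by (auto simp: localization_simps)
    then show ?thesis
      using H zpath_Ob[OF that] ob unfolding is_functor_def by (metis localization_simps(1))
  qed
  have inv: "fmap H B A (zclass C W B A [Inv A B w]) = ginv A B w"
    if w: "A \<in> Ob C" "B \<in> Ob C" "w \<in> Hom C A B" "w \<in> W A B" for A B w
  proof -
    have p: "zpath C W A [Fwd A B w] B" "zpath C W B [Inv A B w] A"
      using w by (auto intro!: zpath.intros)
    have "is_iso_pair D (fob G A) (fob G B) (fmap G A B w) (fmap H B A (zclass C W B A [Inv A B w]))"
      unfolding is_iso_pair_def
      using H_cmp[OF p] H_cmp[OF p(2) p(1)] fwd[OF w(1-3)] H_idn w H_hom[OF p(2)] G_hom
        zclass_eqI[OF zequiv_Fwd_Inv[of A C B w W, OF w]]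
        zclass_eqI[OF zequiv_Inv_Fwd[of A C B w W, OF w]]
      by simp
    then show ?thesis
      using ginv[OF w] w D.iso_pair_unique G_ob by blast
  qed
  have "fmap H A B (zclass C W A B p) = zeval D G B p" if "zpath C W A p B" for A B p
    using that
  proof (induction rule: zpath.induct)
    case (zpath_Nil A)
    then show ?case
      by (simp add: H_idn)
  next
    case (zpath_Fwd A B f p E)
    then have "zpath C W A [Fwd A B f] B"
      by (auto intro!: zpath.intros)
    from H_cmp[OF this zpath_Fwd(4)] zpath_Fwd show ?case
      by (simp add: fwd)
  next
    case (zpath_Inv A B w p E)
    then have "zpath C W B [Inv A B w] A"
      by (auto intro!: zpath.intros)
    from H_cmp[OF this zpath_Inv(5)] zpath_Inv show ?case
      by (simp add: inv)
  qed
  then show ?thesis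
    unfolding fctr_eq_def using ob by (auto simp: localization_simps fmap_lift) (simp add: lift_def)
qed

end

lemma Ob_Prefrag:
  "M \<in> Ob (Prefrag \<Gamma> R F \<Lambda>) \<longleftrightarrow> M \<in> Ob (Modcat (Fcat \<Gamma> R F \<Lambda>)) \<and>
     (\<forall>\<alpha>\<in>\<Lambda>. \<forall>\<beta>\<in>\<Lambda>. \<alpha> \<preceq>\<^bsub>\<Gamma>\<^esub> \<beta> \<longrightarrow> fmap M \<alpha> \<beta> \<one>\<^bsub>R\<^esub> \<in> mon (fob M \<alpha>) (fob M \<beta>))"
  by (simp add: Prefrag_def full_sub_def)

lemma Ob_Preglid:
  "M \<in> Ob (Preglid \<Gamma> R F \<Lambda>) \<longleftrightarrow> M \<in> Ob (Modcat (Fbar \<Gamma> R F \<Lambda>)) \<and>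
     (\<forall>\<alpha>\<in>ext_set \<Lambda>. \<forall>\<beta>\<in>ext_set \<Lambda>.
        ext_le \<Gamma> \<alpha> \<beta> \<longrightarrow> fmap M \<alpha> \<beta> \<one>\<^bsub>R\<^esub> \<in> mon (fob M \<alpha>) (fob M \<beta>))"
  by (simp add: Preglid_def full_sub_def)

lemma Prefrag_simps:
  "Hom (Prefrag \<Gamma> R F \<Lambda>) = Hom (Modcat (Fcat \<Gamma> R F \<Lambda>))"
  "idn (Prefrag \<Gamma> R F \<Lambda>) = idn (Modcat (Fcat \<Gamma> R F \<Lambda>))"
  "cmp (Prefrag \<Gamma> R F \<Lambda>) = cmp (Modcat (Fcat \<Gamma> R F \<Lambda>))"
  by (simp_all add: Prefrag_def full_sub_def)

lemma Preglid_simps: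
  "Hom (Preglid \<Gamma> R F \<Lambda>) = Hom (Modcat (Fbar \<Gamma> R F \<Lambda>))"
  "idn (Preglid \<Gamma> R F \<Lambda>) = idn (Modcat (Fbar \<Gamma> R F \<Lambda>))"
  "cmp (Preglid \<Gamma> R F \<Lambda>) = cmp (Modcat (Fbar \<Gamma> R F \<Lambda>))"
  by (simp_all add: Preglid_def full_sub_def)

lemma Fin_Fbar:
  "Fin \<alpha> \<in> Ob (Fbar \<Gamma> R F \<Lambda>) \<longleftrightarrow> \<alpha> \<in> Ob (Fcat \<Gamma> R F \<Lambda>)"
  "Hom (Fbar \<Gamma> R F \<Lambda>) (Fin \<alpha>) (Fin \<beta>) = Hom (Fcat \<Gamma> R F \<Lambda>) \<alpha> \<beta>"
  "idn (Fbar \<Gamma> R F \<Lambda>) (Fin \<alpha>) = idn (Fcat \<Gamma> R F \<Lambda>) \<alpha>"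
  "cmp (Fbar \<Gamma> R F \<Lambda>) (Fin \<alpha>) (Fin \<beta>) (Fin \<gamma>) = cmp (Fcat \<Gamma> R F \<Lambda>) \<alpha> \<beta> \<gamma>"
  "hom_group (Fbar \<Gamma> R F \<Lambda>) (Fin \<alpha>) (Fin \<beta>) = hom_group (Fcat \<Gamma> R F \<Lambda>) \<alpha> \<beta>"
  by (auto simp: Fbar_def Fcat_def ext_set_def hom_group_def)

lemma Ob_Fcat: "Ob (Fcat \<Gamma> R F \<Lambda>) = \<Lambda>"
  by (simp add: Fcat_def)

lemma Res_simps:
  "fob (fob (Res \<Lambda>) M) \<alpha> = fob M (Fin \<alpha>)"
  "fmap (fob (Res \<Lambda>) M) \<alpha> \<beta> = fmap M (Fin \<alpha>) (Fin \<beta>)"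
  "fmap (Res \<Lambda>) M N t = (\<lambda>\<alpha>\<in>\<Lambda>. t (Fin \<alpha>))"
  by (simp_all add: Res_def)

lemma Res_Ob: "M \<in> Ob (Preglid \<Gamma> R F \<Lambda>) \<Longrightarrow> fob (Res \<Lambda>) M \<in> Ob (Prefrag \<Gamma> R F \<Lambda>)"
proof -
  assume M: "M \<in> Ob (Preglid \<Gamma> R F \<Lambda>)"
  then have add: "is_additive_functor (Fbar \<Gamma> R F \<Lambda>) Ab M"
    by (simp add: Ob_Preglid Modcat_simps)
  have "is_additive_functor (Fcat \<Gamma> R F \<Lambda>) Ab (fob (Res \<Lambda>) M)"
    unfolding is_additive_functor_def is_functor_def Res_simps Fin_Fbar[symmetric]
    using add unfolding is_additive_functor_def is_functor_def
    by (intro conjI ballI; simp only: Fin_Fbar(1)[symmetric]; blast)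
  moreover have "fmap M (Fin \<alpha>) (Fin \<beta>) \<one>\<^bsub>R\<^esub> \<in> mon (fob M (Fin \<alpha>)) (fob M (Fin \<beta>))"
    if "\<alpha> \<in> \<Lambda>" "\<beta> \<in> \<Lambda>" "\<alpha> \<preceq>\<^bsub>\<Gamma>\<^esub> \<beta>" for \<alpha> \<beta>
    using M that unfolding Ob_Preglid ext_set_def by force
  ultimately show "fob (Res \<Lambda>) M \<in> Ob (Prefrag \<Gamma> R F \<Lambda>)"
    by (simp add: Ob_Prefrag Modcat_simps Res_simps)
qed

lemma Res_Hom:
  assumes "t \<in> Hom (Preglid \<Gamma> R F \<Lambda>) M N"
  shows "fmap (Res \<Lambda>) M N t \<in> Hom (Prefrag \<Gamma> R F \<Lambda>) (fob (Res \<Lambda>) M) (fob (Res \<Lambda>) N)"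
proof -
  let ?B = "Fbar \<Gamma> R F \<Lambda>"
  have t: "t \<in> (\<Pi>\<^sub>E A\<in>Ob ?B. Hom Ab (fob M A) (fob N A))"
    and nat: "\<And>A B f. \<lbrakk>A \<in> Ob ?B; B \<in> Ob ?B; f \<in> Hom ?B A B\<rbrakk> \<Longrightarrow>
          cmp Ab (fob M A) (fob M B) (fob N B) (t B) (fmap M A B f) =
          cmp Ab (fob M A) (fob N A) (fob N B) (fmap N A B f) (t A)"
    using assms unfolding Preglid_simps Modcat_simps by blast+
  have "t (Fin \<alpha>) \<in> Hom Ab (fob M (Fin \<alpha>)) (fob N (Fin \<alpha>))" if "\<alpha> \<in> \<Lambda>" for \<alpha>
    using t that by (auto simp: PiE_iff Fin_Fbar Ob_Fcat)
  moreover note nat[of "Fin _" "Fin _", unfolded Fin_Fbar Ob_Fcat]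
  ultimately show ?thesis
    unfolding Prefrag_simps Modcat_simps Res_simps Ob_Fcat by auto
qed

lemma Res_is_functor: "is_functor (Preglid \<Gamma> R F \<Lambda>) (Prefrag \<Gamma> R F \<Lambda>) (Res \<Lambda>)"
  unfolding is_functor_def
proof (intro conjI ballI, goal_cases)
  case (3 M)
  then show ?case
    unfolding Prefrag_simps Preglid_simps Modcat_simps Res_simps Ob_Fcat
    by (auto simp: Fin_Fbar Ob_Fcat)
next
  case (4 M N P s t)
  then show ?case
    unfolding Prefrag_simps Preglid_simps Modcat_simps Res_simps Ob_Fcat
    by (auto simp: Fin_Fbar Ob_Fcat)
qed (auto intro: Res_Ob Res_Hom)

lemma Res_inverts:
  assumes M: "M \<in> Ob (Preglid \<Gamma> R F \<Lambda>)" and N: "N \<in> Ob (Preglid \<Gamma> R F \<Lambda>)"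
    and s: "s \<in> Sigma_glid \<Gamma> R F \<Lambda> M N"
  shows "is_iso_arr (Prefrag \<Gamma> R F \<Lambda>) (fob (Res \<Lambda>) M) (fob (Res \<Lambda>) N) (fmap (Res \<Lambda>) M N s)"
proof -
  let ?F = "Fcat \<Gamma> R F \<Lambda>" and ?c = "\<lambda>X Y Z. cmp (Ab :: ('m monoid, 'm \<Rightarrow> 'm) pcat) X Y Z"
  interpret Ab: category "Ab :: ('m monoid, 'm \<Rightarrow> 'm) pcat"
    by (rule Ab_category)
  define M' N' s' where "M' = fob (Res \<Lambda>) M" and "N' = fob (Res \<Lambda>) N"
    and "s' = fmap (Res \<Lambda>) M N s"
  have M'_ob: "M' \<in> Ob (Modcat ?F)" and N'_ob: "N' \<in> Ob (Modcat ?F)"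
    using Res_Ob[OF M] Res_Ob[OF N] by (simp_all add: Ob_Prefrag M'_def N'_def)
  have s': "s' \<in> Hom (Modcat ?F) M' N'"
    using s Res_Hom[of s \<Gamma> R F \<Lambda> M N] unfolding Sigma_glid_def Prefrag_simps M'_def N'_def s'_def
    by blast
  have iso: "s' \<alpha> \<in> iso (fob M' \<alpha>) (fob N' \<alpha>)" if "\<alpha> \<in> \<Lambda>" for \<alpha>
    using s that by (simp add: Sigma_glid_def M'_def N'_def s'_def Res_simps)
  define t where "t = (\<lambda>\<alpha>\<in>\<Lambda>. \<lambda>y\<in>carrier (fob N' \<alpha>). inv_into (carrier (fob M' \<alpha>)) (s' \<alpha>) y)"
  have s'_hom: "s' \<alpha> \<in> Hom Ab (fob M' \<alpha>) (fob N' \<alpha>)" if "\<alpha> \<in> \<Lambda>" for \<alpha>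
    using s' that unfolding Modcat_simps Ob_Fcat by auto
  have t_hom: "t \<alpha> \<in> Hom Ab (fob N' \<alpha>) (fob M' \<alpha>)" if "\<alpha> \<in> \<Lambda>" for \<alpha>
  proof -
    interpret comm_group "fob M' \<alpha>"
      using Modcat_ObD(1)[OF M'_ob, of \<alpha>] that by (simp add: Ob_Fcat Ab_simps)
    interpret N: comm_group "fob N' \<alpha>"
      using Modcat_ObD(1)[OF N'_ob, of \<alpha>] that by (simp add: Ob_Fcat Ab_simps)
    have "inv_into (carrier (fob M' \<alpha>)) (s' \<alpha>) \<in> hom (fob N' \<alpha>) (fob M' \<alpha>)"
      using iso_set_sym[OF iso[OF that]] by (simp add: iso_def)
    then show ?thesis
      using that by (auto simp: t_def Ab_simps hom_def Pi_iff)
  qed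
  have st: "?c (fob N' \<alpha>) (fob M' \<alpha>) (fob N' \<alpha>) (s' \<alpha>) (t \<alpha>) = idn Ab (fob N' \<alpha>)"
    and ts: "?c (fob M' \<alpha>) (fob N' \<alpha>) (fob M' \<alpha>) (t \<alpha>) (s' \<alpha>) = idn Ab (fob M' \<alpha>)" if "\<alpha> \<in> \<Lambda>" for \<alpha>
  proof -
    have bij: "bij_betw (s' \<alpha>) (carrier (fob M' \<alpha>)) (carrier (fob N' \<alpha>))"
      using iso[OF that] by (simp add: iso_def)
    show "?c (fob N' \<alpha>) (fob M' \<alpha>) (fob N' \<alpha>) (s' \<alpha>) (t \<alpha>) = idn Ab (fob N' \<alpha>)"
      using bij that by (auto simp: Ab_simps t_def compose_def fun_eq_iff bij_betw_inv_into_right)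
    show "?c (fob M' \<alpha>) (fob N' \<alpha>) (fob M' \<alpha>) (t \<alpha>) (s' \<alpha>) = idn Ab (fob M' \<alpha>)"
      using bij that bij_betwE[OF bij]
      by (auto simp: Ab_simps t_def compose_def fun_eq_iff bij_betw_inv_into_left)
  qed
  have t: "t \<in> Hom (Modcat ?F) N' M'"
    unfolding Modcat_simps Ob_Fcat
  proof (intro conjI ballI)
    fix \<alpha> \<beta> f
    assume ab: "\<alpha> \<in> \<Lambda>" "\<beta> \<in> \<Lambda>" and f: "f \<in> Hom ?F \<alpha> \<beta>"
    note ob [simp] = ab Modcat_ObD(1)[OF M'_ob, unfolded Ob_Fcat] Modcat_ObD(1)[OF N'_ob, unfolded Ob_Fcat]
    note h = Modcat_ObD(2)[OF M'_ob, unfolded Ob_Fcat, OF ab f] Modcat_ObD(2)[OF N'_ob, unfolded Ob_Fcat, OF ab f]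
      s'_hom[OF ab(1)] s'_hom[OF ab(2)] t_hom[OF ab(1)] t_hom[OF ab(2)]
    let ?m = "fob M'" and ?n = "fob N'" and ?fm = "fmap M' \<alpha> \<beta> f" and ?fn = "fmap N' \<alpha> \<beta> f"
    have nat: "?c (?m \<alpha>) (?m \<beta>) (?n \<beta>) (s' \<beta>) ?fm = ?c (?m \<alpha>) (?n \<alpha>) (?n \<beta>) ?fn (s' \<alpha>)"
      using s' ab f unfolding Modcat_simps Ob_Fcat by blast
    have "?c (?n \<alpha>) (?n \<beta>) (?m \<beta>) (t \<beta>) ?fn =
        ?c (?n \<alpha>) (?n \<beta>) (?m \<beta>) (t \<beta>)
          (?c (?n \<alpha>) (?n \<alpha>) (?n \<beta>) ?fn (?c (?n \<alpha>) (?m \<alpha>) (?n \<alpha>) (s' \<alpha>) (t \<alpha>)))"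
      using h by (simp add: st Ab.idn_right)
    also have "\<dots> = ?c (?n \<alpha>) (?n \<beta>) (?m \<beta>) (t \<beta>)
          (?c (?n \<alpha>) (?m \<alpha>) (?n \<beta>) (?c (?m \<alpha>) (?m \<beta>) (?n \<beta>) (s' \<beta>) ?fm) (t \<alpha>))"
      using h unfolding nat by (subst Ab.cmp_assoc[where f = "t \<alpha>"]) simp_all
    also have "\<dots> = ?c (?n \<alpha>) (?m \<alpha>) (?m \<beta>)
        (?c (?m \<alpha>) (?n \<beta>) (?m \<beta>) (t \<beta>) (?c (?m \<alpha>) (?m \<beta>) (?n \<beta>) (s' \<beta>) ?fm)) (t \<alpha>)"
      using h by (intro Ab.cmp_assoc Ab.cmp_in) simp_all
    also have "?c (?m \<alpha>) (?n \<beta>) (?m \<beta>) (t \<beta>) (?c (?m \<alpha>) (?m \<beta>) (?n \<beta>) (s' \<beta>) ?fm) =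
        ?c (?m \<alpha>) (?m \<beta>) (?m \<beta>) (?c (?m \<beta>) (?n \<beta>) (?m \<beta>) (t \<beta>) (s' \<beta>)) ?fm"
      using h by (intro Ab.cmp_assoc) simp_all
    also have "\<dots> = ?fm"
      using h by (simp add: ts Ab.idn_left)
    finally show "?c (?n \<alpha>) (?n \<beta>) (?m \<beta>) (t \<beta>) ?fn = ?c (?n \<alpha>) (?m \<alpha>) (?m \<beta>) ?fm (t \<alpha>)" .
  qed (use t_hom in \<open>auto simp: PiE_iff\<close>, simp add: t_def)
  have "cmp (Modcat ?F) M' N' M' t s' = idn (Modcat ?F) M'"
    "cmp (Modcat ?F) N' M' N' s' t = idn (Modcat ?F) N'"
    unfolding Modcat_simps Ob_Fcat using st ts by (auto intro!: restrict_ext)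
  with s' t show ?thesis
    unfolding is_iso_arr_def is_iso_pair_def Prefrag_simps
      M'_def[symmetric] N'_def[symmetric] s'_def[symmetric] by blast
qed

lemma glid_embedding_exists:
  fixes F :: "'g \<Rightarrow> 'r set"
  shows "\<exists>\<phi> :: (('g, 'r, 'm) preglid, ('g, 'r, 'm) glid_arr,
        ('g, 'r, 'm) prefrag, ('g, 'm) prefrag_arr) fctr.
      is_glid_embedding \<Gamma> R F \<Lambda> \<phi> \<and>
      (\<forall>\<psi>. is_glid_embedding \<Gamma> R F \<Lambda> \<psi> \<longrightarrow> fctr_eq (Glid \<Gamma> R F \<Lambda>) \<psi> \<phi>)"
proof -
  interpret inverting_functor
    "Preglid \<Gamma> R F \<Lambda> :: (('g, 'r, 'm) preglid, ('g, 'm) preglid_arr) pcat"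
    "Prefrag \<Gamma> R F \<Lambda> :: (('g, 'r, 'm) prefrag, ('g, 'm) prefrag_arr) pcat"
    "Sigma_glid \<Gamma> R F \<Lambda>" "Res \<Lambda>"
    unfolding inverting_functor_def inverting_functor_axioms_def
    using Res_is_functor Res_inverts
    by (auto simp: Preglid_def Prefrag_def intro!: category_full_sub Modcat_category)
  show ?thesis
    using lift_is_functor lift_comp lift_unique
    unfolding is_glid_embedding_def Glid_def Q_glid_def by blast
qed

end

theory Submission
  imports Defs "HOL-Algebra.Generated_Groups"
begin

text \<open>In both module categories the kernel-cokernel pairs are exactly the pointwise short exact
  sequences, so restriction preserves conflations, and hence so does \<open>\<phi>\<close>. For the converse, a
  natural transformation \<open>t : Res M \<rightarrow> Res N\<close> is the image under \<open>\<phi>\<close> of the roof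
  \<open>M \<leftarrow> G \<rightarrow> N\<close>, where \<open>G\<close> is the submodule of \<open>M \<times> N\<close> spanned by the graph of \<open>t\<close>; every
  arrow of the localization equals the roof of its image, so \<open>\<phi>\<close> is fully faithful. If
  \<open>\<phi>(K) \<rightarrow> \<phi>(M) \<rightarrow> \<phi>(N)\<close> is a conflation, let \<open>M'\<close> be the graph module of \<open>\<phi>(g)\<close>. The
  projection \<open>M' \<rightarrow> N\<close>, its kernel \<open>K'\<close> and its image \<open>N'\<close> form a conflation of preglids whose
  restriction is isomorphic to the given one, and full faithfulness lifts this isomorphism to
  glids.\<close>

section \<open>Modules elementwise\<close>

text \<open>Arrows of the localization are classes of arbitrary zigzags, and no calculus of
  fractions for \<Sigma> is set up. A canonical choice takes its place: the graph module depends
  only on \<open>t\<close> and the two endpoints, so a glid arrow equals one definite roof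
  determined by its image, and induction along a zigzag is enough for faithfulness. The obstacle in
  the converse is that \<open>g\<close> need not come from a preglid arrow M -> N. On the graph
  module it becomes a projection, to which kernels and images of preglids apply. N has to be
  replaced by the image because the projection may miss part of N at \<open>Infty\<close>. A change
  at \<open>Infty\<close> alone is invisible in the localization, while at finite objects the given
  exactness makes kernel and image agree with K and N.\<close>

lemma Modcat_group: "M \<in> Ob (Modcat C) \<Longrightarrow> A \<in> Ob C \<Longrightarrow> comm_group (fob M A)"
  using Modcat_ObD(1)[of M C A] by (simp add: Ab_simps)

lemma Modcat_is_group: "M \<in> Ob (Modcat C) \<Longrightarrow> A \<in> Ob C \<Longrightarrow> group (fob M A)"
  by (rule comm_group.axioms(2)[OF Modcat_group])

lemma Modcat_map_hom:
  "\<lbrakk>M \<in> Ob (Modcat C); A \<in> Ob C; B \<in> Ob C; f \<in> Hom C A B\<rbrakk> \<Longrightarrow> fmap M A B f \<in> hom (fob M A) (fob M B)"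
  using Modcat_ObD(2)[of M C A B f] by (simp add: Ab_simps)

lemma Modcat_map_closed:
  "\<lbrakk>M \<in> Ob (Modcat C); A \<in> Ob C; B \<in> Ob C; f \<in> Hom C A B; x \<in> carrier (fob M A)\<rbrakk>
    \<Longrightarrow> fmap M A B f x \<in> carrier (fob M B)"
  using Modcat_map_hom[of M C A B f] hom_in_carrier by fast

lemma Modcat_map_idn:
  "\<lbrakk>M \<in> Ob (Modcat C); A \<in> Ob C; x \<in> carrier (fob M A)\<rbrakk> \<Longrightarrow> fmap M A A (idn C A) x = x"
  by (simp add: Modcat_simps is_additive_functor_def is_functor_def Ab_simps)

lemma Modcat_map_cmp:
  "\<lbrakk>M \<in> Ob (Modcat C); A \<in> Ob C; B \<in> Ob C; E \<in> Ob C; f \<in> Hom C A B; g \<in> Hom C B E;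
    x \<in> carrier (fob M A)\<rbrakk> \<Longrightarrow> fmap M A E (cmp C A B E g f) x = fmap M B E g (fmap M A B f x)"
  by (simp add: Modcat_simps is_additive_functor_def is_functor_def Ab_simps compose_eq)

lemma Modcat_map_add:
  "\<lbrakk>M \<in> Ob (Modcat C); A \<in> Ob C; B \<in> Ob C; f \<in> Hom C A B; g \<in> Hom C A B; x \<in> carrier (fob M A)\<rbrakk>
    \<Longrightarrow> fmap M A B (hadd C A B f g) x = fmap M A B f x \<otimes>\<^bsub>fob M B\<^esub> fmap M A B g x"
  by (simp add: Modcat_simps is_additive_functor_def hom_def hom_group_def) (simp add: Ab_def)

text \<open>Since all maps are extensional, equations between values on the carriers already give
  the equations between arrows of \<open>Ab\<close> that an additive functor must satisfy.\<close>

lemma (in preadditive_category) Modcat_ObI: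
  assumes "\<And>A. A \<in> Ob C \<Longrightarrow> comm_group (fob M A)"
    and hom: "\<And>A B f. \<lbrakk>A \<in> Ob C; B \<in> Ob C; f \<in> Hom C A B\<rbrakk>
      \<Longrightarrow> fmap M A B f \<in> hom (fob M A) (fob M B) \<inter> extensional (carrier (fob M A))"
    and idn: "\<And>A x. \<lbrakk>A \<in> Ob C; x \<in> carrier (fob M A)\<rbrakk> \<Longrightarrow> fmap M A A (idn C A) x = x"
    and cmp: "\<And>A B E f g x. \<lbrakk>A \<in> Ob C; B \<in> Ob C; E \<in> Ob C; f \<in> Hom C A B; g \<in> Hom C B E;
        x \<in> carrier (fob M A)\<rbrakk> \<Longrightarrow> fmap M A E (cmp C A B E g f) x = fmap M B E g (fmap M A B f x)"
    and add: "\<And>A B f g x. \<lbrakk>A \<in> Ob C; B \<in> Ob C; f \<in> Hom C A B; g \<in> Hom C A B; x \<in> carrier (fob M A)\<rbrakk>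
        \<Longrightarrow> fmap M A B (hadd C A B f g) x = fmap M A B f x \<otimes>\<^bsub>fob M B\<^esub> fmap M A B g x"
  shows "M \<in> Ob (Modcat C)"
proof -
  have hadd: "hadd C A B f g \<in> Hom C A B"
    if "A \<in> Ob C" "B \<in> Ob C" "f \<in> Hom C A B" "g \<in> Hom C A B" for A B f g
  proof -
    interpret comm_group "hom_group C A B"
      by (rule hom_comm_group[OF that(1,2)])
    show ?thesis
      using m_closed[of f g] that by (simp add: hom_group_def)
  qed
  have "fmap M A A (idn C A) = (\<lambda>x\<in>carrier (fob M A). x)" if "A \<in> Ob C" for A
    using hom[OF that that idn_in[OF that]] idn[OF that] by (intro extensionalityI) auto
  moreover have "fmap M A E (cmp C A B E g f) = compose (carrier (fob M A)) (fmap M B E g) (fmap M A B f)"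
    if h: "A \<in> Ob C" "B \<in> Ob C" "E \<in> Ob C" "f \<in> Hom C A B" "g \<in> Hom C B E" for A B E f g
    using hom[OF h(1,3) cmp_in[OF h]] cmp[OF h]
    by (intro extensionalityI[where A = "carrier (fob M A)"]) (auto simp: compose_eq)
  moreover have "fmap M A B (hadd C A B f g) = (\<lambda>x\<in>carrier (fob M A). fmap M A B f x \<otimes>\<^bsub>fob M B\<^esub> fmap M A B g x)"
    if h: "A \<in> Ob C" "B \<in> Ob C" "f \<in> Hom C A B" "g \<in> Hom C A B" for A B f g
    using hom[OF h(1,2) hadd[OF h]] add[OF h]
    by (intro extensionalityI[where A = "carrier (fob M A)"]) auto
  ultimately show ?thesis
    using assms(1) hom
    by (simp add: Modcat_simps is_additive_functor_def is_functor_def Ab_simps hom_def[of "hom_group _ _ _"])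
      (simp add: hom_group_def Ab_def)
qed

text \<open>From 0 + 0 = 0 the value is idempotent in a group, hence the unit. This settles the
  arrows from \<open>Infty\<close> to finite objects, where zero is the only element.\<close>

lemma (in preadditive_category) Modcat_map_zero:
  assumes M: "M \<in> Ob (Modcat C)" and AB: "A \<in> Ob C" "B \<in> Ob C" and x: "x \<in> carrier (fob M A)"
  shows "fmap M A B (hzero C A B) x = \<one>\<^bsub>fob M B\<^esub>"
proof -
  interpret H: comm_group "hom_group C A B"
    by (rule hom_comm_group[OF AB])
  interpret B: comm_group "fob M B"
    by (rule Modcat_group[OF M AB(2)])
  have z: "hzero C A B \<in> Hom C A B" "hadd C A B (hzero C A B) (hzero C A B) = hzero C A B"
    using H.one_closed H.r_one[of "hzero C A B"] by (simp_all add: hom_group_def)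
  show ?thesis
    using Modcat_map_add[OF M AB z(1) z(1) x] Modcat_map_closed[OF M AB z(1) x] z(2) by simp
qed

lemma compose_eq_iff: "compose X g f = compose X g' f' \<longleftrightarrow> (\<forall>x\<in>X. g (f x) = g' (f' x))"
  unfolding compose_def by (auto simp: restrict_def fun_eq_iff)

lemma Modcat_Hom_iff:
  "t \<in> Hom (Modcat C) M N \<longleftrightarrow> t \<in> extensional (Ob C) \<and>
     (\<forall>A\<in>Ob C. t A \<in> hom (fob M A) (fob N A) \<and> t A \<in> extensional (carrier (fob M A))) \<and>
     (\<forall>A\<in>Ob C. \<forall>B\<in>Ob C. \<forall>f\<in>Hom C A B. \<forall>x\<in>carrier (fob M A).
        t B (fmap M A B f x) = fmap N A B f (t A x))"
  unfolding Modcat_simps Ab_simps PiE_iff compose_eq_iff by auto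

lemma Modcat_arr_hom: "t \<in> Hom (Modcat C) M N \<Longrightarrow> A \<in> Ob C \<Longrightarrow> t A \<in> hom (fob M A) (fob N A)"
  by (simp add: Modcat_Hom_iff)

lemma Modcat_arr_closed:
  "t \<in> Hom (Modcat C) M N \<Longrightarrow> A \<in> Ob C \<Longrightarrow> x \<in> carrier (fob M A) \<Longrightarrow> t A x \<in> carrier (fob N A)"
  using Modcat_arr_hom hom_in_carrier by fast

lemma Modcat_arr_nat:
  "\<lbrakk>t \<in> Hom (Modcat C) M N; A \<in> Ob C; B \<in> Ob C; f \<in> Hom C A B; x \<in> carrier (fob M A)\<rbrakk>
    \<Longrightarrow> t B (fmap M A B f x) = fmap N A B f (t A x)"
  by (simp add: Modcat_Hom_iff)

lemma Modcat_arr_eqI: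
  assumes "t \<in> Hom (Modcat C) M N" "s \<in> Hom (Modcat C) M N'"
    and "\<And>A x. A \<in> Ob C \<Longrightarrow> x \<in> carrier (fob M A) \<Longrightarrow> t A x = s A x"
  shows "t = s"
proof (rule extensionalityI[where A = "Ob C"])
  show "t A = s A" if "A \<in> Ob C" for A
    using assms that unfolding Modcat_Hom_iff by (blast intro: extensionalityI)
qed (use assms in \<open>simp_all add: Modcat_Hom_iff\<close>)

lemma Modcat_arr_one:
  assumes "M \<in> Ob (Modcat C)" "N \<in> Ob (Modcat C)" "t \<in> Hom (Modcat C) M N" "A \<in> Ob C"
  shows "t A \<one>\<^bsub>fob M A\<^esub> = \<one>\<^bsub>fob N A\<^esub>"
  using assms by (intro hom_one[OF Modcat_arr_hom] Modcat_is_group)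

lemma Modcat_arr_group_hom:
  assumes "M \<in> Ob (Modcat C)" "N \<in> Ob (Modcat C)" "t \<in> Hom (Modcat C) M N" "A \<in> Ob C"
  shows "group_hom (fob M A) (fob N A) (t A)"
  using assms by (intro group_hom.intro group_hom_axioms.intro Modcat_is_group Modcat_arr_hom)

text \<open>The two restrictions put a raw family of functions into the normal form of an arrow.
  Identities, composites and zero arrows of \<open>Modcat\<close> all have this shape, so equality
  of arrows reduces to equality of values on elements.\<close>

definition mkarr :: "('o, 'a, 'x) pcat_scheme \<Rightarrow> ('o, 'a, 'm monoid, 'b) fctr
    \<Rightarrow> ('o \<Rightarrow> 'm \<Rightarrow> 'm) \<Rightarrow> 'o \<Rightarrow> 'm \<Rightarrow> 'm" where
  "mkarr C M h = (\<lambda>A\<in>Ob C. \<lambda>x\<in>carrier (fob M A). h A x)"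

lemma mkarr_apply [simp]: "A \<in> Ob C \<Longrightarrow> x \<in> carrier (fob M A) \<Longrightarrow> mkarr C M h A x = h A x"
  by (simp add: mkarr_def)

lemma mkarr_Hom:
  assumes M: "M \<in> Ob (Modcat C)"
    and hom: "\<And>A. A \<in> Ob C \<Longrightarrow> h A \<in> hom (fob M A) (fob N A)"
    and nat: "\<And>A B f x. \<lbrakk>A \<in> Ob C; B \<in> Ob C; f \<in> Hom C A B; x \<in> carrier (fob M A)\<rbrakk>
      \<Longrightarrow> h B (fmap M A B f x) = fmap N A B f (h A x)"
  shows "mkarr C M h \<in> Hom (Modcat C) M N"
proof -
  show ?thesis
    unfolding Modcat_Hom_iff
  proof (intro conjI ballI)
    show "mkarr C M h A \<in> hom (fob M A) (fob N A)" if "A \<in> Ob C" for A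
      using hom[OF that] that monoid.m_closed[OF group.is_monoid[OF Modcat_is_group[OF M that]]] by (auto simp: hom_def mkarr_def)
  qed (use nat Modcat_map_closed[OF M] in \<open>auto simp: mkarr_def\<close>)
qed

lemma Modcat_idn: "idn (Modcat C) M = mkarr C M (\<lambda>A x. x)"
  by (simp add: Modcat_simps Ab_simps mkarr_def)

lemma Modcat_cmp: "cmp (Modcat C) M N P t s = mkarr C M (\<lambda>A x. t A (s A x))"
  by (simp add: Modcat_simps Ab_simps mkarr_def compose_def)

lemma Modcat_hzero: "hzero (Modcat C) M N = mkarr C M (\<lambda>A x. \<one>\<^bsub>fob N A\<^esub>)"
  by (simp add: Modcat_def Ab_def mkarr_def)

lemma mkarr_cong:
  "(\<And>A x. A \<in> Ob C \<Longrightarrow> x \<in> carrier (fob M A) \<Longrightarrow> h A x = k A x) \<Longrightarrow> mkarr C M h = mkarr C M k"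
  unfolding mkarr_def by (intro restrict_ext)

lemma mkarr_eqD:
  "mkarr C M h = mkarr C M k \<Longrightarrow> A \<in> Ob C \<Longrightarrow> x \<in> carrier (fob M A) \<Longrightarrow> h A x = k A x"
  using mkarr_apply[of A C x M h] mkarr_apply[of A C x M k] by simp

lemma Modcat_arr_eq_mkarr:
  assumes "t \<in> Hom (Modcat C) M N"
  shows "mkarr C M t = t"
proof (rule extensionalityI[where A = "Ob C"])
  show "mkarr C M t A = t A" if "A \<in> Ob C" for A
    using assms that by (simp add: Modcat_Hom_iff mkarr_def extensional_restrict)
qed (use assms in \<open>simp_all add: Modcat_Hom_iff mkarr_def\<close>)

subsection \<open>Submodules\<close>

definition subfunctor :: "('o, 'a, 'x) pcat_scheme \<Rightarrow> ('o, 'a, 'm monoid, 'm \<Rightarrow> 'm) fctr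
    \<Rightarrow> ('o \<Rightarrow> 'm set) \<Rightarrow> bool" where
  "subfunctor C M T \<longleftrightarrow> (\<forall>A\<in>Ob C. subgroup (T A) (fob M A)) \<and>
     (\<forall>A\<in>Ob C. \<forall>B\<in>Ob C. \<forall>f\<in>Hom C A B. fmap M A B f ` T A \<subseteq> T B)"

definition subm :: "('o, 'a, 'm monoid, 'm \<Rightarrow> 'm) fctr \<Rightarrow> ('o \<Rightarrow> 'm set)
    \<Rightarrow> ('o, 'a, 'm monoid, 'm \<Rightarrow> 'm) fctr" where
  "subm M T = \<lparr>fob = (\<lambda>A. (fob M A)\<lparr>carrier := T A\<rparr>), fmap = (\<lambda>A B f. restrict (fmap M A B f) (T A))\<rparr>"

lemma fob_subm [simp]:
  "carrier (fob (subm M T) A) = T A" "mult (fob (subm M T) A) = mult (fob M A)"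
  "one (fob (subm M T) A) = one (fob M A)"
  by (simp_all add: subm_def)

lemma fmap_subm [simp]: "x \<in> T A \<Longrightarrow> fmap (subm M T) A B f x = fmap M A B f x"
  by (simp add: subm_def)

lemma subfunctor_subset: "subfunctor C M T \<Longrightarrow> A \<in> Ob C \<Longrightarrow> T A \<subseteq> carrier (fob M A)"
  unfolding subfunctor_def using subgroup.subset by blast

lemma subfunctor_carrier: "subfunctor C M T \<Longrightarrow> A \<in> Ob C \<Longrightarrow> x \<in> T A \<Longrightarrow> x \<in> carrier (fob M A)"
  using subfunctor_subset by fast

lemma subfunctor_map:
  "\<lbrakk>subfunctor C M T; A \<in> Ob C; B \<in> Ob C; f \<in> Hom C A B; x \<in> T A\<rbrakk> \<Longrightarrow> fmap M A B f x \<in> T B"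
  unfolding subfunctor_def by blast

lemma hom_subgroupI:
  assumes "subgroup S G" "h \<in> hom G H" "h ` S \<subseteq> T"
  shows "restrict h S \<in> hom (G\<lparr>carrier := S\<rparr>) (H\<lparr>carrier := T\<rparr>)"
  using assms subgroup.m_closed[OF assms(1)] subgroup.subset[OF assms(1)] by (auto simp: hom_def Pi_iff subset_iff)

context preadditive_category
begin

lemma subm_Ob:
  assumes M: "M \<in> Ob (Modcat C)" and T: "subfunctor C M T"
  shows "subm M T \<in> Ob (Modcat C)"
proof (rule Modcat_ObI)
  fix A
  assume A: "A \<in> Ob C"
  then interpret comm_group "fob M A"
    by (rule Modcat_group[OF M])
  have sub: "subgroup (T A) (fob M A)"
    using T A by (simp add: subfunctor_def)
  have "comm_group ((fob M A)\<lparr>carrier := T A\<rparr>)"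
    using subgroup.subset[OF sub]
    by (intro group.group_comm_groupI subgroup.subgroup_is_group[OF sub] is_group)
      (auto intro!: m_comm)
  then show "comm_group (fob (subm M T) A)"
    by (simp add: subm_def)
next
  fix A B f
  assume h: "A \<in> Ob C" "B \<in> Ob C" "f \<in> Hom C A B"
  have "restrict (fmap M A B f) (T A) \<in> hom ((fob M A)\<lparr>carrier := T A\<rparr>) ((fob M B)\<lparr>carrier := T B\<rparr>)"
    using T h by (intro hom_subgroupI Modcat_map_hom[OF M h]) (auto simp: subfunctor_def)
  then show "fmap (subm M T) A B f \<in> hom (fob (subm M T) A) (fob (subm M T) B) \<inter> extensional (carrier (fob (subm M T) A))"
    by (simp add: subm_def)
next
  fix A x
  assume "A \<in> Ob C" "x \<in> carrier (fob (subm M T) A)"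
  then show "fmap (subm M T) A A (idn C A) x = x"
    using Modcat_map_idn[OF M] subfunctor_carrier[OF T] by auto
next
  fix A B E f g x
  assume "A \<in> Ob C" "B \<in> Ob C" "E \<in> Ob C" "f \<in> Hom C A B" "g \<in> Hom C B E"
    "x \<in> carrier (fob (subm M T) A)"
  then show "fmap (subm M T) A E (cmp C A B E g f) x = fmap (subm M T) B E g (fmap (subm M T) A B f x)"
    using Modcat_map_cmp[OF M] subfunctor_carrier[OF T] subfunctor_map[OF T] by auto
next
  fix A B f g x
  assume "A \<in> Ob C" "B \<in> Ob C" "f \<in> Hom C A B" "g \<in> Hom C A B" "x \<in> carrier (fob (subm M T) A)"
  then show "fmap (subm M T) A B (hadd C A B f g) x =
      fmap (subm M T) A B f x \<otimes>\<^bsub>fob (subm M T) B\<^esub> fmap (subm M T) A B g x"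
    using Modcat_map_add[OF M] subfunctor_carrier[OF T] by auto
qed

lemma subm_incl:
  assumes "M \<in> Ob (Modcat C)" "subfunctor C M T"
  shows "mkarr C (subm M T) (\<lambda>A x. x) \<in> Hom (Modcat C) (subm M T) M"
  using assms
  by (intro mkarr_Hom subm_Ob) (auto simp: hom_def subfunctor_carrier)

text \<open>Arrows do not record their codomain, so the same \<open>t\<close> serves as an arrow
  into the submodule and no new function is introduced.\<close>

lemma subm_corestrict:
  assumes T: "subfunctor C N T" and t: "t \<in> Hom (Modcat C) M N"
    and sub: "\<And>A. A \<in> Ob C \<Longrightarrow> t A ` carrier (fob M A) \<subseteq> T A"
  shows "t \<in> Hom (Modcat C) M (subm N T)"
  using t sub unfolding Modcat_Hom_iff by (auto simp: hom_def Pi_iff image_subset_iff)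

lemma subfunctor_kernel:
  assumes M: "M \<in> Ob (Modcat C)" and N: "N \<in> Ob (Modcat C)" and t: "t \<in> Hom (Modcat C) M N"
  shows "subfunctor C M (\<lambda>A. kernel (fob M A) (fob N A) (t A))"
proof -
  have "fmap N A B f \<one>\<^bsub>fob N A\<^esub> = \<one>\<^bsub>fob N B\<^esub>" if "A \<in> Ob C" "B \<in> Ob C" "f \<in> Hom C A B" for A B f
    using N that by (intro hom_one[OF Modcat_map_hom] Modcat_is_group)
  then show ?thesis
    using group_hom.subgroup_kernel[OF Modcat_arr_group_hom[OF M N t]]
      Modcat_map_closed[OF M] Modcat_arr_nat[OF t]
    by (auto simp: subfunctor_def) (auto simp: kernel_def)
qed

lemma subfunctor_image:
  assumes M: "M \<in> Ob (Modcat C)" and N: "N \<in> Ob (Modcat C)" and t: "t \<in> Hom (Modcat C) M N"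
  shows "subfunctor C N (\<lambda>A. t A ` carrier (fob M A))"
  using group_hom.img_is_subgroup[OF Modcat_arr_group_hom[OF M N t]]
    Modcat_map_closed[OF M] Modcat_arr_nat[OF t, symmetric]
  by (auto simp: subfunctor_def)

end

lemma mon_subm:
  assumes "preadditive_category C" and M: "M \<in> Ob (Modcat C)" and T: "subfunctor C M T"
    and h: "A \<in> Ob C" "B \<in> Ob C" "u \<in> Hom C A B" and mon: "fmap M A B u \<in> mon (fob M A) (fob M B)"
  shows "fmap (subm M T) A B u \<in> mon (fob (subm M T) A) (fob (subm M T) B)"
proof -
  have "inj_on (fmap M A B u) (T A)"
    using mon subfunctor_subset[OF T h(1)] by (auto simp: mon_def intro: inj_on_subset)
  then have "inj_on (fmap (subm M T) A B u) (T A)"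
    by (simp add: inj_on_def)
  then show ?thesis
    using Modcat_map_hom[OF preadditive_category.subm_Ob[OF assms(1) M T] h] by (simp add: mon_def)
qed

section \<open>Kernel-cokernel pairs are pointwise short exact sequences\<close>

definition pointwise_exact where
  "pointwise_exact C K f M g N \<longleftrightarrow> (\<forall>A\<in>Ob C. inj_on (f A) (carrier (fob K A)) \<and>
     f A ` carrier (fob K A) = kernel (fob M A) (fob N A) (g A) \<and>
     g A ` carrier (fob M A) = carrier (fob N A))"

lemma is_kernel_factor:
  assumes "is_kernel C K f M g N" "X \<in> Ob C" "h \<in> Hom C X M" "cmp C X M N g h = hzero C X N"
  obtains k where "k \<in> Hom C X K" "cmp C X K M f k = h"
  using assms that unfolding is_kernel_def by metis

lemma is_kernel_unique:
  assumes "is_kernel C K f M g N" "X \<in> Ob C" "h \<in> Hom C X M" "cmp C X M N g h = hzero C X N"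
    and "k \<in> Hom C X K" "cmp C X K M f k = h" "k' \<in> Hom C X K" "cmp C X K M f k' = h"
  shows "k = k'"
  using assms unfolding is_kernel_def by metis

lemma is_cokernel_factor:
  assumes "is_cokernel C K f M g N" "X \<in> Ob C" "h \<in> Hom C M X" "cmp C K M X h f = hzero C K X"
  obtains k where "k \<in> Hom C N X" "cmp C M N X k g = h"
  using assms that unfolding is_cokernel_def by metis

lemma is_cokernel_unique:
  assumes "is_cokernel C K f M g N" "X \<in> Ob C" "h \<in> Hom C M X" "cmp C K M X h f = hzero C K X"
    and "k \<in> Hom C N X" "cmp C M N X k g = h" "k' \<in> Hom C N X" "cmp C M N X k' g = h"
  shows "k = k'"
  using assms unfolding is_cokernel_def by metis

text \<open>One treatment for prefragments and preglids: injectivity of the maps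
  \<open>\<one>\<close> passes to submodules. It may be lost in quotients, so every test object
  below is a submodule.\<close>

locale module_subcategory = preadditive_category C
  for C :: "('o, 'a, 'x) pcat_scheme" and U :: "('o, 'a, 'm monoid, 'm \<Rightarrow> 'm) fctr set" +
  assumes subm_closed:
    "\<lbrakk>M \<in> Ob (Modcat C); M \<in> U; subfunctor C M T\<rbrakk> \<Longrightarrow> subm M T \<in> U"
begin

abbreviation D :: "(('o, 'a, 'm monoid, 'm \<Rightarrow> 'm) fctr, 'o \<Rightarrow> 'm \<Rightarrow> 'm) pcat" where
  "D \<equiv> full_sub (Modcat C) U"

lemma D_simps:
  "M \<in> Ob D \<longleftrightarrow> M \<in> Ob (Modcat C) \<and> M \<in> U" "Hom D = Hom (Modcat C)"
  "idn D = idn (Modcat C)" "cmp D = cmp (Modcat C)" "hzero D = hzero (Modcat C)"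
  by (simp_all add: full_sub_def)

section \<open>From the universal properties to pointwise exactness, and back\<close>

context
  fixes K M N :: "('o, 'a, 'm monoid, 'm \<Rightarrow> 'm) fctr" and f g :: "'o \<Rightarrow> 'm \<Rightarrow> 'm"
  assumes K: "K \<in> Ob (Modcat C)" and M: "M \<in> Ob (Modcat C)" and N: "N \<in> Ob (Modcat C)"
    and f: "f \<in> Hom (Modcat C) K M" and g: "g \<in> Hom (Modcat C) M N"
begin

text \<open>The test object is the pointwise kernel of \<open>f\<close>. Its inclusion
  \<open>i\<close> and the trivial map \<open>z\<close> into \<open>K\<close> have the same
  composite with \<open>f\<close>, so uniqueness of factorizations gives \<open>i = z\<close> and
  this kernel is trivial.\<close>

lemma kernel_imp_inj:
  assumes "is_kernel D K f M g N" and "K \<in> U" and A: "A \<in> Ob C"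
  shows "inj_on (f A) (carrier (fob K A))"
proof -
  interpret Mod: category "Modcat C :: (('o, 'a, 'm monoid, 'm \<Rightarrow> 'm) fctr, 'o \<Rightarrow> 'm \<Rightarrow> 'm) pcat"
    by (rule Modcat_category)
  define T where "T = (\<lambda>A. kernel (fob K A) (fob M A) (f A))"
  have T: "subfunctor C K T"
    unfolding T_def by (rule subfunctor_kernel[OF K M f])
  define X where "X = subm K T"
  define i where "i = mkarr C X (\<lambda>A x. x)"
  define z where "z = mkarr C X (\<lambda>A x. \<one>\<^bsub>fob K A\<^esub>)"
  have X: "X \<in> Ob (Modcat C)" "X \<in> Ob D"
    using subm_Ob[OF K T] subm_closed[OF K assms(2) T] by (simp_all add: X_def D_simps)
  have i: "i \<in> Hom (Modcat C) X K"
    unfolding i_def X_def by (rule subm_incl[OF K T])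
  have K_one: "fmap K A B r \<one>\<^bsub>fob K A\<^esub> = \<one>\<^bsub>fob K B\<^esub>" if "A \<in> Ob C" "B \<in> Ob C" "r \<in> Hom C A B" for A B r
    using that K by (intro hom_one[OF Modcat_map_hom] Modcat_is_group)
  have z: "z \<in> Hom (Modcat C) X K"
    unfolding z_def
    using Modcat_is_group[OF K, THEN group.is_monoid]
    by (intro mkarr_Hom[OF X(1)]) (auto simp: hom_def K_one)
  define h where "h = cmp (Modcat C) X K M f i"
  have h: "h \<in> Hom (Modcat C) X M"
    unfolding h_def by (rule Mod.cmp_in[OF X(1) K M i f])
  have fx: "f A x = \<one>\<^bsub>fob M A\<^esub>" if "A \<in> Ob C" "x \<in> T A" for A x
    using that by (simp add: T_def kernel_def)
  have "cmp (Modcat C) X K M f z = h"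
    unfolding h_def Modcat_cmp using Modcat_arr_one[OF K M f]
    by (intro mkarr_cong) (simp add: z_def i_def X_def fx)
  moreover have "cmp (Modcat C) X M N g h = hzero (Modcat C) X N"
    unfolding h_def Modcat_cmp Modcat_hzero using Modcat_arr_one[OF M N g]
    by (intro mkarr_cong) (simp add: i_def X_def fx)
  ultimately have iz: "i = z"
    using X(2) h i z h_def is_kernel_unique[OF assms(1), of X h i z] by (simp add: D_simps)
  have "T A \<subseteq> {\<one>\<^bsub>fob K A\<^esub>}"
    using mkarr_eqD[OF iz[unfolded i_def z_def] A] by (auto simp: X_def)
  moreover have "\<one>\<^bsub>fob K A\<^esub> \<in> T A"
    using T A subgroup.one_closed by (auto simp: subfunctor_def)
  ultimately have "T A = {\<one>\<^bsub>fob K A\<^esub>}"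
    by blast
  then show ?thesis
    using group_hom.trivial_ker_imp_inj[OF Modcat_arr_group_hom[OF K M f A]] by (simp add: T_def)
qed

text \<open>One inclusion is the vanishing of the composite. For the other the test object is the
  pointwise kernel of \<open>g\<close>, whose inclusion into \<open>M\<close> must factor through
  \<open>f\<close>.\<close>

lemma kernel_imp_image:
  assumes "is_kernel D K f M g N" and "M \<in> U" and A: "A \<in> Ob C"
  shows "f A ` carrier (fob K A) = kernel (fob M A) (fob N A) (g A)"
proof
  have "cmp (Modcat C) K M N g f = hzero (Modcat C) K N"
    using assms(1) by (simp add: is_kernel_def D_simps)
  then show "f A ` carrier (fob K A) \<subseteq> kernel (fob M A) (fob N A) (g A)"
    unfolding Modcat_cmp Modcat_hzero
    using Modcat_arr_closed[OF f A] by (auto simp: kernel_def dest: mkarr_eqD[OF _ A])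
next
  define T where "T = (\<lambda>A. kernel (fob M A) (fob N A) (g A))"
  have T: "subfunctor C M T"
    unfolding T_def by (rule subfunctor_kernel[OF M N g])
  define X where "X = subm M T"
  define i where "i = mkarr C X (\<lambda>A x. x)"
  have X: "X \<in> Ob D"
    using subm_Ob[OF M T] subm_closed[OF M assms(2) T] by (simp add: X_def D_simps)
  have i: "i \<in> Hom (Modcat C) X M"
    unfolding i_def X_def by (rule subm_incl[OF M T])
  have "cmp (Modcat C) X M N g i = hzero (Modcat C) X N"
    unfolding Modcat_cmp Modcat_hzero by (intro mkarr_cong) (simp add: i_def X_def T_def kernel_def)
  then obtain k where k: "k \<in> Hom (Modcat C) X K" and eq: "cmp (Modcat C) X K M f k = i"
    by (rule is_kernel_factor[OF assms(1) X, unfolded D_simps, OF i])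
  show "kernel (fob M A) (fob N A) (g A) \<subseteq> f A ` carrier (fob K A)"
  proof
    fix x
    assume x: "x \<in> kernel (fob M A) (fob N A) (g A)"
    then have x': "x \<in> carrier (fob X A)"
      by (simp add: X_def T_def)
    then have "f A (k A x) = x"
      using mkarr_eqD[OF eq[unfolded Modcat_cmp i_def] A x'] by simp
    then show "x \<in> f A ` carrier (fob K A)"
      using Modcat_arr_closed[OF k A x'] by (metis imageI)
  qed
qed

text \<open>Testing the universal property against the image of \<open>g\<close> avoids forming quotients.\<close>

lemma cokernel_imp_surj:
  assumes "is_cokernel D K f M g N" and "N \<in> U" and A: "A \<in> Ob C"
  shows "g A ` carrier (fob M A) = carrier (fob N A)"
proof
  interpret Mod: category "Modcat C :: (('o, 'a, 'm monoid, 'm \<Rightarrow> 'm) fctr, 'o \<Rightarrow> 'm \<Rightarrow> 'm) pcat"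
    by (rule Modcat_category)
  show "g A ` carrier (fob M A) \<subseteq> carrier (fob N A)"
    using Modcat_arr_closed[OF g A] by blast
  define T where "T = (\<lambda>A. g A ` carrier (fob M A))"
  have T: "subfunctor C N T"
    unfolding T_def by (rule subfunctor_image[OF M N g])
  define X where "X = subm N T"
  define i where "i = mkarr C X (\<lambda>A x. x)"
  have X: "X \<in> Ob (Modcat C)" "X \<in> Ob D"
    using subm_Ob[OF N T] subm_closed[OF N assms(2) T] by (simp_all add: X_def D_simps)
  have i: "i \<in> Hom (Modcat C) X N"
    unfolding i_def X_def by (rule subm_incl[OF N T])
  have gX: "g \<in> Hom (Modcat C) M X"
    unfolding X_def using T g by (rule subm_corestrict) (simp add: T_def)
  have gf: "cmp (Modcat C) K M N g f = hzero (Modcat C) K N"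
    using assms(1) by (simp add: is_cokernel_def D_simps)
  then have "cmp (Modcat C) K M X g f = hzero (Modcat C) K X"
    unfolding Modcat_cmp Modcat_hzero by (simp add: X_def)
  then obtain k where k: "k \<in> Hom (Modcat C) N X" and eq: "cmp (Modcat C) M N X k g = g"
    by (rule is_cokernel_factor[OF assms(1) X(2), unfolded D_simps, OF gX])
  have kg: "k A (g A x) = g A x" if "A \<in> Ob C" "x \<in> carrier (fob M A)" for A x
    using eq[unfolded Modcat_cmp, THEN fun_cong, THEN fun_cong, of A x] that by simp
  \<comment> \<open>Both \<open>e\<close> and the identity of \<open>N\<close> restrict to
    \<open>g\<close> along \<open>g\<close>, so uniqueness makes them equal. Hence each element of
    \<open>N\<close> is its own value under \<open>k\<close>, which lies in the image of
    \<open>g\<close>.\<close>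
  define e where "e = cmp (Modcat C) N X N i k"
  have e: "e \<in> Hom (Modcat C) N N"
    unfolding e_def by (rule Mod.cmp_in[OF N X(1) N k i])
  have e_val: "e A y = k A y" if "A \<in> Ob C" "y \<in> carrier (fob N A)" for A y
    using that Modcat_arr_closed[OF k that] by (simp add: e_def Modcat_cmp i_def)
  have "cmp (Modcat C) M N N e g = mkarr C M g"
    unfolding Modcat_cmp using Modcat_arr_closed[OF g] by (intro mkarr_cong) (simp add: e_val kg)
  then have "cmp (Modcat C) M N N e g = g" "cmp (Modcat C) M N N (idn (Modcat C) N) g = g"
    using Mod.idn_left[OF M N g] Modcat_arr_eq_mkarr[OF g] by simp_all
  then have "e = idn (Modcat C) N"
    using assms(2) N g gf e Mod.idn_in[OF N] is_cokernel_unique[OF assms(1), of N g e "idn (Modcat C) N"]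
    by (simp add: D_simps)
  then have "k A y = y" if "y \<in> carrier (fob N A)" for y
    using e_val[OF A that] A that by (simp add: Modcat_idn)
  then show "carrier (fob N A) \<subseteq> g A ` carrier (fob M A)"
    using Modcat_arr_closed[OF k A] by (force simp: X_def T_def)
qed

section \<open>Universal properties of a pointwise short exact sequence\<close>

context
  assumes ex: "pointwise_exact C K f M g N"
begin

lemma exact_inj: "A \<in> Ob C \<Longrightarrow> inj_on (f A) (carrier (fob K A))"
  and exact_image: "A \<in> Ob C \<Longrightarrow> f A ` carrier (fob K A) = kernel (fob M A) (fob N A) (g A)"
  and exact_surj: "A \<in> Ob C \<Longrightarrow> g A ` carrier (fob M A) = carrier (fob N A)"
  using ex by (auto simp: pointwise_exact_def)

lemma exact_comp_zero: "cmp (Modcat C) K M N g f = hzero (Modcat C) K N"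
  unfolding Modcat_cmp Modcat_hzero using exact_image
  by (intro mkarr_cong) (auto simp: kernel_def)

text \<open>Each value of \<open>h\<close> has exactly one preimage under \<open>f\<close>.
  Injectivity of \<open>f\<close> also makes this pointwise preimage additive and natural: both
  claims hold after applying \<open>f\<close>.\<close>

lemma exact_imp_kernel: "is_kernel D K f M g N"
  unfolding is_kernel_def D_simps
proof (intro conjI ballI impI f g exact_comp_zero)
  fix X h
  assume "X \<in> Ob D" and h: "h \<in> Hom (Modcat C) X M"
    and gh: "cmp (Modcat C) X M N g h = hzero (Modcat C) X N"
  then have X: "X \<in> Ob (Modcat C)"
    by (simp add: D_simps)
  define s where "s = (\<lambda>A x. inv_into (carrier (fob K A)) (f A) (h A x))"
  have "h A x \<in> f A ` carrier (fob K A)" if "A \<in> Ob C" "x \<in> carrier (fob X A)" for A x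
    using mkarr_eqD[OF gh[unfolded Modcat_cmp Modcat_hzero] that] Modcat_arr_closed[OF h that]
      exact_image[OF that(1)] by (simp add: kernel_def)
  then have s: "s A x \<in> carrier (fob K A)" "f A (s A x) = h A x"
    if "A \<in> Ob C" "x \<in> carrier (fob X A)" for A x
    using that by (simp_all add: s_def inv_into_into f_inv_into_f)
  have hom: "s A \<in> hom (fob X A) (fob K A)" if A: "A \<in> Ob C" for A
  proof (rule homI)
    interpret X: group "fob X A" by (rule Modcat_is_group[OF X A])
    interpret K: group "fob K A" by (rule Modcat_is_group[OF K A])
    fix x y
    assume xy: "x \<in> carrier (fob X A)" "y \<in> carrier (fob X A)"
    show "s A (x \<otimes>\<^bsub>fob X A\<^esub> y) = s A x \<otimes>\<^bsub>fob K A\<^esub> s A y"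
      using xy s[OF A] hom_mult[OF Modcat_arr_hom[OF f A]] hom_mult[OF Modcat_arr_hom[OF h A]]
      by - (rule inj_onD[OF exact_inj[OF A]], simp_all)
  qed (use s A in blast)
  have nat: "s B (fmap X A B r x) = fmap K A B r (s A x)"
    if h': "A \<in> Ob C" "B \<in> Ob C" "r \<in> Hom C A B" and x: "x \<in> carrier (fob X A)" for A B r x
    using s[OF h'(1) x] s[OF h'(2) Modcat_map_closed[OF X h' x]]
      Modcat_map_closed[OF K h'] Modcat_arr_nat[OF f h'] Modcat_arr_nat[OF h h' x]
    by - (rule inj_onD[OF exact_inj[OF h'(2)]], simp_all)
  have "cmp (Modcat C) X K M f (mkarr C X s) = mkarr C X h"
    unfolding Modcat_cmp by (intro mkarr_cong) (simp add: s)
  then have "cmp (Modcat C) X K M f (mkarr C X s) = h"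
    using Modcat_arr_eq_mkarr[OF h] by simp
  moreover have "k = k'"
    if k: "k \<in> Hom (Modcat C) X K" and k': "k' \<in> Hom (Modcat C) X K"
      and eq: "cmp (Modcat C) X K M f k = cmp (Modcat C) X K M f k'" for k k'
  proof (rule Modcat_arr_eqI[OF k k'])
    fix A x
    assume A: "A \<in> Ob C" and x: "x \<in> carrier (fob X A)"
    show "k A x = k' A x"
      using mkarr_eqD[OF eq[unfolded Modcat_cmp] A x] Modcat_arr_closed[OF k A x] Modcat_arr_closed[OF k' A x]
      by (rule inj_onD[OF exact_inj[OF A]])
  qed
  ultimately show "\<exists>!k. k \<in> Hom (Modcat C) X K \<and> cmp (Modcat C) X K M f k = h"
    using mkarr_Hom[OF X hom nat] by (intro ex_ex1I) auto
qed

text \<open>The factorization applies \<open>h\<close> to a preimage chosen under \<open>g\<close>.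
  The section \<open>s\<close> itself is neither additive nor natural in general, but
  \<open>h\<close> is constant on the fibres of \<open>g\<close>, so \<open>h\<close> after
  \<open>s\<close> is both.\<close>

lemma exact_imp_cokernel: "is_cokernel D K f M g N"
  unfolding is_cokernel_def D_simps
proof (intro conjI ballI impI f g exact_comp_zero)
  fix X h
  assume "X \<in> Ob D" and h: "h \<in> Hom (Modcat C) M X"
    and hf: "cmp (Modcat C) K M X h f = hzero (Modcat C) K X"
  then have X: "X \<in> Ob (Modcat C)"
    by (simp add: D_simps)
  \<comment> \<open>Two points of one fibre of \<open>g\<close> differ by an element of the kernel
    of \<open>g\<close>, that is, of the image of \<open>f\<close>, where \<open>h\<close> is
    trivial.\<close>
  have key: "h A x = h A y"
    if A: "A \<in> Ob C" and xy: "x \<in> carrier (fob M A)" "y \<in> carrier (fob M A)" "g A x = g A y" for A x y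
  proof -
    interpret g: group_hom "fob M A" "fob N A" "g A" by (rule Modcat_arr_group_hom[OF M N g A])
    interpret h: group_hom "fob M A" "fob X A" "h A" by (rule Modcat_arr_group_hom[OF M X h A])
    let ?d = "x \<otimes>\<^bsub>fob M A\<^esub> inv\<^bsub>fob M A\<^esub> y"
    have "?d \<in> kernel (fob M A) (fob N A) (g A)"
      using xy by (simp add: kernel_def)
    then obtain z where z: "z \<in> carrier (fob K A)" "?d = f A z"
      using exact_image[OF A] by blast
    then have "h A ?d = \<one>\<^bsub>fob X A\<^esub>"
      using mkarr_eqD[OF hf[unfolded Modcat_cmp Modcat_hzero] A z(1)] by simp
    then show ?thesis
      using xy by (simp add: h.H.inv_equality h.H.inv_solve_right')
  qed
  define s where "s = (\<lambda>A y. inv_into (carrier (fob M A)) (g A) y)"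
  have s: "s A y \<in> carrier (fob M A)" "g A (s A y) = y"
    if "A \<in> Ob C" "y \<in> carrier (fob N A)" for A y
    using that exact_surj by (simp_all add: s_def inv_into_into f_inv_into_f)
  have sg: "h A (s A (g A x)) = h A x" if A: "A \<in> Ob C" and x: "x \<in> carrier (fob M A)" for A x
    using s[OF A Modcat_arr_closed[OF g A x]] x by (intro key[OF A]) simp_all
  have hom: "(\<lambda>y. h A (s A y)) \<in> hom (fob N A) (fob X A)" if A: "A \<in> Ob C" for A
  proof (rule homI)
    interpret M: group "fob M A" by (rule Modcat_is_group[OF M A])
    interpret N: group "fob N A" by (rule Modcat_is_group[OF N A])
    fix x y
    assume xy: "x \<in> carrier (fob N A)" "y \<in> carrier (fob N A)"
    have "h A (s A (x \<otimes>\<^bsub>fob N A\<^esub> y)) = h A (s A x \<otimes>\<^bsub>fob M A\<^esub> s A y)"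
      using xy s[OF A] hom_mult[OF Modcat_arr_hom[OF g A]] by (intro key[OF A]) simp_all
    then show "h A (s A (x \<otimes>\<^bsub>fob N A\<^esub> y)) = h A (s A x) \<otimes>\<^bsub>fob X A\<^esub> h A (s A y)"
      using xy s[OF A] hom_mult[OF Modcat_arr_hom[OF h A]] by simp
  qed (use s[OF A] Modcat_arr_closed[OF h A] in blast)
  have nat: "h B (s B (fmap N A B r y)) = fmap X A B r (h A (s A y))"
    if h': "A \<in> Ob C" "B \<in> Ob C" "r \<in> Hom C A B" and y: "y \<in> carrier (fob N A)" for A B r y
  proof -
    have "h B (s B (fmap N A B r y)) = h B (fmap M A B r (s A y))"
      using s[OF h'(1) y] s[OF h'(2) Modcat_map_closed[OF N h' y]]
        Modcat_map_closed[OF M h'] Modcat_arr_nat[OF g h'] by (intro key[OF h'(2)]) simp_all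
    then show ?thesis
      using Modcat_arr_nat[OF h h'] s[OF h'(1) y] by simp
  qed
  let ?k = "mkarr C N (\<lambda>A y. h A (s A y))"
  have "cmp (Modcat C) M N X ?k g = mkarr C M h"
    unfolding Modcat_cmp using Modcat_arr_closed[OF g] by (intro mkarr_cong) (simp add: sg)
  then have "cmp (Modcat C) M N X ?k g = h"
    using Modcat_arr_eq_mkarr[OF h] by simp
  moreover have "k = k'"
    if k: "k \<in> Hom (Modcat C) N X" and k': "k' \<in> Hom (Modcat C) N X"
      and eq: "cmp (Modcat C) M N X k g = cmp (Modcat C) M N X k' g" for k k'
  proof (rule Modcat_arr_eqI[OF k k'])
    fix A y
    assume A: "A \<in> Ob C" and y: "y \<in> carrier (fob N A)"
    show "k A y = k' A y"
      using mkarr_eqD[OF eq[unfolded Modcat_cmp] A s(1)[OF A y]] s(2)[OF A y] by simp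
  qed
  ultimately show "\<exists>!k. k \<in> Hom (Modcat C) N X \<and> cmp (Modcat C) M N X k g = h"
    using mkarr_Hom[OF N hom nat] by (intro ex_ex1I) auto
qed

end

end

theorem kernel_cokernel_pair_iff_exact:
  assumes "K \<in> Ob D" "M \<in> Ob D" "N \<in> Ob D" "f \<in> Hom D K M" "g \<in> Hom D M N"
  shows "kernel_cokernel_pair D K f M g N \<longleftrightarrow> pointwise_exact C K f M g N"
proof -
  note ob = assms(1-3)[unfolded D_simps, THEN conjunct1] assms(4,5)[unfolded D_simps]
  note U = assms(1-3)[unfolded D_simps, THEN conjunct2]
  show ?thesis
  proof
    assume "kernel_cokernel_pair D K f M g N"
    then have "is_kernel D K f M g N" "is_cokernel D K f M g N"
      by (simp_all add: kernel_cokernel_pair_def)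
    then show "pointwise_exact C K f M g N"
      unfolding pointwise_exact_def
      using kernel_imp_inj[OF ob] kernel_imp_image[OF ob] cokernel_imp_surj[OF ob] U by simp
  next
    assume "pointwise_exact C K f M g N"
    then show "kernel_cokernel_pair D K f M g N"
      using exact_imp_kernel[OF ob] exact_imp_cokernel[OF ob] assms(1-3)
      by (simp add: kernel_cokernel_pair_def)
  qed
qed

end

section \<open>Products\<close>

text \<open>The modules take values in groups on a fixed type \<open>'m\<close>; a bijection between \<open>'m\<close> and its
  square keeps products inside that universe.\<close>

locale pairing =
  fixes pair :: "'m \<Rightarrow> 'm \<Rightarrow> 'm" and p1 p2 :: "'m \<Rightarrow> 'm"
  assumes p1_pair [simp]: "p1 (pair x y) = x" and p2_pair [simp]: "p2 (pair x y) = y"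
    and pair_p [simp]: "pair (p1 z) (p2 z) = z"
begin

lemma pair_inj: "pair x y = pair x' y' \<longleftrightarrow> x = x' \<and> y = y'"
  by (metis p1_pair p2_pair)

definition prodg :: "'m monoid \<Rightarrow> 'm monoid \<Rightarrow> 'm monoid" where
  "prodg G H = \<lparr>carrier = {z. p1 z \<in> carrier G \<and> p2 z \<in> carrier H},
     mult = (\<lambda>z w. pair (p1 z \<otimes>\<^bsub>G\<^esub> p1 w) (p2 z \<otimes>\<^bsub>H\<^esub> p2 w)), one = pair \<one>\<^bsub>G\<^esub> \<one>\<^bsub>H\<^esub>\<rparr>"

lemma prodg_simps [simp]:
  "z \<in> carrier (prodg G H) \<longleftrightarrow> p1 z \<in> carrier G \<and> p2 z \<in> carrier H"
  "z \<otimes>\<^bsub>prodg G H\<^esub> w = pair (p1 z \<otimes>\<^bsub>G\<^esub> p1 w) (p2 z \<otimes>\<^bsub>H\<^esub> p2 w)"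
  "\<one>\<^bsub>prodg G H\<^esub> = pair \<one>\<^bsub>G\<^esub> \<one>\<^bsub>H\<^esub>"
  by (simp_all add: prodg_def)

lemma prodg_comm_group:
  assumes "comm_group G" "comm_group H"
  shows "comm_group (prodg G H)"
proof -
  interpret G: comm_group G by fact
  interpret H: comm_group H by fact
  show ?thesis
  proof (rule comm_groupI)
    show "\<exists>y\<in>carrier (prodg G H). y \<otimes>\<^bsub>prodg G H\<^esub> x = \<one>\<^bsub>prodg G H\<^esub>" if "x \<in> carrier (prodg G H)" for x
      using that by (intro bexI[of _ "pair (inv\<^bsub>G\<^esub> p1 x) (inv\<^bsub>H\<^esub> p2 x)"]) auto
  qed (simp_all add: G.m_ac H.m_ac)
qed

definition prodm :: "('o, 'a, 'm monoid, 'm \<Rightarrow> 'm) fctr \<Rightarrow> ('o, 'a, 'm monoid, 'm \<Rightarrow> 'm) fctr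
    \<Rightarrow> ('o, 'a, 'm monoid, 'm \<Rightarrow> 'm) fctr" where
  "prodm M N = \<lparr>fob = (\<lambda>A. prodg (fob M A) (fob N A)),
     fmap = (\<lambda>A B f. \<lambda>z\<in>carrier (prodg (fob M A) (fob N A)).
       pair (fmap M A B f (p1 z)) (fmap N A B f (p2 z)))\<rparr>"

lemma fob_prodm [simp]: "fob (prodm M N) A = prodg (fob M A) (fob N A)"
  by (simp add: prodm_def)

lemma fmap_prodm [simp]:
  "p1 z \<in> carrier (fob M A) \<Longrightarrow> p2 z \<in> carrier (fob N A) \<Longrightarrow>
    fmap (prodm M N) A B f z = pair (fmap M A B f (p1 z)) (fmap N A B f (p2 z))"
  by (simp add: prodm_def)

lemma prodm_Ob:
  assumes "preadditive_category C" and M: "M \<in> Ob (Modcat C)" and N: "N \<in> Ob (Modcat C)"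
  shows "prodm M N \<in> Ob (Modcat C)"
proof (rule preadditive_category.Modcat_ObI[OF assms(1)])
  show "comm_group (fob (prodm M N) A)" if "A \<in> Ob C" for A
    using that M N by (simp add: prodg_comm_group Modcat_group)
  show "fmap (prodm M N) A B f \<in> hom (fob (prodm M N) A) (fob (prodm M N) B) \<inter>
      extensional (carrier (fob (prodm M N) A))"
    if h: "A \<in> Ob C" "B \<in> Ob C" "f \<in> Hom C A B" for A B f
    using Modcat_map_closed[OF M h] Modcat_map_closed[OF N h]
      hom_mult[OF Modcat_map_hom[OF M h]] hom_mult[OF Modcat_map_hom[OF N h]]
      comm_groupE(1)[OF Modcat_group[OF M h(1)]] comm_groupE(1)[OF Modcat_group[OF N h(1)]]
    by (auto intro!: homI) (simp add: prodm_def)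
qed (use M N in \<open>simp_all add: Modcat_map_idn Modcat_map_cmp Modcat_map_add Modcat_map_closed\<close>)

end

text \<open>Cardinal arithmetic: an infinite set is in bijection with its square. The size of the
  universe enters only here.\<close>

lemma infinite_pairing:
  assumes "infinite (UNIV :: 'm set)"
  obtains pair :: "'m \<Rightarrow> 'm \<Rightarrow> 'm" and p1 p2 where "pairing pair p1 p2"
proof -
  obtain e :: "'m \<times> 'm \<Rightarrow> 'm" where e: "bij e"
    using card_of_Times_same_infinite[OF assms]
    unfolding card_of_ordIso[symmetric] by auto
  have "pairing (\<lambda>x y. e (x, y)) (\<lambda>z. fst (inv_into UNIV e z)) (\<lambda>z. snd (inv_into UNIV e z))"
    using e by unfold_locales (simp_all add: bij_is_inj bij_is_surj surj_f_inv_f)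
  then show thesis
    by (rule that)
qed

lemma (in pairing) mon_prodm:
  assumes "preadditive_category C" and M: "M \<in> Ob (Modcat C)" and N: "N \<in> Ob (Modcat C)"
    and h: "A \<in> Ob C" "B \<in> Ob C" "u \<in> Hom C A B"
    and mon: "fmap M A B u \<in> mon (fob M A) (fob M B)" "fmap N A B u \<in> mon (fob N A) (fob N B)"
  shows "fmap (prodm M N) A B u \<in> mon (fob (prodm M N) A) (fob (prodm M N) B)"
proof -
  have "inj_on (fmap (prodm M N) A B u) (carrier (fob (prodm M N) A))"
  proof (rule inj_onI)
    fix z w
    assume zw: "z \<in> carrier (fob (prodm M N) A)" "w \<in> carrier (fob (prodm M N) A)"
      and eq: "fmap (prodm M N) A B u z = fmap (prodm M N) A B u w"
    have "fmap M A B u (p1 z) = fmap M A B u (p1 w)" "fmap N A B u (p2 z) = fmap N A B u (p2 w)"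
      using zw eq by (simp_all add: pair_inj)
    then have "p1 z = p1 w" "p2 z = p2 w"
      using mon zw unfolding mon_def by (simp_all add: inj_on_def)
    then show "z = w"
      using pair_p by metis
  qed
  then show ?thesis
    using Modcat_map_hom[OF prodm_Ob[OF assms(1) M N] h] by (simp add: mon_def)
qed

section \<open>Isomorphisms\<close>

lemma Modcat_iso_imp_bij:
  assumes "is_iso_arr (Modcat C) M N t" and A: "A \<in> Ob C"
  shows "bij_betw (t A) (carrier (fob M A)) (carrier (fob N A))"
proof -
  obtain s where t: "t \<in> Hom (Modcat C) M N" and s: "s \<in> Hom (Modcat C) N M"
    and st: "cmp (Modcat C) M N M s t = idn (Modcat C) M"
    and ts: "cmp (Modcat C) N M N t s = idn (Modcat C) N"
    using assms(1) unfolding is_iso_arr_def is_iso_pair_def by blast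
  show ?thesis
    using Modcat_arr_closed[OF t A] Modcat_arr_closed[OF s A]
      mkarr_eqD[OF st[unfolded Modcat_cmp Modcat_idn] A] mkarr_eqD[OF ts[unfolded Modcat_cmp Modcat_idn] A]
    by (intro bij_betw_byWitness[where f' = "s A"]) auto
qed

text \<open>The pointwise inverse inherits additivity and naturality from \<open>t\<close>: apply
  \<open>t\<close> to the expected value, then cancel with \<open>ht\<close>.\<close>

lemma Modcat_bij_imp_iso:
  assumes M: "M \<in> Ob (Modcat C)" and N: "N \<in> Ob (Modcat C)" and t: "t \<in> Hom (Modcat C) M N"
    and bij: "\<And>A. A \<in> Ob C \<Longrightarrow> bij_betw (t A) (carrier (fob M A)) (carrier (fob N A))"
  shows "is_iso_arr (Modcat C) M N t"
proof -
  define h where "h = (\<lambda>A. inv_into (carrier (fob M A)) (t A))"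
  have h: "h A y \<in> carrier (fob M A)" "t A (h A y) = y" if "A \<in> Ob C" "y \<in> carrier (fob N A)" for A y
    using that bij by (auto simp: h_def bij_betw_def inv_into_into f_inv_into_f)
  have ht: "h A (t A x) = x" if "A \<in> Ob C" "x \<in> carrier (fob M A)" for A x
    using that bij by (auto simp: h_def bij_betw_def)
  have s: "mkarr C N h \<in> Hom (Modcat C) N M"
  proof (rule mkarr_Hom[OF N])
    fix A
    assume A: "A \<in> Ob C"
    show "h A \<in> hom (fob N A) (fob M A)"
    proof (rule homI)
      fix x y
      assume xy: "x \<in> carrier (fob N A)" "y \<in> carrier (fob N A)"
      have "h A x \<otimes>\<^bsub>fob M A\<^esub> h A y \<in> carrier (fob M A)"
        using h[OF A] xy comm_groupE(1)[OF Modcat_group[OF M A]] by blast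
      then show "h A (x \<otimes>\<^bsub>fob N A\<^esub> y) = h A x \<otimes>\<^bsub>fob M A\<^esub> h A y"
        using ht[OF A, of "h A x \<otimes>\<^bsub>fob M A\<^esub> h A y"] h[OF A] xy hom_mult[OF Modcat_arr_hom[OF t A]] by simp
    qed (use h A in blast)
  next
    fix A B f x
    assume a: "A \<in> Ob C" "B \<in> Ob C" "f \<in> Hom C A B" and x: "x \<in> carrier (fob N A)"
    show "h B (fmap N A B f x) = fmap M A B f (h A x)"
      using ht[OF a(2) Modcat_map_closed[OF M a h(1)[OF a(1) x]]]
        Modcat_arr_nat[OF t a h(1)[OF a(1) x]] h(2)[OF a(1) x] by simp
  qed
  have "cmp (Modcat C) M N M (mkarr C N h) t = idn (Modcat C) M"
    unfolding Modcat_cmp Modcat_idn using Modcat_arr_closed[OF t] by (intro mkarr_cong) (simp add: ht)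
  moreover have "cmp (Modcat C) N M N t (mkarr C N h) = idn (Modcat C) N"
    unfolding Modcat_cmp Modcat_idn by (intro mkarr_cong) (simp add: h)
  ultimately show ?thesis
    using s t unfolding is_iso_arr_def is_iso_pair_def by blast
qed

lemma (in category) iso_arr_cancel:
  assumes "A \<in> Ob C" "B \<in> Ob C" "E \<in> Ob C" "is_iso_arr C A B s" "x \<in> Hom C B E" "y \<in> Hom C B E"
    and eq: "cmp C A B E x s = cmp C A B E y s"
  shows "x = y"
proof -
  obtain r where r: "s \<in> Hom C A B" "r \<in> Hom C B A" "cmp C B A B s r = idn C B"
    using assms(4) unfolding is_iso_arr_def is_iso_pair_def by blast
  have "cmp C B B E x (cmp C B A B s r) = cmp C B B E y (cmp C B A B s r)"
    using assms r(1,2) by (simp add: cmp_assoc[of B A B E])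
  then show ?thesis
    using assms r(3) by (simp add: idn_right)
qed

lemma functor_iso_arr:
  assumes "is_functor C E G" "A \<in> Ob C" "B \<in> Ob C" "is_iso_arr C A B f"
  shows "is_iso_arr E (fob G A) (fob G B) (fmap G A B f)"
proof -
  obtain g where g: "f \<in> Hom C A B" "g \<in> Hom C B A" "cmp C A B A g f = idn C A" "cmp C B A B f g = idn C B"
    using assms(4) unfolding is_iso_arr_def is_iso_pair_def by blast
  have cmp: "fmap G X Z (cmp C X Y Z k h) = cmp E (fob G X) (fob G Y) (fob G Z) (fmap G Y Z k) (fmap G X Y h)"
    if "X \<in> Ob C" "Y \<in> Ob C" "Z \<in> Ob C" "h \<in> Hom C X Y" "k \<in> Hom C Y Z" for X Y Z h k
    using assms(1) that unfolding is_functor_def by blast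
  have "is_iso_pair E (fob G A) (fob G B) (fmap G A B f) (fmap G B A g)"
    unfolding is_iso_pair_def
    using assms(1-3) g cmp[of A B A f g] cmp[of B A B g f] by (simp add: is_functor_def)
  then show ?thesis
    unfolding is_iso_arr_def by blast
qed

text \<open>A chase through the bijections: \<open>a\<close> and \<open>b\<close> match the image of
  \<open>f\<close> with that of \<open>f'\<close>, while \<open>c\<close>, an injective
  homomorphism, detects the unit and so matches the kernel of \<open>g\<close> with that of
  \<open>g'\<close>.\<close>

lemma pointwise_exact_transfer:
  assumes hom: "\<And>A. A \<in> Ob C \<Longrightarrow> group_hom (fob N A) (fob N' A) (c A)"
    and f: "\<And>A x. A \<in> Ob C \<Longrightarrow> x \<in> carrier (fob K A) \<Longrightarrow> f A x \<in> carrier (fob M A)"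
    and g: "\<And>A x. A \<in> Ob C \<Longrightarrow> x \<in> carrier (fob M A) \<Longrightarrow> g A x \<in> carrier (fob N A)"
    and a: "\<And>A. A \<in> Ob C \<Longrightarrow> bij_betw (a A) (carrier (fob K A)) (carrier (fob K' A))"
    and b: "\<And>A. A \<in> Ob C \<Longrightarrow> bij_betw (b A) (carrier (fob M A)) (carrier (fob M' A))"
    and c: "\<And>A. A \<in> Ob C \<Longrightarrow> bij_betw (c A) (carrier (fob N A)) (carrier (fob N' A))"
    and bf: "\<And>A x. A \<in> Ob C \<Longrightarrow> x \<in> carrier (fob K A) \<Longrightarrow> b A (f A x) = f' A (a A x)"
    and cg: "\<And>A x. A \<in> Ob C \<Longrightarrow> x \<in> carrier (fob M A) \<Longrightarrow> c A (g A x) = g' A (b A x)"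
    and ex: "pointwise_exact C K' f' M' g' N'"
  shows "pointwise_exact C K f M g N"
  unfolding pointwise_exact_def
proof (intro ballI conjI)
  fix A
  assume A: "A \<in> Ob C"
  interpret c: group_hom "fob N A" "fob N' A" "c A" by (rule hom[OF A])
  note bij = a[OF A, unfolded bij_betw_def] b[OF A, unfolded bij_betw_def] c[OF A, unfolded bij_betw_def]
  note a_in = bij(1)[THEN conjunct2, symmetric] and b_im = bij(2)[THEN conjunct2, symmetric]
    and c_im = bij(3)[THEN conjunct2, symmetric]
  have ex': "inj_on (f' A) (carrier (fob K' A))"
    "f' A ` carrier (fob K' A) = kernel (fob M' A) (fob N' A) (g' A)"
    "g' A ` carrier (fob M' A) = carrier (fob N' A)"
    using ex A by (auto simp: pointwise_exact_def)
  have "inj_on (\<lambda>x. f' A (a A x)) (carrier (fob K A))"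
    using ex'(1) bij(1) comp_inj_on[of "a A" _ "f' A"] by (simp add: comp_def)
  then show "inj_on (f A) (carrier (fob K A))"
    using bf[OF A] unfolding inj_on_def by metis
  have c_one: "c A y = \<one>\<^bsub>fob N' A\<^esub> \<longleftrightarrow> y = \<one>\<^bsub>fob N A\<^esub>" if "y \<in> carrier (fob N A)" for y
    using bij(3) that c.hom_one c.G.one_closed unfolding inj_on_def by metis
  have "x \<in> f A ` carrier (fob K A) \<longleftrightarrow> g A x = \<one>\<^bsub>fob N A\<^esub>" if x: "x \<in> carrier (fob M A)" for x
  proof -
    have bx: "b A x \<in> carrier (fob M' A)"
      using x b_im by blast
    have "x \<in> f A ` carrier (fob K A) \<longleftrightarrow> (\<exists>k\<in>carrier (fob K A). b A x = b A (f A k))"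
      using x f[OF A] bij(2) unfolding inj_on_def by blast
    also have "\<dots> \<longleftrightarrow> b A x \<in> f' A ` carrier (fob K' A)"
      using bf[OF A] a_in by auto
    also have "\<dots> \<longleftrightarrow> c A (g A x) = \<one>\<^bsub>fob N' A\<^esub>"
      using bx cg[OF A x] unfolding ex'(2) by (simp add: kernel_def)
    finally show ?thesis
      using c_one[OF g[OF A x]] by simp
  qed
  then show "f A ` carrier (fob K A) = kernel (fob M A) (fob N A) (g A)"
    using f[OF A] unfolding kernel_def by blast
  show "g A ` carrier (fob M A) = carrier (fob N A)"
  proof
    show "carrier (fob N A) \<subseteq> g A ` carrier (fob M A)"
    proof
      fix y
      assume y: "y \<in> carrier (fob N A)"
      then have "c A y \<in> g' A ` b A ` carrier (fob M A)"
        unfolding b_im[symmetric] ex'(3) by (rule c.hom_closed)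
      then obtain x where x: "x \<in> carrier (fob M A)" "c A y = g' A (b A x)"
        by blast
      then have "c A y = c A (g A x)"
        by (simp add: cg[OF A])
      with x(1) show "y \<in> g A ` carrier (fob M A)"
        using y g[OF A] bij(3) unfolding inj_on_def by blast
    qed
  qed (use g[OF A] in blast)
qed

section \<open>Glid arrows are natural transformations of restrictions\<close>

lemma Fbar_simps:
  "Ob (Fbar \<Gamma> R F \<Lambda>) = ext_set \<Lambda>" "Hom (Fbar \<Gamma> R F \<Lambda>) = Fbar_hom \<Gamma> R F \<Lambda>"
  "cmp (Fbar \<Gamma> R F \<Lambda>) \<alpha> \<beta> \<gamma> s r = s \<otimes>\<^bsub>R\<^esub> r" "hzero (Fbar \<Gamma> R F \<Lambda>) \<alpha> \<beta> = \<zero>\<^bsub>R\<^esub>"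
  by (simp_all add: Fbar_def)

lemma ext_set_simps [simp]: "Fin \<alpha> \<in> ext_set \<Lambda> \<longleftrightarrow> \<alpha> \<in> \<Lambda>" "Infty \<in> ext_set \<Lambda>"
  by (auto simp: ext_set_def)

text \<open>About \<open>\<phi>\<close> only functoriality and its composite with the localization
  functor are assumed. Its fullness and faithfulness are derived below. The pairing is auxiliary
  data for building graph modules.\<close>

locale glids = filtered_ring \<Gamma> R F + pairing pair p1 p2
  for \<Gamma> :: "('g, 'x) ogroup_scheme" and R :: "('r, 'y) ring_scheme" and F :: "'g \<Rightarrow> 'r set"
    and pair :: "'m \<Rightarrow> 'm \<Rightarrow> 'm" and p1 p2 :: "'m \<Rightarrow> 'm" +
  fixes \<Lambda> :: "'g set"
    and \<phi> :: "(('g, 'r, 'm) preglid, ('g, 'r, 'm) glid_arr,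
              ('g, 'r, 'm) prefrag, ('g, 'm) prefrag_arr) fctr"
  assumes \<Lambda>_subset: "\<Lambda> \<subseteq> carrier \<Gamma>"
    and embedding: "is_glid_embedding \<Gamma> R F \<Lambda> \<phi>"
begin

abbreviation "Fc \<equiv> Fcat \<Gamma> R F \<Lambda>"
abbreviation "Fb \<equiv> Fbar \<Gamma> R F \<Lambda>"
abbreviation PF :: "(('g, 'r, 'm) prefrag, ('g, 'm) prefrag_arr) pcat" where
  "PF \<equiv> Prefrag \<Gamma> R F \<Lambda>"
abbreviation PG :: "(('g, 'r, 'm) preglid, ('g, 'm) preglid_arr) pcat" where
  "PG \<equiv> Preglid \<Gamma> R F \<Lambda>"
abbreviation Sig :: "('g, 'r, 'm) preglid \<Rightarrow> ('g, 'r, 'm) preglid \<Rightarrow> ('g, 'm) preglid_arr set" where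
  "Sig \<equiv> Sigma_glid \<Gamma> R F \<Lambda>"
abbreviation GL :: "(('g, 'r, 'm) preglid, ('g, 'r, 'm) glid_arr) cat" where
  "GL \<equiv> Glid \<Gamma> R F \<Lambda>"
abbreviation rs :: "('g, 'r, 'm) preglid \<Rightarrow> ('g, 'r, 'm) prefrag" where
  "rs \<equiv> fob (Res \<Lambda>)"
abbreviation q :: "('g, 'r, 'm) preglid \<Rightarrow> ('g, 'r, 'm) preglid \<Rightarrow> ('g, 'm) preglid_arr
    \<Rightarrow> ('g, 'r, 'm) glid_arr" where
  "q \<equiv> fmap (Q_glid \<Gamma> R F \<Lambda>)"

lemma one_in_Fbar_hom:
  assumes "\<alpha> \<in> ext_set \<Lambda>" "\<beta> \<in> ext_set \<Lambda>" "ext_le \<Gamma> \<alpha> \<beta>"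
  shows "\<one>\<^bsub>R\<^esub> \<in> Hom Fb \<alpha> \<beta>"
  using assms one_in_Fcat_hom \<Lambda>_subset
  by (cases \<alpha>; cases \<beta>) (auto simp: Fbar_simps subset_iff)

sublocale fin: module_subcategory Fc
  "{M :: ('g, 'r, 'm) prefrag. \<forall>\<alpha>\<in>\<Lambda>. \<forall>\<beta>\<in>\<Lambda>. \<alpha> \<preceq>\<^bsub>\<Gamma>\<^esub> \<beta> \<longrightarrow> fmap M \<alpha> \<beta> \<one>\<^bsub>R\<^esub> \<in> mon (fob M \<alpha>) (fob M \<beta>)}"
proof (intro module_subcategory.intro module_subcategory_axioms.intro CollectI ballI impI)
  show C: "preadditive_category Fc"
    by (rule Fcat_preadditive[OF \<Lambda>_subset])
  fix M :: "('g, 'r, 'm) prefrag" and T \<alpha> \<beta>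
  assume "M \<in> Ob (Modcat Fc)" "subfunctor Fc M T" "\<alpha> \<in> \<Lambda>" "\<beta> \<in> \<Lambda>" "\<alpha> \<preceq>\<^bsub>\<Gamma>\<^esub> \<beta>"
    and "M \<in> {M. \<forall>\<alpha>\<in>\<Lambda>. \<forall>\<beta>\<in>\<Lambda>. \<alpha> \<preceq>\<^bsub>\<Gamma>\<^esub> \<beta> \<longrightarrow> fmap M \<alpha> \<beta> \<one>\<^bsub>R\<^esub> \<in> mon (fob M \<alpha>) (fob M \<beta>)}"
  then show "fmap (subm M T) \<alpha> \<beta> \<one>\<^bsub>R\<^esub> \<in> mon (fob (subm M T) \<alpha>) (fob (subm M T) \<beta>)"
    using \<Lambda>_subset by (intro mon_subm[OF C] one_in_Fcat_hom) (auto simp: Ob_Fcat)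
qed

sublocale bar: module_subcategory Fb
  "{M :: ('g, 'r, 'm) preglid. \<forall>\<alpha>\<in>ext_set \<Lambda>. \<forall>\<beta>\<in>ext_set \<Lambda>.
      ext_le \<Gamma> \<alpha> \<beta> \<longrightarrow> fmap M \<alpha> \<beta> \<one>\<^bsub>R\<^esub> \<in> mon (fob M \<alpha>) (fob M \<beta>)}"
proof (intro module_subcategory.intro module_subcategory_axioms.intro CollectI ballI impI)
  show C: "preadditive_category Fb"
    by (rule Fbar_preadditive[OF \<Lambda>_subset])
  fix M :: "('g, 'r, 'm) preglid" and T \<alpha> \<beta>
  assume "M \<in> Ob (Modcat Fb)" "subfunctor Fb M T" "\<alpha> \<in> ext_set \<Lambda>" "\<beta> \<in> ext_set \<Lambda>" "ext_le \<Gamma> \<alpha> \<beta>"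
    and "M \<in> {M. \<forall>\<alpha>\<in>ext_set \<Lambda>. \<forall>\<beta>\<in>ext_set \<Lambda>.
      ext_le \<Gamma> \<alpha> \<beta> \<longrightarrow> fmap M \<alpha> \<beta> \<one>\<^bsub>R\<^esub> \<in> mon (fob M \<alpha>) (fob M \<beta>)}"
  then show "fmap (subm M T) \<alpha> \<beta> \<one>\<^bsub>R\<^esub> \<in> mon (fob (subm M T) \<alpha>) (fob (subm M T) \<beta>)"
    by (intro mon_subm[OF C] one_in_Fbar_hom) (auto simp: Fbar_simps)
qed

lemmas conflation_Prefrag_iff = fin.kernel_cokernel_pair_iff_exact[folded Prefrag_def]
lemmas conflation_Preglid_iff = bar.kernel_cokernel_pair_iff_exact[folded Preglid_def]

lemma Preglid_Modcat: "M \<in> Ob PG \<Longrightarrow> M \<in> Ob (Modcat Fb)"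
  by (simp add: Ob_Preglid)

lemma Prefrag_Modcat: "M \<in> Ob PF \<Longrightarrow> M \<in> Ob (Modcat Fc)"
  by (simp add: Ob_Prefrag)

lemma subm_Preglid:
  assumes "M \<in> Ob PG" "subfunctor Fb M T"
  shows "subm M T \<in> Ob PG"
  using bar.subm_Ob bar.subm_closed assms unfolding Ob_Preglid by blast

lemma prodm_Preglid:
  assumes "M \<in> Ob PG" "N \<in> Ob PG"
  shows "prodm M N \<in> Ob PG"
  unfolding Ob_Preglid
proof (intro conjI ballI impI)
  show "prodm M N \<in> Ob (Modcat Fb)"
    using assms by (intro prodm_Ob Fbar_preadditive \<Lambda>_subset Preglid_Modcat)
  show "fmap (prodm M N) \<alpha> \<beta> \<one>\<^bsub>R\<^esub> \<in> mon (fob (prodm M N) \<alpha>) (fob (prodm M N) \<beta>)"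
    if "\<alpha> \<in> ext_set \<Lambda>" "\<beta> \<in> ext_set \<Lambda>" "ext_le \<Gamma> \<alpha> \<beta>" for \<alpha> \<beta>
    using assms that one_in_Fbar_hom[OF that]
    by (intro mon_prodm[where C = Fb] Fbar_preadditive \<Lambda>_subset Preglid_Modcat)
      (auto simp: Ob_Preglid Fbar_simps)
qed

subsection \<open>The graph of a natural transformation of restrictions\<close>

text \<open>A natural transformation \<open>t\<close> need not extend to a map \<open>M(\<infinity>) \<rightarrow> N(\<infinity>)\<close>, since the
  values at finite objects may not generate \<open>M(\<infinity>)\<close> and relations in \<open>M(\<infinity>)\<close> may fail in
  \<open>N(\<infinity>)\<close>. Closing its graph under \<open>R\<close> inside \<open>M \<times> N\<close> gives a preglid whose
  first projection lies in \<open>\<Sigma>\<close>.\<close>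

fun graph_sub :: "('g, 'm) prefrag_arr \<Rightarrow> ('g, 'r, 'm) preglid \<Rightarrow> ('g, 'r, 'm) preglid \<Rightarrow> 'g ext \<Rightarrow> 'm set" where
  "graph_sub t M N (Fin \<alpha>) = (\<lambda>x. pair x (t \<alpha> x)) ` carrier (fob M (Fin \<alpha>))"
| "graph_sub t M N Infty = generate (fob (prodm M N) Infty)
     (\<Union>\<alpha>\<in>\<Lambda>. \<Union>r\<in>carrier R. fmap (prodm M N) (Fin \<alpha>) Infty r ` (\<lambda>x. pair x (t \<alpha> x)) ` carrier (fob M (Fin \<alpha>)))"

definition graph :: "('g, 'm) prefrag_arr \<Rightarrow> ('g, 'r, 'm) preglid \<Rightarrow> ('g, 'r, 'm) preglid \<Rightarrow> ('g, 'r, 'm) preglid" where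
  "graph t M N = subm (prodm M N) (graph_sub t M N)"

definition pr1 where "pr1 t M N = mkarr Fb (graph t M N) (\<lambda>_. p1)"
definition pr2 where "pr2 t M N = mkarr Fb (graph t M N) (\<lambda>_. p2)"

context
  fixes M N :: "('g, 'r, 'm) preglid" and t :: "('g, 'm) prefrag_arr"
  assumes M: "M \<in> Ob PG" and N: "N \<in> Ob PG" and t: "t \<in> Hom PF (rs M) (rs N)"
begin

lemma Prefrag_arr_Modcat: "t \<in> Hom (Modcat Fc) (rs M) (rs N)"
  using t by (simp add: Prefrag_simps)

lemma Prefrag_arr_closed: "\<alpha> \<in> \<Lambda> \<Longrightarrow> x \<in> carrier (fob M (Fin \<alpha>)) \<Longrightarrow> t \<alpha> x \<in> carrier (fob N (Fin \<alpha>))"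
  using Modcat_arr_closed[OF Prefrag_arr_Modcat] by (simp add: Ob_Fcat Res_simps)

lemma prodm_Modcat: "prodm M N \<in> Ob (Modcat Fb)"
  using prodm_Preglid[OF M N] by (rule Preglid_Modcat)

lemma graph_map_hom: "\<alpha> \<in> \<Lambda> \<Longrightarrow> (\<lambda>x. pair x (t \<alpha> x)) \<in> hom (fob M (Fin \<alpha>)) (fob (prodm M N) (Fin \<alpha>))"
  using Prefrag_arr_closed Modcat_arr_hom[OF Prefrag_arr_Modcat, of \<alpha>]
  by (auto intro!: homI simp: Ob_Fcat Res_simps hom_mult)

lemma graph_map_closed: "\<alpha> \<in> \<Lambda> \<Longrightarrow> x \<in> carrier (fob M (Fin \<alpha>)) \<Longrightarrow> pair x (t \<alpha> x) \<in> carrier (fob (prodm M N) (Fin \<alpha>))"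
  using Prefrag_arr_closed by simp

lemma graph_map_nat:
  assumes "\<alpha> \<in> \<Lambda>" "\<beta> \<in> \<Lambda>" "r \<in> Hom Fc \<alpha> \<beta>" "x \<in> carrier (fob M (Fin \<alpha>))"
  shows "fmap (prodm M N) (Fin \<alpha>) (Fin \<beta>) r (pair x (t \<alpha> x)) =
    pair (fmap M (Fin \<alpha>) (Fin \<beta>) r x) (t \<beta> (fmap M (Fin \<alpha>) (Fin \<beta>) r x))"
  using Modcat_arr_nat[OF Prefrag_arr_Modcat, of \<alpha> \<beta> r x] assms Prefrag_arr_closed by (simp add: Ob_Fcat Res_simps)

text \<open>Stability has four cases. Between finite objects it is naturality of \<open>t\<close>;
  from \<open>Infty\<close> to a finite object only the zero arrow exists; from a finite object to
  \<open>Infty\<close> the result is a generator; at \<open>Infty\<close> the generators absorb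
  scalars, r(sz) = (rs)z, so a homomorphism given by a scalar maps their span into itself.\<close>

lemma graph_subfunctor: "subfunctor Fb (prodm M N) (graph_sub t M N)"
proof -
  note P = prodm_Modcat
  let ?P = "prodm M N"
  let ?S = "\<Union>\<alpha>\<in>\<Lambda>. \<Union>r\<in>carrier R. fmap ?P (Fin \<alpha>) Infty r ` (\<lambda>x. pair x (t \<alpha> x)) ` carrier (fob M (Fin \<alpha>))"
  interpret Pi: group "fob ?P Infty"
    by (rule Modcat_is_group[OF P]) (simp add: Fbar_simps)
  have S: "?S \<subseteq> carrier (fob ?P Infty)"
    using Modcat_map_closed[OF P, of "Fin _" Infty] graph_map_closed
    by (fastforce simp: Fbar_simps simp del: fob_prodm)
  have sub: "subgroup (graph_sub t M N \<alpha>) (fob ?P \<alpha>)" if \<alpha>: "\<alpha> \<in> ext_set \<Lambda>" for \<alpha>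
  proof (cases \<alpha>)
    case (Fin a)
    have "group_hom (fob M \<alpha>) (fob ?P \<alpha>) (\<lambda>x. pair x (t a x))"
      using Fin \<alpha> graph_map_hom Preglid_Modcat[OF M] P
      by (intro group_hom.intro group_hom_axioms.intro Modcat_is_group[where C = Fb]) (auto simp: Fbar_simps simp del: fob_prodm)
    from group_hom.img_is_subgroup[OF this] show ?thesis
      using Fin by simp
  next
    case Infty
    then show ?thesis
      using Pi.generate_is_subgroup[OF S] by simp
  qed
  have "fmap ?P \<alpha> \<beta> r z \<in> graph_sub t M N \<beta>"
    if ab: "\<alpha> \<in> ext_set \<Lambda>" "\<beta> \<in> ext_set \<Lambda>" and r: "r \<in> Fbar_hom \<Gamma> R F \<Lambda> \<alpha> \<beta>" and z: "z \<in> graph_sub t M N \<alpha>"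
    for \<alpha> \<beta> r z
  proof (cases \<beta>)
    case b: (Fin b)
    show ?thesis
    proof (cases \<alpha>)
      case a: (Fin a)
      obtain x where x: "x \<in> carrier (fob M (Fin a))" "z = pair x (t a x)"
        using z a by auto
      have r': "r \<in> Hom Fc a b"
        using r a b by simp
      have "fmap M (Fin a) (Fin b) r x \<in> carrier (fob M (Fin b))"
        using Modcat_map_closed[OF Preglid_Modcat[OF M], of "Fin a" "Fin b" r x] ab r x a b
        by (simp add: Fbar_simps)
      then show ?thesis
        using graph_map_nat[OF _ _ r' x(1)] ab x a b by simp
    next
      case Infty
      then have "fmap ?P \<alpha> \<beta> r z = \<one>\<^bsub>fob ?P \<beta>\<^esub>"
        using bar.Modcat_map_zero[OF P, of \<alpha> \<beta> z] ab r b subgroup.subset[OF sub[OF ab(1)]] z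
        by (auto simp: Fbar_simps)
      then show ?thesis
        using subgroup.one_closed[OF sub[OF ab(2)]] by simp
    qed
  next
    case b: Infty
    show ?thesis
    proof (cases \<alpha>)
      case (Fin a)
      then show ?thesis
        using b ab r z by (auto intro!: generate.incl)
    next
      case a: Infty
      interpret r: group_hom "fob ?P Infty" "fob ?P Infty" "fmap ?P Infty Infty r"
        using r a b Modcat_map_hom[OF P, of Infty Infty r]
        by (intro group_hom.intro group_hom_axioms.intro Pi.is_group) (simp add: Fbar_simps)
      have "fmap ?P Infty Infty r ` ?S \<subseteq> ?S"
      proof clarify
        fix c s x
        assume c: "c \<in> \<Lambda>" and s: "s \<in> carrier R" and x: "x \<in> carrier (fob M (Fin c))"
        have "fmap ?P Infty Infty r (fmap ?P (Fin c) Infty s (pair x (t c x))) =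
            fmap ?P (Fin c) Infty (r \<otimes>\<^bsub>R\<^esub> s) (pair x (t c x))"
          using Modcat_map_cmp[OF P, of "Fin c" Infty Infty s r, OF _ _ _ _ _ graph_map_closed[OF c x]] c s r a b
          by (simp add: Fbar_simps)
        then show "fmap ?P Infty Infty r (fmap ?P (Fin c) Infty s (pair x (t c x))) \<in> ?S"
          using c s x r a b by (auto intro!: bexI[of _ c] bexI[of _ "r \<otimes>\<^bsub>R\<^esub> s"])
      qed
      then have "fmap ?P Infty Infty r ` generate (fob ?P Infty) ?S \<subseteq> generate (fob ?P Infty) ?S"
        unfolding r.generate_img[OF S, symmetric] by (rule Pi.mono_generate)
      then show ?thesis
        using z a b by (auto simp del: fob_prodm)
    qed
  qed
  then show ?thesis
    using sub unfolding subfunctor_def Fbar_simps by blast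
qed

lemma graph_Preglid: "graph t M N \<in> Ob PG"
  unfolding graph_def by (intro subm_Preglid prodm_Preglid M N graph_subfunctor)

lemma graph_closed:
  assumes "\<alpha> \<in> ext_set \<Lambda>" "z \<in> carrier (fob (graph t M N) \<alpha>)"
  shows "p1 z \<in> carrier (fob M \<alpha>)" "p2 z \<in> carrier (fob N \<alpha>)"
  using subfunctor_carrier[OF graph_subfunctor, of \<alpha> z] assms
  by (simp_all add: Fbar_simps graph_def)

lemma graph_map:
  assumes "\<alpha> \<in> ext_set \<Lambda>" "z \<in> carrier (fob (graph t M N) \<alpha>)"
  shows "fmap (graph t M N) \<alpha> \<beta> r z = pair (fmap M \<alpha> \<beta> r (p1 z)) (fmap N \<alpha> \<beta> r (p2 z))"
  using graph_closed[OF assms] assms by (simp add: graph_def)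

lemma graph_mult: "z \<otimes>\<^bsub>fob (graph t M N) \<alpha>\<^esub> w =
    pair (p1 z \<otimes>\<^bsub>fob M \<alpha>\<^esub> p1 w) (p2 z \<otimes>\<^bsub>fob N \<alpha>\<^esub> p2 w)"
  by (simp add: graph_def)

lemma graph_fin: "carrier (fob (graph t M N) (Fin \<alpha>)) = (\<lambda>x. pair x (t \<alpha> x)) ` carrier (fob M (Fin \<alpha>))"
  by (simp add: graph_def)

lemma pr1_Hom: "pr1 t M N \<in> Hom PG (graph t M N) M"
  and pr2_Hom: "pr2 t M N \<in> Hom PG (graph t M N) N"
  unfolding pr1_def pr2_def Preglid_simps
  by (rule mkarr_Hom[OF Preglid_Modcat[OF graph_Preglid]];
    simp add: graph_closed graph_map graph_mult Fbar_simps hom_def)+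

text \<open>\<Sigma> tests finite objects only, and there the projection from the graph of a
  function to its domain is inverted by sending \<open>x\<close> to
  \<open>pair x (t \<alpha> x)\<close>. At \<open>Infty\<close> the projection may fail to be
  bijective.\<close>

lemma pr1_Sigma: "pr1 t M N \<in> Sig (graph t M N) M"
  unfolding Sigma_glid_def iso_def
proof (clarsimp simp: pr1_Hom, intro conjI)
  fix \<alpha>
  assume \<alpha>: "\<alpha> \<in> \<Lambda>"
  show "pr1 t M N (Fin \<alpha>) \<in> hom (fob (graph t M N) (Fin \<alpha>)) (fob M (Fin \<alpha>))"
    using Modcat_arr_hom[OF pr1_Hom[unfolded Preglid_simps], of "Fin \<alpha>"] \<alpha> by (simp add: Fbar_simps)
  show "bij_betw (pr1 t M N (Fin \<alpha>)) (carrier (fob (graph t M N) (Fin \<alpha>))) (carrier (fob M (Fin \<alpha>)))"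
    using \<alpha> by (intro bij_betw_byWitness[where f' = "\<lambda>x. pair x (t \<alpha> x)"])
      (auto simp: pr1_def Fbar_simps graph_fin)
qed

end

subsection \<open>Full faithfulness\<close>

lemma PG_category: "category PG"
  unfolding Preglid_def by (intro category_full_sub Modcat_category)

lemma PF_category: "category PF"
  unfolding Prefrag_def by (intro category_full_sub Modcat_category)

lemma GL_category: "category GL"
  unfolding Glid_def by (rule localization_category)

lemma GL_Ob: "Ob GL = Ob PG"
  by (simp add: Glid_def localization_simps)

lemma q_eq: "q A B f = zclass PG Sig A B [Fwd A B f]"
  by (simp add: Q_glid_def localization_functor_def)

lemma fob_Q: "fob (Q_glid \<Gamma> R F \<Lambda>) A = A"
  by (simp add: Q_glid_def localization_functor_def)

lemma q_functor: "is_functor PG GL (Q_glid \<Gamma> R F \<Lambda>)"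
  unfolding Q_glid_def Glid_def by (rule category.localization_functor_is_functor[OF PG_category])

lemma q_Hom: "A \<in> Ob PG \<Longrightarrow> B \<in> Ob PG \<Longrightarrow> f \<in> Hom PG A B \<Longrightarrow> q A B f \<in> Hom GL A B"
  using q_functor unfolding is_functor_def fob_Q by blast

lemma q_cmp:
  "\<lbrakk>A \<in> Ob PG; B \<in> Ob PG; E \<in> Ob PG; f \<in> Hom PG A B; g \<in> Hom PG B E\<rbrakk> \<Longrightarrow>
    q A E (cmp PG A B E g f) = cmp GL A B E (q B E g) (q A B f)"
  using q_functor unfolding is_functor_def fob_Q by blast

lemma q_Sigma_inverse:
  assumes "A \<in> Ob PG" "B \<in> Ob PG" "s \<in> Sig A B"
  shows "is_iso_pair GL A B (q A B s) (zclass PG Sig B A [Inv A B s])"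
proof -
  have "s \<in> Hom PG A B"
    using assms(3) by (simp add: Sigma_glid_def)
  then show ?thesis
    unfolding Q_glid_def Glid_def using assms by (intro localization_functor_inverts)
qed

lemma \<phi>_functor: "is_functor GL PF \<phi>"
  using embedding by (simp add: is_glid_embedding_def)

lemma \<phi>_fob: "A \<in> Ob PG \<Longrightarrow> fob \<phi> A = rs A"
  using embedding by (simp add: is_glid_embedding_def fctr_eq_def fctr_comp_def fob_Q)

lemma \<phi>_q: "A \<in> Ob PG \<Longrightarrow> B \<in> Ob PG \<Longrightarrow> f \<in> Hom PG A B \<Longrightarrow> fmap \<phi> A B (q A B f) = fmap (Res \<Lambda>) A B f"
  using embedding by (simp add: is_glid_embedding_def fctr_eq_def fctr_comp_def fob_Q)

lemma \<phi>_Hom: "A \<in> Ob PG \<Longrightarrow> B \<in> Ob PG \<Longrightarrow> f \<in> Hom GL A B \<Longrightarrow> fmap \<phi> A B f \<in> Hom PF (rs A) (rs B)"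
  using \<phi>_functor \<phi>_fob unfolding is_functor_def GL_Ob by metis

lemma \<phi>_idn: "A \<in> Ob PG \<Longrightarrow> fmap \<phi> A A (idn GL A) = idn PF (rs A)"
  using \<phi>_functor \<phi>_fob unfolding is_functor_def GL_Ob by metis

lemma \<phi>_cmp:
  assumes "A \<in> Ob PG" "B \<in> Ob PG" "E \<in> Ob PG" "f \<in> Hom GL A B" "g \<in> Hom GL B E"
  shows "fmap \<phi> A E (cmp GL A B E g f) = cmp PF (rs A) (rs B) (rs E) (fmap \<phi> B E g) (fmap \<phi> A B f)"
proof -
  have "fmap \<phi> A E (cmp GL A B E g f) =
      cmp PF (fob \<phi> A) (fob \<phi> B) (fob \<phi> E) (fmap \<phi> B E g) (fmap \<phi> A B f)"
    using \<phi>_functor assms unfolding is_functor_def GL_Ob by blast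
  then show ?thesis
    using assms by (simp add: \<phi>_fob)
qed

text \<open>The second projection after the formal inverse of the first; the inverse is the class of
  the one-step path \<open>Inv\<close>.\<close>

definition roof :: "('g, 'm) prefrag_arr \<Rightarrow> ('g, 'r, 'm) preglid \<Rightarrow> ('g, 'r, 'm) preglid \<Rightarrow> ('g, 'r, 'm) glid_arr" where
  "roof t M N = cmp GL M (graph t M N) N (q (graph t M N) N (pr2 t M N))
     (zclass PG Sig M (graph t M N) [Inv (graph t M N) M (pr1 t M N)])"

lemma roof:
  assumes M: "M \<in> Ob PG" and N: "N \<in> Ob PG" and t: "t \<in> Hom PF (rs M) (rs N)"
  shows roof_Hom: "roof t M N \<in> Hom GL M N"
    and roof_pr1: "cmp GL (graph t M N) M N (roof t M N) (q (graph t M N) M (pr1 t M N)) =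
      q (graph t M N) N (pr2 t M N)"
    and pr1_iso: "is_iso_arr GL (graph t M N) M (q (graph t M N) M (pr1 t M N))"
proof -
  interpret GL: category GL by (rule GL_category)
  let ?G = "graph t M N" and ?s = "zclass PG Sig M (graph t M N) [Inv (graph t M N) M (pr1 t M N)]"
  note G = graph_Preglid[OF M N t]
  note inv = q_Sigma_inverse[OF G M pr1_Sigma[OF M N t]]
  note ob = M[folded GL_Ob] N[folded GL_Ob] G[folded GL_Ob]
  have s: "?s \<in> Hom GL M ?G" "cmp GL ?G M ?G ?s (q ?G M (pr1 t M N)) = idn GL ?G"
    using inv by (auto simp: is_iso_pair_def)
  note p = q_Hom[OF G M pr1_Hom[OF M N t]] q_Hom[OF G N pr2_Hom[OF M N t]]
  show "roof t M N \<in> Hom GL M N"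
    unfolding roof_def by (intro GL.cmp_in ob s p)
  show "cmp GL ?G M N (roof t M N) (q ?G M (pr1 t M N)) = q ?G N (pr2 t M N)"
    unfolding roof_def using GL.cmp_assoc[OF ob(3,1,3,2) p(1) s(1) p(2)] s(2) GL.idn_right[OF ob(3,2) p(2)]
    by simp
  show "is_iso_arr GL ?G M (q ?G M (pr1 t M N))"
    using inv by (auto simp: is_iso_arr_def)
qed

text \<open>The image of the first projection is an isomorphism and can be cancelled on the right.
  Arrows are thus recognized as roofs by an equation free of formal inverses.\<close>

lemma roof_unique:
  assumes M: "M \<in> Ob PG" and N: "N \<in> Ob PG" and t: "t \<in> Hom PF (rs M) (rs N)"
    and x: "x \<in> Hom GL M N"
    and eq: "cmp GL (graph t M N) M N x (q (graph t M N) M (pr1 t M N)) = q (graph t M N) N (pr2 t M N)"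
  shows "x = roof t M N"
  using assms graph_Preglid[OF M N t] roof[OF M N t]
  by - (rule category.iso_arr_cancel[OF GL_category, of "graph t M N" M N "q (graph t M N) M (pr1 t M N)"], simp_all add: GL_Ob)

text \<open>This is fullness. Applying \<open>\<phi>\<close> to \<open>roof_pr1\<close> leaves an
  equation between restrictions of the two projections, which can be evaluated on elements.\<close>

lemma \<phi>_roof:
  assumes M: "M \<in> Ob PG" and N: "N \<in> Ob PG" and t: "t \<in> Hom PF (rs M) (rs N)"
  shows "fmap \<phi> M N (roof t M N) = t"
proof (rule Modcat_arr_eqI)
  note G = graph_Preglid[OF M N t]
  show "fmap \<phi> M N (roof t M N) \<in> Hom (Modcat Fc) (rs M) (rs N)"
    using \<phi>_Hom[OF M N roof_Hom[OF M N t]] by (simp add: Prefrag_simps)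
  show "t \<in> Hom (Modcat Fc) (rs M) (rs N)"
    using t by (simp add: Prefrag_simps)
  fix \<alpha> x
  assume \<alpha>: "\<alpha> \<in> Ob Fc" and x: "x \<in> carrier (fob (rs M) \<alpha>)"
  \<comment> \<open>The point of the graph over \<open>x\<close>: the first projection sends it to
    \<open>x\<close>, the second to \<open>t \<alpha> x\<close>.\<close>
  let ?z = "pair x (t \<alpha> x)"
  have z: "?z \<in> carrier (fob (graph t M N) (Fin \<alpha>))"
    using x by (auto simp: graph_fin[OF M N t] Res_simps)
  have "cmp PF (rs (graph t M N)) (rs M) (rs N) (fmap \<phi> M N (roof t M N))
      (fmap (Res \<Lambda>) (graph t M N) M (pr1 t M N)) = fmap (Res \<Lambda>) (graph t M N) N (pr2 t M N)"
    using arg_cong[OF roof_pr1[OF M N t], of "fmap \<phi> (graph t M N) N"]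
      \<phi>_cmp[OF G M N q_Hom[OF G M pr1_Hom[OF M N t]] roof_Hom[OF M N t]]
      \<phi>_q[OF G M pr1_Hom[OF M N t]] \<phi>_q[OF G N pr2_Hom[OF M N t]] by simp
  from fun_cong[OF fun_cong[OF this, of \<alpha>], of ?z]
  show "fmap \<phi> M N (roof t M N) \<alpha> x = t \<alpha> x"
    using \<alpha> z unfolding Prefrag_simps Modcat_cmp
    by (simp add: Res_simps Ob_Fcat pr1_def pr2_def Fbar_simps)
qed

text \<open>Graphs are functorial in the source: (x, y) goes to (f x, y), from the graph of the
  composite to the graph of \<open>t\<close>. This map \<open>w\<close> commutes with the
  projections, so the left side satisfies the equation that characterizes the roof on the
  right.\<close>

lemma roof_comp_q:
  assumes A: "A \<in> Ob PG" and B: "B \<in> Ob PG" and E: "E \<in> Ob PG"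
    and f: "f \<in> Hom PG A B" and t: "t \<in> Hom PF (rs B) (rs E)"
  shows "cmp GL A B E (roof t B E) (q A B f) = roof (cmp PF (rs A) (rs B) (rs E) t (fmap (Res \<Lambda>) A B f)) A E"
proof (rule roof_unique[OF A E])
  interpret GL: category GL by (rule GL_category)
  interpret PF: category PF by (rule PF_category)
  define t' where "t' = cmp PF (rs A) (rs B) (rs E) t (fmap (Res \<Lambda>) A B f)"
  have t': "t' \<in> Hom PF (rs A) (rs E)"
    unfolding t'_def by (intro PF.cmp_in Res_Ob Res_Hom A B E f t)
  then show "cmp PF (rs A) (rs B) (rs E) t (fmap (Res \<Lambda>) A B f) \<in> Hom PF (rs A) (rs E)"
    by (simp add: t'_def)
  have t'_eq: "t' \<alpha> x = t \<alpha> (f (Fin \<alpha>) x)" if "\<alpha> \<in> \<Lambda>" "x \<in> carrier (fob A (Fin \<alpha>))" for \<alpha> x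
    using that unfolding t'_def Prefrag_simps Modcat_cmp by (simp add: Res_simps Ob_Fcat)
  let ?G = "graph t B E" and ?G' = "graph t' A E"
  let ?h = "\<lambda>\<alpha> z. pair (f \<alpha> (p1 z)) (p2 z)"
  note G = graph_Preglid[OF B E t] and G' = graph_Preglid[OF A E t']
  note PA = prodm_Modcat[OF A E t'] and PB = prodm_Modcat[OF B E t]
  have f': "f \<in> Hom (Modcat Fb) A B"
    using f by (simp add: Preglid_simps)
  have f_closed: "f \<alpha> x \<in> carrier (fob B \<alpha>)" if "\<alpha> \<in> ext_set \<Lambda>" "x \<in> carrier (fob A \<alpha>)" for \<alpha> x
    using Modcat_arr_closed[OF f'] that by (simp add: Fbar_simps)
  have fin: "?h (Fin \<alpha>) z \<in> graph_sub t B E (Fin \<alpha>)" if "\<alpha> \<in> \<Lambda>" "z \<in> graph_sub t' A E (Fin \<alpha>)" for \<alpha> z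
    using that f_closed[of "Fin \<alpha>"] by (auto simp: t'_eq)
  \<comment> \<open>At \<open>Infty\<close> the comparison map is a homomorphism. By naturality of
    \<open>f\<close> it sends generators to generators, hence span into span.\<close>
  have infty: "?h Infty z \<in> graph_sub t B E Infty" if z: "z \<in> graph_sub t' A E Infty" for z
  proof -
    let ?PA = "prodm A E" and ?PB = "prodm B E"
    let ?S = "\<Union>\<alpha>\<in>\<Lambda>. \<Union>r\<in>carrier R. fmap ?PA (Fin \<alpha>) Infty r ` graph_sub t' A E (Fin \<alpha>)"
    let ?T = "\<Union>\<alpha>\<in>\<Lambda>. \<Union>r\<in>carrier R. fmap ?PB (Fin \<alpha>) Infty r ` graph_sub t B E (Fin \<alpha>)"
    have hom: "?h Infty \<in> hom (fob ?PA Infty) (fob ?PB Infty)"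
      using hom_mult[OF Modcat_arr_hom[OF f']] f_closed by (auto intro!: homI simp: Fbar_simps)
    interpret h: group_hom "fob ?PA Infty" "fob ?PB Infty" "?h Infty"
      using hom by (intro group_hom.intro group_hom_axioms.intro Modcat_is_group[OF PA] Modcat_is_group[OF PB])
        (simp_all add: Fbar_simps)
    have graph_in: "z \<in> carrier (fob ?PA (Fin \<alpha>))" if "\<alpha> \<in> \<Lambda>" "z \<in> graph_sub t' A E (Fin \<alpha>)" for \<alpha> z
      using subfunctor_carrier[OF graph_subfunctor[OF A E t'], of "Fin \<alpha>" z] that
      by (simp add: Fbar_simps del: fob_prodm)
    have S: "?S \<subseteq> carrier (fob ?PA Infty)"
      using Modcat_map_closed[OF PA, of "Fin _" Infty] graph_in
      by (auto simp: Fbar_simps simp del: fob_prodm graph_sub.simps)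
    have "?h Infty ` ?S \<subseteq> ?T"
    proof clarify
      fix \<alpha> r z
      assume h: "\<alpha> \<in> \<Lambda>" "r \<in> carrier R" and z: "z \<in> graph_sub t' A E (Fin \<alpha>)"
      have "?h Infty (fmap ?PA (Fin \<alpha>) Infty r z) = fmap ?PB (Fin \<alpha>) Infty r (?h (Fin \<alpha>) z)"
        using graph_in[OF h(1) z] f_closed[of "Fin \<alpha>" "p1 z"] h
          Modcat_arr_nat[OF f', of "Fin \<alpha>" Infty r "p1 z"] by (simp add: Fbar_simps)
      then show "?h Infty (fmap ?PA (Fin \<alpha>) Infty r z) \<in> ?T"
        using fin[OF h(1) z] h by auto
    qed
    then have "?h Infty ` generate (fob ?PA Infty) ?S \<subseteq> generate (fob ?PB Infty) ?T"
      unfolding h.generate_img[OF S, symmetric] by (rule h.H.mono_generate)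
    then show ?thesis
      using z by (auto simp del: fob_prodm)
  qed
  have h_in: "?h \<alpha> z \<in> carrier (fob ?G \<alpha>)" if "\<alpha> \<in> ext_set \<Lambda>" "z \<in> carrier (fob ?G' \<alpha>)" for \<alpha> z
    using that fin infty by (cases \<alpha>) (auto simp: graph_def simp del: graph_sub.simps)
  define w where "w = mkarr Fb ?G' ?h"
  have w: "w \<in> Hom PG ?G' ?G"
    unfolding w_def Preglid_simps
  proof (rule mkarr_Hom[OF Preglid_Modcat[OF G']])
    fix \<alpha>
    assume \<alpha>: "\<alpha> \<in> Ob Fb"
    then show "?h \<alpha> \<in> hom (fob ?G' \<alpha>) (fob ?G \<alpha>)"
      using h_in graph_closed[OF A E t'] hom_mult[OF Modcat_arr_hom[OF f' \<alpha>]]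
      by (intro homI) (simp_all add: Fbar_simps graph_mult[OF A E t'] graph_mult[OF B E t])
  next
    fix \<alpha> \<beta> r z
    assume h: "\<alpha> \<in> Ob Fb" "\<beta> \<in> Ob Fb" "r \<in> Hom Fb \<alpha> \<beta>" and z: "z \<in> carrier (fob ?G' \<alpha>)"
    have \<alpha>: "\<alpha> \<in> ext_set \<Lambda>"
      using h(1) by (simp add: Fbar_simps)
    show "?h \<beta> (fmap ?G' \<alpha> \<beta> r z) = fmap ?G \<alpha> \<beta> r (?h \<alpha> z)"
      using Modcat_arr_nat[OF f' h graph_closed(1)[OF A E t' \<alpha> z]]
      by (simp add: graph_map[OF A E t' \<alpha> z] graph_map[OF B E t \<alpha> h_in[OF \<alpha> z]])
  qed
  have pw: "pr1 t' A E \<in> Hom PG ?G' A" "pr2 t' A E \<in> Hom PG ?G' E"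
    "pr1 t B E \<in> Hom PG ?G B" "pr2 t B E \<in> Hom PG ?G E"
    by (rule pr1_Hom[OF A E t'] pr2_Hom[OF A E t'] pr1_Hom[OF B E t] pr2_Hom[OF B E t])+
  have fp1: "cmp PG ?G' A B f (pr1 t' A E) = cmp PG ?G' ?G B (pr1 t B E) w"
    unfolding Preglid_simps Modcat_cmp
    by (rule mkarr_cong) (simp add: pr1_def w_def h_in Fbar_simps)
  have p2: "cmp PG ?G' ?G E (pr2 t B E) w = pr2 t' A E"
    unfolding Preglid_simps Modcat_cmp unfolding pr2_def
    by (rule mkarr_cong) (simp add: w_def h_in Fbar_simps)
  note ob = A[folded GL_Ob] B[folded GL_Ob] E[folded GL_Ob] G[folded GL_Ob] G'[folded GL_Ob]
  note qf = q_Hom[OF A B f] and qw = q_Hom[OF G' G w]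
    and qp1 = q_Hom[OF G B pw(3)] and qp1' = q_Hom[OF G' A pw(1)]
  note rf = roof_Hom[OF B E t]
  show "cmp GL A B E (roof t B E) (q A B f) \<in> Hom GL A E"
    by (rule GL.cmp_in[OF ob(1,2,3) qf rf])
  have "cmp GL ?G' A E (cmp GL A B E (roof t B E) (q A B f)) (q ?G' A (pr1 t' A E)) =
      cmp GL ?G' B E (roof t B E) (q ?G' B (cmp PG ?G' A B f (pr1 t' A E)))"
    using GL.cmp_assoc[OF ob(5,1,2,3) qp1' qf rf] q_cmp[OF G' A B pw(1) f] by simp
  also have "\<dots> = cmp GL ?G' ?G E (cmp GL ?G B E (roof t B E) (q ?G B (pr1 t B E))) (q ?G' ?G w)"
    unfolding fp1 using GL.cmp_assoc[OF ob(5,4,2,3) qw qp1 rf] q_cmp[OF G' G B w pw(3)] by simp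
  also have "\<dots> = q ?G' E (pr2 t' A E)"
    unfolding roof_pr1[OF B E t] using q_cmp[OF G' G E w pw(4)] p2 by simp
  finally show "cmp GL (graph (cmp PF (rs A) (rs B) (rs E) t (fmap (Res \<Lambda>) A B f)) A E) A E
      (cmp GL A B E (roof t B E) (q A B f))
      (q (graph (cmp PF (rs A) (rs B) (rs E) t (fmap (Res \<Lambda>) A B f)) A E) A
        (pr1 (cmp PF (rs A) (rs B) (rs E) t (fmap (Res \<Lambda>) A B f)) A E)) =
    q (graph (cmp PF (rs A) (rs B) (rs E) t (fmap (Res \<Lambda>) A B f)) A E) E
      (pr2 (cmp PF (rs A) (rs B) (rs E) t (fmap (Res \<Lambda>) A B f)) A E)"
    by (simp add: t'_def)
qed

text \<open>The two projections coincide: over finite objects the graph of the identity is the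
  diagonal, and at \<open>Infty\<close> it is generated by diagonal elements, hence contained in the
  diagonal subgroup. It may be smaller, as the finite values need not generate \<open>A\<close> at
  \<open>Infty\<close>.\<close>

lemma roof_idn:
  assumes A: "A \<in> Ob PG"
  shows "idn GL A = roof (idn PF (rs A)) A A"
proof -
  interpret GL: category GL by (rule GL_category)
  interpret PF: category PF by (rule PF_category)
  let ?t = "idn PF (rs A)" and ?P = "prodm A A"
  have t: "?t \<in> Hom PF (rs A) (rs A)"
    by (intro PF.idn_in Res_Ob A)
  have t_eq: "?t \<alpha> x = x" if "\<alpha> \<in> \<Lambda>" "x \<in> carrier (fob A (Fin \<alpha>))" for \<alpha> x
    using that unfolding Prefrag_simps Modcat_idn by (simp add: Res_simps Ob_Fcat)
  note G = graph_Preglid[OF A A t] and P = prodm_Modcat[OF A A t]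
  have A': "A \<in> Ob (Modcat Fb)"
    by (rule Preglid_Modcat[OF A])
  have "p1 z = p2 z" if "\<alpha> \<in> ext_set \<Lambda>" "z \<in> graph_sub ?t A A \<alpha>" for \<alpha> z
  proof (cases \<alpha>)
    case (Fin a)
    then show ?thesis
      using that by (auto simp: t_eq)
  next
    case Infty
    let ?diag = "(\<lambda>x. pair x x) ` carrier (fob A Infty)"
    interpret A: group "fob A Infty"
      by (rule Modcat_is_group[OF A']) (simp add: Fbar_simps)
    interpret P: group "fob ?P Infty"
      by (rule Modcat_is_group[OF P]) (simp add: Fbar_simps)
    have "group_hom (fob A Infty) (fob ?P Infty) (\<lambda>x. pair x x)"
      by (intro group_hom.intro group_hom_axioms.intro A.is_group P.is_group homI) simp_all
    then have "subgroup ?diag (fob ?P Infty)"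
      by (rule group_hom.img_is_subgroup)
    then have "graph_sub ?t A A Infty \<subseteq> ?diag"
      unfolding graph_sub.simps
      using Modcat_map_closed[OF A', of "Fin _" Infty]
      by (intro P.generate_subgroup_incl) (auto simp: Fbar_simps t_eq)
    then show ?thesis
      using that Infty by auto
  qed
  then have "pr2 ?t A A = pr1 ?t A A"
    unfolding pr1_def pr2_def by (intro mkarr_cong) (simp add: Fbar_simps graph_def)
  then show ?thesis
    using GL.idn_left[OF _ _ q_Hom[OF G A pr1_Hom[OF A A t]]] GL.idn_in A G
    by - (rule roof_unique[OF A A t], simp_all add: GL_Ob)
qed

text \<open>Faithfulness in explicit form: a glid arrow is recovered from its image. The induction
  removes the first step of the path. A forward step is absorbed by \<open>roof_comp_q\<close>; for
  a formal inverse of \<open>w\<close>, both sides are compared after precomposing with the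
  isomorphism \<open>q A B w\<close>, which is then cancelled.\<close>

lemma zclass_eq_roof:
  assumes "zpath PG Sig A p B"
  shows "zclass PG Sig A B p = roof (fmap \<phi> A B (zclass PG Sig A B p)) A B"
  using assms
proof (induction rule: zpath.induct)
  case (zpath_Nil A)
  have "zclass PG Sig A A [] = idn GL A"
    by (simp add: Glid_def localization_simps)
  then show ?case
    using roof_idn[OF zpath_Nil] \<phi>_idn[OF zpath_Nil] by metis
next
  case (zpath_Fwd A B f p E)
  let ?x = "zclass PG Sig B E p"
  have E: "E \<in> Ob PG"
    using zpath_Ob[OF zpath_Fwd(4)] by blast
  have x: "?x \<in> Hom GL B E"
    using zpath_Fwd(4) by (auto simp: Glid_def localization_simps)
  have "zpath PG Sig A [Fwd A B f] B"
    using zpath_Fwd by (auto intro!: zpath.intros)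
  from localization_cmp[OF this zpath_Fwd(4)]
  have eq: "zclass PG Sig A E (Fwd A B f # p) = cmp GL A B E ?x (q A B f)"
    by (simp add: Glid_def q_eq)
  have "cmp GL A B E ?x (q A B f) =
      roof (cmp PF (rs A) (rs B) (rs E) (fmap \<phi> B E ?x) (fmap (Res \<Lambda>) A B f)) A E"
    using roof_comp_q[OF zpath_Fwd(1,2) E zpath_Fwd(3) \<phi>_Hom[OF zpath_Fwd(2) E x]] zpath_Fwd.IH by simp
  then show ?case
    unfolding eq
    using \<phi>_cmp[OF zpath_Fwd(1,2) E q_Hom[OF zpath_Fwd(1-3)] x] \<phi>_q[OF zpath_Fwd(1-3)] by simp
next
  case (zpath_Inv A B w p E)
  let ?x = "zclass PG Sig A E p" and ?y = "zclass PG Sig B E (Inv A B w # p)"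
  have E: "E \<in> Ob PG"
    using zpath_Ob[OF zpath_Inv(5)] by blast
  have path: "zpath PG Sig A [Fwd A B w] B" "zpath PG Sig B (Inv A B w # p) E"
    using zpath_Inv by (auto intro!: zpath.intros)
  then have y: "?y \<in> Hom GL B E"
    by (auto simp: Glid_def localization_simps)
  \<comment> \<open>Putting the forward step \<open>w\<close> in front cancels its formal inverse,
    so precomposition leads back to the shorter path of the induction hypothesis.\<close>
  have "zequiv PG Sig A E ([Fwd A B w, Inv A B w] @ p) ([] @ p)"
    using zpath_Inv by (intro zequiv_append[where B = A] zequiv_Fwd_Inv zequiv_refl)
  then have yx: "cmp GL A B E ?y (q A B w) = ?x"
    using localization_cmp[OF path] by (simp add: Glid_def q_eq zclass_eqI)
  have w: "q A B w \<in> Hom GL A B"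
    by (rule q_Hom[OF zpath_Inv(1-3)])
  have \<phi>y: "fmap \<phi> B E ?y \<in> Hom PF (rs B) (rs E)"
    by (rule \<phi>_Hom[OF zpath_Inv(2) E y])
  have "fmap \<phi> A E ?x = cmp PF (rs A) (rs B) (rs E) (fmap \<phi> B E ?y) (fmap (Res \<Lambda>) A B w)"
    unfolding yx[symmetric] using \<phi>_cmp[OF zpath_Inv(1,2) E w y] \<phi>_q[OF zpath_Inv(1-3)] by simp
  then have "cmp GL A B E (roof (fmap \<phi> B E ?y) B E) (q A B w) = roof (fmap \<phi> A E ?x) A E"
    using roof_comp_q[OF zpath_Inv(1,2) E zpath_Inv(3) \<phi>y] by simp
  then have "cmp GL A B E (roof (fmap \<phi> B E ?y) B E) (q A B w) = cmp GL A B E ?y (q A B w)"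
    unfolding yx using zpath_Inv.IH by simp
  moreover have "is_iso_arr GL A B (q A B w)"
    using q_Sigma_inverse[OF zpath_Inv(1,2,4)] unfolding is_iso_arr_def by blast
  ultimately show ?case
    using zpath_Inv(1,2) E y roof_Hom[OF zpath_Inv(2) E \<phi>y]
    by - (rule category.iso_arr_cancel[OF GL_category, of A B E "q A B w"], simp_all add: GL_Ob)
qed

lemma \<phi>_faithful:
  assumes "A \<in> Ob PG" "B \<in> Ob PG" "x \<in> Hom GL A B" "y \<in> Hom GL A B" "fmap \<phi> A B x = fmap \<phi> A B y"
  shows "x = y"
proof -
  have "z = roof (fmap \<phi> A B z) A B" if "z \<in> Hom GL A B" for z
    using that zclass_eq_roof by (auto simp: Glid_def localization_simps)
  then show ?thesis
    using assms by metis
qed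

text \<open>The pointwise inverse also lifts to a roof. The two inverse laws hold after
  \<open>\<phi>\<close>, hence among glids by faithfulness.\<close>

lemma lift_iso:
  assumes A: "A \<in> Ob PG" and B: "B \<in> Ob PG" and t: "t \<in> Hom (Modcat Fc) (rs A) (rs B)"
    and bij: "\<And>\<alpha>. \<alpha> \<in> \<Lambda> \<Longrightarrow> bij_betw (t \<alpha>) (carrier (fob A (Fin \<alpha>))) (carrier (fob B (Fin \<alpha>)))"
  shows "is_iso_arr GL A B (roof t A B)"
proof -
  interpret GL: category GL by (rule GL_category)
  have "is_iso_arr (Modcat Fc) (rs A) (rs B) t"
    using bij by (intro Modcat_bij_imp_iso Prefrag_Modcat Res_Ob A B t) (simp add: Ob_Fcat Res_simps)
  then obtain s where "is_iso_pair PF (rs A) (rs B) t s"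
    unfolding is_iso_arr_def is_iso_pair_def Prefrag_simps by blast
  then have s: "t \<in> Hom PF (rs A) (rs B)" "s \<in> Hom PF (rs B) (rs A)"
    "cmp PF (rs A) (rs B) (rs A) s t = idn PF (rs A)" "cmp PF (rs B) (rs A) (rs B) t s = idn PF (rs B)"
    unfolding is_iso_pair_def by blast+
  note r = roof_Hom[OF A B s(1)] roof_Hom[OF B A s(2)]
  note ob = A[folded GL_Ob] B[folded GL_Ob]
  have "cmp GL A B A (roof s B A) (roof t A B) = idn GL A"
    using \<phi>_cmp[OF A B A r] \<phi>_idn[OF A] s \<phi>_roof[OF A B s(1)] \<phi>_roof[OF B A s(2)]
    by (intro \<phi>_faithful[OF A A] GL.cmp_in GL.idn_in ob r) simp
  moreover have "cmp GL B A B (roof t A B) (roof s B A) = idn GL B"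
    using \<phi>_cmp[OF B A B r(2,1)] \<phi>_idn[OF B] s \<phi>_roof[OF A B s(1)] \<phi>_roof[OF B A s(2)]
    by (intro \<phi>_faithful[OF B B] GL.cmp_in GL.idn_in ob r) simp
  ultimately show ?thesis
    using r unfolding is_iso_arr_def is_iso_pair_def by blast
qed

end

section \<open>Conflations of glids\<close>

lemma Res_pointwise_exact:
  assumes "pointwise_exact (Fbar \<Gamma> R F \<Lambda>) K f M g N"
  shows "pointwise_exact (Fcat \<Gamma> R F \<Lambda>) (fob (Res \<Lambda>) K) (fmap (Res \<Lambda>) K M f) (fob (Res \<Lambda>) M)
    (fmap (Res \<Lambda>) M N g) (fob (Res \<Lambda>) N)"
  using assms unfolding pointwise_exact_def by (simp add: Res_simps Ob_Fcat Fbar_simps)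

context glids
begin

text \<open>\<open>\<phi>\<close> turns the glid isomorphisms \<open>a\<close>, \<open>b\<close>,
  \<open>c\<close> into pointwise bijections. Along these, exactness of the restricted preglid
  conflation is carried back to the given sequence.\<close>

lemma conflation_Glid_imp_Prefrag:
  assumes K: "K \<in> Ob PG" and M: "M \<in> Ob PG" and N: "N \<in> Ob PG"
    and f: "f \<in> Hom GL K M" and g: "g \<in> Hom GL M N"
    and conf: "conflation_Glid \<Gamma> R F \<Lambda> K f M g N"
  shows "conflation_Prefrag \<Gamma> R F \<Lambda> (rs K) (fmap \<phi> K M f) (rs M) (fmap \<phi> M N g) (rs N)"
proof -
  obtain K' f' M' g' N' a b c where conf': "conflation_Preglid \<Gamma> R F \<Lambda> K' f' M' g' N'"
    and iso: "is_iso_arr GL K K' a" "is_iso_arr GL M M' b" "is_iso_arr GL N N' c"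
    and sq: "cmp GL K M M' b f = cmp GL K K' M' (q K' M' f') a"
      "cmp GL M N N' c g = cmp GL M M' N' (q M' N' g') b"
    using conf unfolding conflation_Glid_def Let_def fob_Q iso_sequences_def by blast
  have ob': "K' \<in> Ob PG" "M' \<in> Ob PG" "N' \<in> Ob PG" and f': "f' \<in> Hom PG K' M'" and g': "g' \<in> Hom PG M' N'"
    using conf' by (auto simp: kernel_cokernel_pair_def is_kernel_def)
  have "pointwise_exact Fb K' f' M' g' N'"
    using conflation_Preglid_iff[OF ob' f' g'] conf' by blast
  note ex = Res_pointwise_exact[OF this]
  have arr: "a \<in> Hom GL K K'" "b \<in> Hom GL M M'" "c \<in> Hom GL N N'"
    using iso by (auto simp: is_iso_arr_def is_iso_pair_def)
  have \<phi>_bij: "bij_betw (fmap \<phi> A B x \<alpha>) (carrier (fob (rs A) \<alpha>)) (carrier (fob (rs B) \<alpha>))"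
    if AB: "A \<in> Ob PG" "B \<in> Ob PG" and x: "is_iso_arr GL A B x" and \<alpha>: "\<alpha> \<in> Ob Fc" for A B x \<alpha>
  proof (rule Modcat_iso_imp_bij[OF _ \<alpha>])
    have "is_iso_arr PF (fob \<phi> A) (fob \<phi> B) (fmap \<phi> A B x)"
      using functor_iso_arr[OF \<phi>_functor _ _ x] AB by (simp add: GL_Ob)
    then show "is_iso_arr (Modcat Fc) (rs A) (rs B) (fmap \<phi> A B x)"
      using AB by (simp add: \<phi>_fob is_iso_arr_def is_iso_pair_def Prefrag_simps)
  qed
  note h = \<phi>_Hom[OF K M f] \<phi>_Hom[OF M N g]
  have eq: "cmp PF (rs K) (rs M) (rs M') (fmap \<phi> M M' b) (fmap \<phi> K M f) =
      cmp PF (rs K) (rs K') (rs M') (fmap (Res \<Lambda>) K' M' f') (fmap \<phi> K K' a)"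
    "cmp PF (rs M) (rs N) (rs N') (fmap \<phi> N N' c) (fmap \<phi> M N g) =
      cmp PF (rs M) (rs M') (rs N') (fmap (Res \<Lambda>) M' N' g') (fmap \<phi> M M' b)"
    using sq \<phi>_cmp[OF K M ob'(2) f arr(2)] \<phi>_cmp[OF K ob'(1,2) arr(1) q_Hom[OF ob'(1,2) f']]
      \<phi>_cmp[OF M N ob'(3) g arr(3)] \<phi>_cmp[OF M ob'(2,3) arr(2) q_Hom[OF ob'(2,3) g']]
      \<phi>_q[OF ob'(1,2) f'] \<phi>_q[OF ob'(2,3) g'] by simp_all
  have "pointwise_exact Fc (rs K) (fmap \<phi> K M f) (rs M) (fmap \<phi> M N g) (rs N)"
    using Modcat_arr_closed[OF h(1)[unfolded Prefrag_simps]] Modcat_arr_closed[OF h(2)[unfolded Prefrag_simps]]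
      \<phi>_bij[OF K ob'(1) iso(1)] \<phi>_bij[OF M ob'(2) iso(2)] \<phi>_bij[OF N ob'(3) iso(3)]
      mkarr_eqD[OF eq(1)[unfolded Prefrag_simps Modcat_cmp]] mkarr_eqD[OF eq(2)[unfolded Prefrag_simps Modcat_cmp]]
      Modcat_arr_group_hom[OF Prefrag_Modcat[OF Res_Ob[OF N]] Prefrag_Modcat[OF Res_Ob[OF ob'(3)]]
        \<phi>_Hom[OF N ob'(3) arr(3), unfolded Prefrag_simps]]
    by (intro pointwise_exact_transfer[OF _ _ _ _ _ _ _ _ ex])
  then show ?thesis
    using conflation_Prefrag_iff[OF Res_Ob[OF K] Res_Ob[OF M] Res_Ob[OF N] h] by blast
qed

lemma conflation_Prefrag_imp_Glid:
  assumes K: "K \<in> Ob PG" and M: "M \<in> Ob PG" and N: "N \<in> Ob PG"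
    and f: "f \<in> Hom GL K M" and g: "g \<in> Hom GL M N"
    and conf: "conflation_Prefrag \<Gamma> R F \<Lambda> (rs K) (fmap \<phi> K M f) (rs M) (fmap \<phi> M N g) (rs N)"
  shows "conflation_Glid \<Gamma> R F \<Lambda> K f M g N"
proof -
  interpret GL: category GL by (rule GL_category)
  define t u where "t = fmap \<phi> K M f" and "u = fmap \<phi> M N g"
  have t: "t \<in> Hom PF (rs K) (rs M)" and u: "u \<in> Hom PF (rs M) (rs N)"
    unfolding t_def u_def using \<phi>_Hom K M N f g by blast+
  have t': "t \<in> Hom (Modcat Fc) (rs K) (rs M)" and u': "u \<in> Hom (Modcat Fc) (rs M) (rs N)"
    using t u by (simp_all add: Prefrag_simps)
  have "pointwise_exact Fc (rs K) t (rs M) u (rs N)"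
    using conf conflation_Prefrag_iff[OF Res_Ob[OF K] Res_Ob[OF M] Res_Ob[OF N] t u]
    by (simp add: t_def u_def)
  then have ex: "inj_on (t \<alpha>) (carrier (fob K (Fin \<alpha>)))"
    "t \<alpha> ` carrier (fob K (Fin \<alpha>)) = kernel (fob M (Fin \<alpha>)) (fob N (Fin \<alpha>)) (u \<alpha>)"
    "u \<alpha> ` carrier (fob M (Fin \<alpha>)) = carrier (fob N (Fin \<alpha>))" if "\<alpha> \<in> \<Lambda>" for \<alpha>
    using that by (simp_all add: pointwise_exact_def Ob_Fcat Res_simps)
  have t_closed: "t \<alpha> x \<in> carrier (fob M (Fin \<alpha>))" if "\<alpha> \<in> \<Lambda>" "x \<in> carrier (fob K (Fin \<alpha>))" for \<alpha> x
    using Modcat_arr_closed[OF t'] that by (simp add: Ob_Fcat Res_simps)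
  define M' where "M' = graph u M N"
  define p where "p = pr2 u M N"
  have M': "M' \<in> Ob PG" and p: "p \<in> Hom (Modcat Fb) M' N"
    using graph_Preglid[OF M N u] pr2_Hom[OF M N u] by (simp_all add: M'_def p_def Preglid_simps)
  note mod = Preglid_Modcat[OF M'] Preglid_Modcat[OF N]
  \<comment> \<open>Kernel and image are taken at all objects including \<open>Infty\<close>, so
    that exactness as preglids holds by construction. The given conflation is used only to identify
    both at finite objects.\<close>
  define S where "S = (\<lambda>\<alpha>. kernel (fob M' \<alpha>) (fob N \<alpha>) (p \<alpha>))"
  define T where "T = (\<lambda>\<alpha>. p \<alpha> ` carrier (fob M' \<alpha>))"
  have S: "subfunctor Fb M' S" and T: "subfunctor Fb N T"
    unfolding S_def T_def by (rule bar.subfunctor_kernel[OF mod p] bar.subfunctor_image[OF mod p])+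
  define K' N' where "K' = subm M' S" and "N' = subm N T"
  have K': "K' \<in> Ob PG" and N': "N' \<in> Ob PG"
    unfolding K'_def N'_def by (rule subm_Preglid[OF M' S] subm_Preglid[OF N T])+
  define i where "i = mkarr Fb K' (\<lambda>\<alpha> x. x)"
  have i: "i \<in> Hom PG K' M'"
    unfolding i_def K'_def Preglid_simps by (rule bar.subm_incl[OF mod(1) S])
  have p': "p \<in> Hom PG M' N'"
    unfolding N'_def Preglid_simps by (rule bar.subm_corestrict[OF T p]) (simp add: T_def)
  have "pointwise_exact Fb K' i M' p N'"
    unfolding pointwise_exact_def
    by (auto simp: i_def K'_def N'_def S_def T_def kernel_def inj_on_def image_iff)
  then have conf': "conflation_Preglid \<Gamma> R F \<Lambda> K' i M' p N'"
    using conflation_Preglid_iff[OF K' M' N' i p'] by blast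
  have M'_fin: "carrier (fob M' (Fin \<alpha>)) = (\<lambda>x. pair x (u \<alpha> x)) ` carrier (fob M (Fin \<alpha>))" for \<alpha>
    unfolding M'_def by (rule graph_fin[OF M N u])
  have p_fin: "p (Fin \<alpha>) z = p2 z" if "\<alpha> \<in> \<Lambda>" "z \<in> carrier (fob M' (Fin \<alpha>))" for \<alpha> z
    using that by (simp add: p_def pr2_def M'_def Fbar_simps)
  \<comment> \<open>A point \<open>pair x (u \<alpha> x)\<close> is killed by the second projection
    exactly when \<open>x\<close> lies in the kernel of \<open>u \<alpha>\<close>, which by
    exactness is the image of \<open>t \<alpha>\<close>.\<close>
  have S_fin: "S (Fin \<alpha>) = (\<lambda>x. pair x (u \<alpha> x)) ` t \<alpha> ` carrier (fob K (Fin \<alpha>))" if "\<alpha> \<in> \<Lambda>" for \<alpha>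
  proof -
    let ?h = "\<lambda>x. pair x (u \<alpha> x)"
    have ph: "p (Fin \<alpha>) (?h x) = u \<alpha> x" if "x \<in> carrier (fob M (Fin \<alpha>))" for x
      using that p_fin[OF \<open>\<alpha> \<in> \<Lambda>\<close>, of "?h x"] by (simp add: M'_fin)
    have "S (Fin \<alpha>) = ?h ` {x \<in> carrier (fob M (Fin \<alpha>)). p (Fin \<alpha>) (?h x) = \<one>\<^bsub>fob N (Fin \<alpha>)\<^esub>}"
      unfolding S_def kernel_def M'_fin by blast
    also have "{x \<in> carrier (fob M (Fin \<alpha>)). p (Fin \<alpha>) (?h x) = \<one>\<^bsub>fob N (Fin \<alpha>)\<^esub>} =
        t \<alpha> ` carrier (fob K (Fin \<alpha>))"
      unfolding ex(2)[OF that] kernel_def using ph by (intro Collect_cong conj_cong refl) simp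
    finally show ?thesis .
  qed
  have T_fin: "T (Fin \<alpha>) = carrier (fob N (Fin \<alpha>))" if "\<alpha> \<in> \<Lambda>" for \<alpha>
  proof -
    have "T (Fin \<alpha>) = p2 ` carrier (fob M' (Fin \<alpha>))"
      unfolding T_def using p_fin[OF that] by (rule image_cong[OF refl])
    then show ?thesis
      unfolding ex(3)[OF that, symmetric] by (simp add: M'_fin image_image)
  qed
  \<comment> \<open>\<open>\<mu>\<close> inverts the first projection at finite objects.
    \<open>\<kappa>\<close> is \<open>\<mu>\<close> after \<open>t\<close>, with values in the
    kernel by \<open>S_fin\<close>. \<open>\<nu>\<close> is the identity on elements, since by
    \<open>T_fin\<close> the image is everything there.\<close>
  define \<mu> where "\<mu> = mkarr Fc (rs M) (\<lambda>\<alpha> x. pair x (u \<alpha> x))"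
  define \<kappa> where "\<kappa> = mkarr Fc (rs K) (\<lambda>\<alpha> x. pair (t \<alpha> x) (u \<alpha> (t \<alpha> x)))"
  define \<nu> where "\<nu> = mkarr Fc (rs N) (\<lambda>\<alpha> x. x)"
  have \<mu>: "\<mu> \<in> Hom (Modcat Fc) (rs M) (rs M')"
    unfolding \<mu>_def
  proof (rule mkarr_Hom[OF Prefrag_Modcat[OF Res_Ob[OF M]]])
    fix \<alpha>
    assume \<alpha>: "\<alpha> \<in> Ob Fc"
    then show "(\<lambda>x. pair x (u \<alpha> x)) \<in> hom (fob (rs M) \<alpha>) (fob (rs M') \<alpha>)"
      using hom_mult[OF Modcat_arr_hom[OF u' \<alpha>]]
      by (intro homI) (auto simp: Res_simps M'_fin graph_mult[OF M N u, folded M'_def])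
  next
    fix \<alpha> \<beta> r x
    assume h: "\<alpha> \<in> Ob Fc" "\<beta> \<in> Ob Fc" "r \<in> Hom Fc \<alpha> \<beta>" and x: "x \<in> carrier (fob (rs M) \<alpha>)"
    have z: "pair x (u \<alpha> x) \<in> carrier (fob M' (Fin \<alpha>))"
      using x by (auto simp: M'_fin Res_simps)
    show "pair (fmap (rs M) \<alpha> \<beta> r x) (u \<beta> (fmap (rs M) \<alpha> \<beta> r x)) = fmap (rs M') \<alpha> \<beta> r (pair x (u \<alpha> x))"
      using graph_map[OF M N u _ z[unfolded M'_def]] h(1) Modcat_arr_nat[OF u' h x]
      by (simp add: Res_simps Ob_Fcat M'_def)
  qed
  have \<kappa>_eq: "\<kappa> = cmp (Modcat Fc) (rs K) (rs M) (rs M') \<mu> t"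
    unfolding \<kappa>_def \<mu>_def Modcat_cmp using t_closed
    by (intro mkarr_cong) (simp add: Ob_Fcat Res_simps)
  have "\<kappa> \<in> Hom (Modcat Fc) (rs K) (rs M')"
    unfolding \<kappa>_eq
    by (intro category.cmp_in[OF Modcat_category] Prefrag_Modcat Res_Ob K M M' t' \<mu>)
  then have \<kappa>: "\<kappa> \<in> Hom (Modcat Fc) (rs K) (rs K')"
    unfolding Modcat_Hom_iff
    by (auto simp: Res_simps Ob_Fcat K'_def S_fin \<kappa>_def hom_def Pi_iff)
  have \<nu>: "\<nu> \<in> Hom (Modcat Fc) (rs N) (rs N')"
    unfolding \<nu>_def
    by (rule mkarr_Hom[OF Prefrag_Modcat[OF Res_Ob[OF N]]])
      (auto simp: Res_simps Ob_Fcat N'_def T_fin hom_def)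
  note \<kappa>P = \<kappa>[folded Prefrag_simps(1)] and \<mu>P = \<mu>[folded Prefrag_simps(1)] and \<nu>P = \<nu>[folded Prefrag_simps(1)]
  have iso: "is_iso_arr GL K K' (roof \<kappa> K K')" "is_iso_arr GL M M' (roof \<mu> M M')"
    "is_iso_arr GL N N' (roof \<nu> N N')"
  proof -
    show "is_iso_arr GL K K' (roof \<kappa> K K')"
      using ex(1) by (intro lift_iso[OF K K' \<kappa>])
        (auto simp: bij_betw_def inj_on_def pair_inj \<kappa>_def Ob_Fcat Res_simps K'_def S_fin image_image)
    show "is_iso_arr GL M M' (roof \<mu> M M')"
      by (intro lift_iso[OF M M' \<mu>])
        (auto simp: bij_betw_def inj_on_def pair_inj \<mu>_def Ob_Fcat Res_simps M'_fin)
    show "is_iso_arr GL N N' (roof \<nu> N N')"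
      by (intro lift_iso[OF N N' \<nu>])
        (auto simp: bij_betw_def inj_on_def \<nu>_def Ob_Fcat Res_simps N'_def T_fin)
  qed
  note r = roof_Hom[OF K K' \<kappa>P] roof_Hom[OF M M' \<mu>P] roof_Hom[OF N N' \<nu>P]
  note ob = K[folded GL_Ob] M[folded GL_Ob] N[folded GL_Ob] K'[folded GL_Ob] M'[folded GL_Ob] N'[folded GL_Ob]
  note qi = q_Hom[OF K' M' i] and qp = q_Hom[OF M' N' p']
  \<comment> \<open>By faithfulness the square may be checked among restrictions, where both
    composites send \<open>x\<close> to the point of the graph over
    \<open>t \<alpha> x\<close>.\<close>
  have "cmp GL K M M' (roof \<mu> M M') f = cmp GL K K' M' (q K' M' i) (roof \<kappa> K K')"
  proof (rule \<phi>_faithful[OF K M'])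
    have "cmp PF (rs K) (rs M) (rs M') \<mu> t = cmp PF (rs K) (rs K') (rs M') (fmap (Res \<Lambda>) K' M' i) \<kappa>"
      unfolding Prefrag_simps Modcat_cmp
      by (intro mkarr_cong) (simp add: \<mu>_def \<kappa>_def i_def Res_simps Ob_Fcat Fbar_simps K'_def S_fin t_closed)
    then show "fmap \<phi> K M' (cmp GL K M M' (roof \<mu> M M') f) =
        fmap \<phi> K M' (cmp GL K K' M' (q K' M' i) (roof \<kappa> K K'))"
      using \<phi>_cmp[OF K M M' f r(2)] \<phi>_cmp[OF K K' M' r(1) qi] \<phi>_q[OF K' M' i]
        \<phi>_roof[OF M M' \<mu>P] \<phi>_roof[OF K K' \<kappa>P] by (simp add: t_def)
  qed (rule GL.cmp_in[OF ob(1,2,5) f r(2)] GL.cmp_in[OF ob(1,4,5) r(1) qi])+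
  moreover have "cmp GL M N N' (roof \<nu> N N') g = cmp GL M M' N' (q M' N' p) (roof \<mu> M M')"
  proof (rule \<phi>_faithful[OF M N'])
    \<comment> \<open>Both composites have the value \<open>u \<alpha> x\<close>:
      \<open>\<nu>\<close> does not change it, and it is the second coordinate of the point over
      \<open>x\<close>.\<close>
    have "cmp PF (rs M) (rs N) (rs N') \<nu> u = cmp PF (rs M) (rs M') (rs N') (fmap (Res \<Lambda>) M' N' p) \<mu>"
      unfolding Prefrag_simps Modcat_cmp using Modcat_arr_closed[OF u']
      by (intro mkarr_cong) (simp add: \<mu>_def \<nu>_def Res_simps Ob_Fcat p_fin M'_fin)
    then show "fmap \<phi> M N' (cmp GL M N N' (roof \<nu> N N') g) =
        fmap \<phi> M N' (cmp GL M M' N' (q M' N' p) (roof \<mu> M M'))"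
      using \<phi>_cmp[OF M N N' g r(3)] \<phi>_cmp[OF M M' N' r(2) qp] \<phi>_q[OF M' N' p']
        \<phi>_roof[OF M M' \<mu>P] \<phi>_roof[OF N N' \<nu>P] by (simp add: u_def)
  qed (rule GL.cmp_in[OF ob(2,3,6) g r(3)] GL.cmp_in[OF ob(2,5,6) r(2) qp])+
  ultimately have "iso_sequences GL K f M g N K' (q K' M' i) M' (q M' N' p) N'"
    using iso unfolding iso_sequences_def by blast
  then show ?thesis
    unfolding conflation_Glid_def Let_def fob_Q using ob f g conf' by blast
qed

end

theorem proposition5p8:
  fixes \<Gamma> :: "'g ogroup" and R :: "'r ring" and F :: "'g \<Rightarrow> 'r set" and \<Lambda> :: "'g set"
    and \<phi> :: "(('g, 'r, 'm) preglid, ('g, 'r, 'm) glid_arr,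
              ('g, 'r, 'm) prefrag, ('g, 'm) prefrag_arr) fctr"
    and K M N :: "('g, 'r, 'm) preglid" and f g :: "('g, 'r, 'm) glid_arr"
  assumes "infinite (UNIV :: 'm set)"
    and "filtered_ring \<Gamma> R F" and "\<Lambda> \<subseteq> carrier \<Gamma>"
    and "is_glid_embedding \<Gamma> R F \<Lambda> \<phi>"
    and "K \<in> Ob (Glid \<Gamma> R F \<Lambda>)" and "M \<in> Ob (Glid \<Gamma> R F \<Lambda>)" and "N \<in> Ob (Glid \<Gamma> R F \<Lambda>)"
    and "f \<in> Hom (Glid \<Gamma> R F \<Lambda>) K M" and "g \<in> Hom (Glid \<Gamma> R F \<Lambda>) M N"
  shows "conflation_Glid \<Gamma> R F \<Lambda> K f M g N \<longleftrightarrow>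
    conflation_Prefrag \<Gamma> R F \<Lambda> (fob \<phi> K) (fmap \<phi> K M f) (fob \<phi> M) (fmap \<phi> M N g) (fob \<phi> N)"
proof -
  \<comment> \<open>Any pairing will do: the graph modules depend on it, but neither side of the
    equivalence mentions it.\<close>
  obtain pair :: "'m \<Rightarrow> 'm \<Rightarrow> 'm" and p1 p2 where "pairing pair p1 p2"
    using infinite_pairing[OF assms(1)] .
  then interpret glids \<Gamma> R F pair p1 p2 \<Lambda> \<phi>
    using assms(2-4) by (simp add: glids_def glids_axioms_def)
  show ?thesis
    using assms(5-9) conflation_Glid_imp_Prefrag conflation_Prefrag_imp_Glid
    by (auto simp: GL_Ob \<phi>_fob)
qed

end
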